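(* Let $\Bbbk$ be a field of characteristic $0$, let $(P,\cdot,[-,-],\Delta,\delta)$ be a finite-dimensional Poisson bialgebra over $\Bbbk$, let $(B=\bigoplus_{i\in\mathbb Z}B_i,\circ_B,\omega)$ be a quadratic $\mathbb Z$-graded perm algebra, and let $(P\otimes B,\circ,\ast,\nu,\vartheta)$ be the induced completed DPP bialgebra, i.e. $(p_1\otimes b_1)\circ(p_2\otimes b_2)=(p_1p_2)\otimes(b_1\circ_B b_2)$, $(p_1\otimes b_1)\ast(p_2\otimes b_2)=[p_1,p_2]\otimes(b_1\circ_B b_2)$, $\nu(p\otimes b)=\Delta(p)\bullet\nu_\omega(b)$, $\vartheta(p\otimes b)=\delta(p)\bullet\nu_\omega(b)$. If $\Delta=\Delta_r$ and $\delta=\delta_r$ for some $r=\sum_i x_i\otimes y_i\in P\otimes P$, then $\nu=\nu_{\widehat r}$ and $\vartheta=\vartheta_{\widehat r}$, where $$\widehat r=\sum_i\sum_{j\in\Omega}(x_i\otimes e_j)\otimes(y_i\otimes f_j)\in(P\otimes B)\,\hat\otimes\,(P\otimes B),$$ $\{e_j\}_{j\in\Omega}$ is a basis of $B$ of homogeneous elements and $\{f_j\}_{j\in\Omega}$ is the homogeneous dual basis with respect to $\omega$, i.e. $\omega(f_i,e_j)=\delta_{ij}$. In particular, $(P\otimes B,\circ,\ast,\nu,\vartheta)$ is a coboundary (resp. quasi-triangular, triangular) completed DPP bialgebra if $(P,\cdot,[-,-],\Delta,\delta)$ is coboundary (resp. quasi-triangular, triangular).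
   Context: **Poisson bialgebras.** A Poisson algebra $(P,\cdot,[-,-])$ is a commutative associative (not necessarily unital) algebra and a Lie algebra with $[p_1,p_2p_3]=[p_1,p_2]p_3+p_2[p_1,p_3]$. Let $u(p)q=pq$, $\mathrm{ad}(p)q=[p,q]$, $\tau(x\otimes y)=y\otimes x$. A Poisson coalgebra $(P,\Delta,\delta)$ satisfies: $\tau\Delta=\Delta$, $(\Delta\otimes\mathrm{id})\Delta=(\mathrm{id}\otimes\Delta)\Delta$, $\tau\delta=-\delta$, $(\mathrm{id}\otimes\delta)\delta-(\tau\otimes\mathrm{id})(\mathrm{id}\otimes\delta)\delta=(\delta\otimes\mathrm{id})\delta$, $(\mathrm{id}\otimes\Delta)\delta=(\delta\otimes\mathrm{id})\Delta+(\tau\otimes\mathrm{id})(\mathrm{id}\otimes\delta)\Delta$. A Poisson bialgebra is a Poisson algebra and Poisson coalgebra such that for all $p_1,p_2$: $\Delta(p_1p_2)=(u(p_2)\otimes\mathrm{id})\Delta(p_1)+(\mathrm{id}\otimes u(p_1))\Delta(p_2)$; $\delta([p_1,p_2])=(\mathrm{ad}(p_1)\otimes\mathrm{id}+\mathrm{id}\otimes\mathrm{ad}(p_1))\delta(p_2)-(\mathrm{ad}(p_2)\otimes\mathrm{id}+\mathrm{id}\otimes\mathrm{ad}(p_2))\delta(p_1)$; $\Delta([p_1,p_2])=(\mathrm{ad}(p_1)\otimes\mathrm{id}+\mathrm{id}\otimes\mathrm{ad}(p_1))\Delta(p_2)+(u(p_2)\otimes\mathrm{id}-\mathrm{id}\otimes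 u(p_2))\delta(p_1)$; $\delta(p_1p_2)=(u(p_1)\otimes\mathrm{id})\delta(p_2)+(u(p_2)\otimes\mathrm{id})\delta(p_1)+(\mathrm{id}\otimes\mathrm{ad}(p_1))\Delta(p_2)+(\mathrm{id}\otimes\mathrm{ad}(p_2))\Delta(p_1)$. For $r\in P\otimes P$: $\Delta_r(p)=(\mathrm{id}\otimes u(p)-u(p)\otimes\mathrm{id})(r)$, $\delta_r(p)=(\mathrm{id}\otimes\mathrm{ad}(p)+\mathrm{ad}(p)\otimes\mathrm{id})(r)$. $r$ is Poi-invariant if $\Delta_r=\delta_r=0$. For $r=\sum_i x_i\otimes y_i$ the PoiYBE is the pair $\mathbf A_r=\sum_{i,j}(x_ix_j\otimes y_i\otimes y_j+x_i\otimes x_j\otimes y_iy_j-x_j\otimes x_iy_j\otimes y_i)=0$, $\mathbf C_r=\sum_{i,j}([x_i,x_j]\otimes y_i\otimes y_j+x_i\otimes x_j\otimes[y_i,y_j]+x_i\otimes[y_i,x_j]\otimes y_j)=0$. The Poisson bialgebra is coboundary if $\Delta=\Delta_r,\delta=\delta_r$ for some $r\in P\otimes P$; quasi-triangular if such an $r$ can be taken to be a solution of the PoiYBE with $r+\tau(r)$ Poi-invariant; triangular if such an $r$ can be taken to be a skew-symmetric ($\tau(r)=-r$) solution of the PoiYBE. **Algebras.** A perm algebra $(B,\circ)$ satisfies $b_1\circ(b_2\circ b_3)=(b_1\circ b_2)\circ b_3=(b_2\circ b_1)\circ b_3$; a (left) Leibniz algebra satisfies $a_1\ast(a_2\ast a_3)=(a_1\ast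 a_2)\ast a_3+a_2\ast(a_1\ast a_3)$. A DPP algebra $(A,\circ,\ast)$ is a perm algebra and a Leibniz algebra with $(a_1\circ a_2)\ast a_3=a_1\circ(a_2\ast a_3)+a_2\circ(a_1\ast a_3)$ and $(a_1\ast a_2)\circ a_3=a_1\ast(a_2\circ a_3)-a_2\circ(a_1\ast a_3)=-(a_2\ast a_1)\circ a_3$. It is $\mathbb Z$-graded if $A=\bigoplus_iA_i$ with every $A_i$ finite-dimensional, $A_i\circ A_j\subseteq A_{i+j}$, $A_i\ast A_j\subseteq A_{i+j}$; similarly for perm algebras. $(P\otimes B)_i=P\otimes B_i$. A quadratic $\mathbb Z$-graded perm algebra $(B,\circ_B,\omega)$ is a $\mathbb Z$-graded perm algebra with a skew-symmetric nondegenerate bilinear form $\omega$ with $\omega(b_1\circ_B b_2,b_3)=\omega(b_1,b_2\circ_B b_3-b_3\circ_B b_2)$ and, for some $m\in\mathbb Z$, $\omega(B_i,B_j)=0$ whenever $i+j+m\neq0$. **Completed tensor products.** For $\mathbb Z$-graded $U,V$, $U\hat\otimes V=\prod_{i,j}U_i\otimes V_j$, elements written as formal sums $\sum_{i,j,\alpha}u_{i,\alpha}\otimes v_{j,\alpha}$; similarly for more factors. $f\hat\otimes g$, the flip $\hat\tau$, and composites such as $(\nu\hat\otimes\mathrm{id})\nu$ are defined termwise (each homogeneous component is required to receive only finitely many nonzero contributions). $\hat\omega(\sum x_{i,\alpha}\otimes y_{j,\alpha},b\otimes b')=\sum\omega(x_{i,\alpha},b)\omega(y_{j,\alpha},b')$.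 $\nu_\omega:B\to B\hat\otimes B$ is determined by $\hat\omega(\nu_\omega(b_1),b_2\otimes b_3)=-\omega(b_1,b_2\circ_B b_3)$. $(\sum_l p'_l\otimes p''_l)\bullet(\sum b_{1,i,\alpha}\otimes b_{2,j,\alpha})=\sum(p'_l\otimes b_{1,i,\alpha})\otimes(p''_l\otimes b_{2,j,\alpha})$. **Completed DPP bialgebras.** A completed DPP coalgebra $(A,\nu,\vartheta)$: $A$ $\mathbb Z$-graded, $\nu,\vartheta:A\to A\hat\otimes A$ linear, $(\nu\hat\otimes\mathrm{id})\nu=(\mathrm{id}\hat\otimes\nu)\nu=(\hat\tau\hat\otimes\mathrm{id})(\nu\hat\otimes\mathrm{id})\nu$, $(\mathrm{id}\hat\otimes\vartheta)\vartheta=(\vartheta\hat\otimes\mathrm{id})\vartheta+(\hat\tau\hat\otimes\mathrm{id})(\mathrm{id}\hat\otimes\vartheta)\vartheta$, $(\mathrm{id}\hat\otimes\nu)\vartheta=(\vartheta\hat\otimes\mathrm{id})\nu+(\hat\tau\hat\otimes\mathrm{id})(\mathrm{id}\hat\otimes\vartheta)\nu$, $(\nu\hat\otimes\mathrm{id})\vartheta=(\mathrm{id}\hat\otimes\vartheta)\nu+(\hat\tau\hat\otimes\mathrm{id})(\mathrm{id}\hat\otimes\vartheta)\nu$, $(\vartheta\hat\otimes\mathrm{id})\nu=-(\hat\tau\hat\otimes\mathrm{id})(\vartheta\hat\otimes\mathrm{id})\nu$. Write $L(a)b=a\circ b$, $R(a)b=b\circ a$, $\tilde L(a)b=a\ast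 b$, $\tilde R(a)b=b\ast a$, $\nu^-=\nu-\hat\tau\nu$, $\vartheta^+=\vartheta+\hat\tau\vartheta$. A completed DPP bialgebra $(A,\circ,\ast,\nu,\vartheta)$ is a $\mathbb Z$-graded DPP algebra with a completed DPP coalgebra such that for all $a_1,a_2\in A$: (perm bialgebra) $(R(a_1)\hat\otimes\mathrm{id})\nu(a_2)=\hat\tau((R(a_2)\hat\otimes\mathrm{id})\nu(a_1))$; $\nu(a_1\circ a_2)=((L-R)(a_1)\hat\otimes\mathrm{id})\nu(a_2)+(\mathrm{id}\hat\otimes R(a_2))\nu(a_1)$; $\nu(a_1\circ a_2)=(\mathrm{id}\hat\otimes L(a_1))\nu(a_2)+((L-R)(a_2)\hat\otimes\mathrm{id})\nu^-(a_1)$; (Leibniz bialgebra) $\hat\tau((\tilde R(a_2)\hat\otimes\mathrm{id})\vartheta(a_1))=(\tilde R(a_1)\hat\otimes\mathrm{id})\vartheta(a_2)$; $\vartheta(a_1\ast a_2)=(\mathrm{id}\hat\otimes\tilde R(a_2)-(\tilde L+\tilde R)(a_2)\hat\otimes\mathrm{id})\vartheta^+(a_1)+(\mathrm{id}\hat\otimes\tilde L(a_1)+\tilde L(a_1)\hat\otimes\mathrm{id})\vartheta(a_2)$; 1. $\nu(a_1\ast a_2)=(\mathrm{id}\hat\otimes\tilde L(a_1)+\tilde L(a_1)\hat\otimes\mathrm{id})\nu(a_2)+((L-R)(a_2)\hat\otimes\mathrm{id}-\mathrm{id}\hat\otimes R(a_2))\vartheta^+(a_1)$; 2. $\vartheta(a_1\circ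 a_2)=(\mathrm{id}\hat\otimes L(a_1))\vartheta(a_2)+(\mathrm{id}\hat\otimes R(a_2))\vartheta(a_1)-((\tilde L+\tilde R)(a_1)\hat\otimes\mathrm{id})\nu(a_2)-((\tilde L+\tilde R)(a_2)\hat\otimes\mathrm{id})\nu^-(a_1)$; 3. $(\mathrm{id}\hat\otimes\tilde R(a_1))\hat\tau\nu(a_2)=-(R(a_2)\hat\otimes\mathrm{id})\vartheta(a_1)$; 4. $\nu(a_1\ast a_2)=(\mathrm{id}\hat\otimes L(a_1)-L(a_1)\hat\otimes\mathrm{id})\vartheta(a_2)+(\mathrm{id}\hat\otimes\tilde R(a_2)-(\tilde L+\tilde R)(a_2)\hat\otimes\mathrm{id})\nu^-(a_1)$; 5. $\vartheta^+(a_1\circ a_2)=(\mathrm{id}\hat\otimes L(a_1))\vartheta^+(a_2)+(\mathrm{id}\hat\otimes L(a_2))\vartheta^+(a_1)-(\tilde L(a_1)\hat\otimes\mathrm{id})\nu^-(a_2)-(\tilde L(a_2)\hat\otimes\mathrm{id})\nu^-(a_1)$; 6. $\vartheta(a_1\circ a_2)=(L(a_1)\hat\otimes\mathrm{id})\vartheta(a_2)-(\mathrm{id}\hat\otimes\tilde R(a_2))\nu^-(a_1)+(\mathrm{id}\hat\otimes\tilde L(a_1))\nu(a_2)+((L-R)(a_2)\hat\otimes\mathrm{id})\vartheta^+(a_1)$; 7. $\nu(a_1\ast a_2+a_2\ast a_1)=(\mathrm{id}\hat\otimes(\tilde L+\tilde R)(a_1))\nu(a_2)+((\tilde L+\tilde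 R)(a_1)\hat\otimes\mathrm{id})\hat\tau\nu(a_2)+(\mathrm{id}\hat\otimes(L-R)(a_2))\vartheta(a_1)+((L-R)(a_2)\hat\otimes\mathrm{id})\hat\tau\vartheta(a_1)$. For $s\in A\hat\otimes A$: $\nu_s(a)=(\mathrm{id}\hat\otimes R(a)+(R-L)(a)\hat\otimes\mathrm{id})(s)$, $\vartheta_s(a)=((\tilde L+\tilde R)(a)\hat\otimes\mathrm{id}-\mathrm{id}\hat\otimes\tilde R(a))(s)$; $s$ is DP-invariant if $\nu_s=\vartheta_s=0$. Writing $s=\sum_\alpha x_\alpha\otimes y_\alpha$ (formal sum of homogeneous pure tensors), $s$ is a completed solution of the DPYBE if, in $A\hat\otimes A\hat\otimes A$, $\sum_{\alpha,\beta}\big(x_\alpha\otimes(y_\alpha\circ x_\beta)\otimes y_\beta-x_\alpha\otimes x_\beta\otimes(y_\alpha\circ y_\beta)+(x_\alpha\circ x_\beta)\otimes y_\alpha\otimes y_\beta-(x_\alpha\circ x_\beta)\otimes y_\beta\otimes y_\alpha\big)=0$ and $\sum_{\alpha,\beta}\big((x_\alpha\ast x_\beta)\otimes y_\alpha\otimes y_\beta-x_\alpha\otimes(y_\alpha\ast x_\beta)\otimes y_\beta-x_\beta\otimes(x_\alpha\ast y_\beta)\otimes y_\alpha+x_\beta\otimes x_\alpha\otimes(y_\alpha\ast y_\beta)\big)=0$. A completed DPP bialgebra is coboundary if $\nu=\nu_s,\vartheta=\vartheta_s$ for some $s\in A\hat\otimes A$; quasi-triangular if such an $s$ can be taken to be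 a completed solution of the DPYBE with $s-\hat\tau(s)$ DP-invariant; triangular if such an $s$ can be taken to be a symmetric ($\hat\tau(s)=s$) completed solution of the DPYBE. *)

theory Defs
  imports Complex_Main "HOL-Library.Function_Algebras"
begin

section \<open>Tensor products\<close>

definition bilinear_map ::
    "('k::field \<Rightarrow> 'u::ab_group_add \<Rightarrow> 'u) \<Rightarrow> ('k \<Rightarrow> 'v::ab_group_add \<Rightarrow> 'v) \<Rightarrow>
     ('k \<Rightarrow> 'w::ab_group_add \<Rightarrow> 'w) \<Rightarrow> ('u \<Rightarrow> 'v \<Rightarrow> 'w) \<Rightarrow> bool" where
  "bilinear_map sU sV sW f \<longleftrightarrow>
     (\<forall>u. Vector_Spaces.linear sV sW (f u)) \<and> (\<forall>v. Vector_Spaces.linear sU sW (\<lambda>u. f u v))"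

definition trilinear_form ::
    "('k::field \<Rightarrow> 'v::ab_group_add \<Rightarrow> 'v) \<Rightarrow> ('v \<Rightarrow> 'v \<Rightarrow> 'v \<Rightarrow> 'k) \<Rightarrow> bool" where
  "trilinear_form s \<beta> \<longleftrightarrow>
     (\<forall>y z. Vector_Spaces.linear s (*) (\<lambda>x. \<beta> x y z)) \<and>
     (\<forall>x z. Vector_Spaces.linear s (*) (\<lambda>y. \<beta> x y z)) \<and>
     (\<forall>x y. Vector_Spaces.linear s (*) (\<lambda>z. \<beta> x y z))"

text \<open>
  The vector space \<open>T\<close> together with \<open>tens :: V \<times> W \<rightarrow> T\<close> is a tensor product of \<open>V\<close> and \<open>W\<close>.
  HOL cannot quantify over the target space of the universal property inside a formula, so
  it is required for the target \<open>k\<close> only, uniqueness being the spanning condition;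
  lemma \<open>tensor_product_universal\<close> below derives it for every target.
\<close>
definition tensor_product ::
    "('k::field \<Rightarrow> 'v::ab_group_add \<Rightarrow> 'v) \<Rightarrow> ('k \<Rightarrow> 'w::ab_group_add \<Rightarrow> 'w) \<Rightarrow>
     ('k \<Rightarrow> 't::ab_group_add \<Rightarrow> 't) \<Rightarrow> ('v \<Rightarrow> 'w \<Rightarrow> 't) \<Rightarrow> bool" where
  "tensor_product sV sW sT tens \<longleftrightarrow>
     bilinear_map sV sW sT tens \<and>
     module.span sT {tens v w | v w. True} = UNIV \<and>
     (\<forall>\<beta>. bilinear_map sV sW (*) \<beta> \<longrightarrow>
        (\<exists>h. Vector_Spaces.linear sT (*) h \<and> (\<forall>v w. h (tens v w) = \<beta> v w)))"

text \<open>
  The powers \<open>V \<otimes> V\<close> and \<open>V \<otimes> V \<otimes> V\<close> are realised concretely: \<open>t = \<Sum>\<^sub>l x\<^sub>l \<otimes> y\<^sub>l\<close> is the functional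
  \<open>\<beta> \<mapsto> \<Sum>\<^sub>l \<beta> x\<^sub>l y\<^sub>l\<close> on bilinear forms \<open>\<beta>\<close> (extended by 0 to all functions \<open>\<beta>\<close>).
  The span \<open>tprod UNIV UNIV\<close> of the pure tensors meets the requirements of \<open>tensor_product\<close>, the
  linear form extending \<open>\<beta>\<close> being evaluation at \<open>\<beta>\<close>. Trilinear forms encode \<open>V \<otimes> V \<otimes> V\<close>.
\<close>
type_synonym ('v, 'k) tensor2 = "('v \<Rightarrow> 'v \<Rightarrow> 'k) \<Rightarrow> 'k"
type_synonym ('v, 'k) tensor3 = "('v \<Rightarrow> 'v \<Rightarrow> 'v \<Rightarrow> 'k) \<Rightarrow> 'k"

definition fscale :: "'k::field \<Rightarrow> ('x \<Rightarrow> 'k) \<Rightarrow> 'x \<Rightarrow> 'k" where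
  "fscale c t = (\<lambda>\<beta>. c * t \<beta>)"

text \<open>
  For \<open>t = \<Sum>\<^sub>l x\<^sub>l \<otimes> y\<^sub>l\<close> and a tensor-valued bilinear map \<open>F\<close>, \<open>tsum2 t F\<close> is \<open>\<Sum>\<^sub>l F x\<^sub>l y\<^sub>l\<close>,
  i.e. the image of \<open>t\<close> under the linear map induced by \<open>F\<close>
  (see \<open>tsum2_pure2\<close>, \<open>tsum2_add\<close> and \<open>tsum2_scale\<close>).
\<close>
definition tsum2 :: "('v, 'k) tensor2 \<Rightarrow> ('v \<Rightarrow> 'v \<Rightarrow> 'x \<Rightarrow> 'k) \<Rightarrow> 'x \<Rightarrow> 'k" where
  "tsum2 t F = (\<lambda>\<beta>. t (\<lambda>x y. F x y \<beta>))"

definition tsum3 :: "('v, 'k) tensor3 \<Rightarrow> ('v \<Rightarrow> 'v \<Rightarrow> 'v \<Rightarrow> 'x \<Rightarrow> 'k) \<Rightarrow> 'x \<Rightarrow> 'k" where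
  "tsum3 t F = (\<lambda>\<beta>. t (\<lambda>x y z. F x y z \<beta>))"

locale tensor_powers = vector_space scale
  for scale :: "'k::field \<Rightarrow> 'v::ab_group_add \<Rightarrow> 'v"
begin

definition pure2 :: "'v \<Rightarrow> 'v \<Rightarrow> ('v, 'k) tensor2" where
  "pure2 x y = (\<lambda>\<beta>. if bilinear_map scale scale (*) \<beta> then \<beta> x y else 0)"

definition pure3 :: "'v \<Rightarrow> 'v \<Rightarrow> 'v \<Rightarrow> ('v, 'k) tensor3" where
  "pure3 x y z = (\<lambda>\<beta>. if trilinear_form scale \<beta> then \<beta> x y z else 0)"

definition tprod :: "'v set \<Rightarrow> 'v set \<Rightarrow> ('v, 'k) tensor2 set" where
  "tprod V W = module.span fscale {pure2 x y | x y. x \<in> V \<and> y \<in> W}"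

definition flip :: "('v, 'k) tensor2 \<Rightarrow> ('v, 'k) tensor2" where
  "flip t = tsum2 t (\<lambda>x y. pure2 y x)"

text \<open>\<open>\<tau> \<otimes> id\<close>\<close>
definition flip12 :: "('v, 'k) tensor3 \<Rightarrow> ('v, 'k) tensor3" where
  "flip12 t = tsum3 t (\<lambda>x y z. pure3 y x z)"

text \<open>\<open>f \<otimes> g\<close> for linear \<open>f, g : V \<rightarrow> V\<close>; \<open>f \<otimes> id\<close> and \<open>id \<otimes> f\<close> for linear \<open>f : V \<rightarrow> V \<otimes> V\<close>\<close>
definition map2 :: "('v \<Rightarrow> 'v) \<Rightarrow> ('v \<Rightarrow> 'v) \<Rightarrow> ('v, 'k) tensor2 \<Rightarrow> ('v, 'k) tensor2" where
  "map2 f g t = tsum2 t (\<lambda>x y. pure2 (f x) (g y))"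

definition lmap3 :: "('v \<Rightarrow> ('v, 'k) tensor2) \<Rightarrow> ('v, 'k) tensor2 \<Rightarrow> ('v, 'k) tensor3" where
  "lmap3 f t = tsum2 t (\<lambda>x y. tsum2 (f x) (\<lambda>x' x''. pure3 x' x'' y))"

definition rmap3 :: "('v \<Rightarrow> ('v, 'k) tensor2) \<Rightarrow> ('v, 'k) tensor2 \<Rightarrow> ('v, 'k) tensor3" where
  "rmap3 f t = tsum2 t (\<lambda>x y. tsum2 (f y) (\<lambda>y' y''. pure3 x y' y''))"

end

subsection \<open>Adequacy of the encodings\<close>

lemma vector_space_fscale: "vector_space (fscale :: 'k::field \<Rightarrow> ('x \<Rightarrow> 'k) \<Rightarrow> 'x \<Rightarrow> 'k)"
  by unfold_locales (auto simp: fscale_def fun_eq_iff algebra_simps)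

lemma vector_space_mult: "vector_space ((*) :: 'k::field \<Rightarrow> 'k \<Rightarrow> 'k)"
  by unfold_locales (auto simp: algebra_simps)

lemma (in tensor_powers) bilinear_map_pure2: "bilinear_map scale scale fscale pure2"
proof -
  interpret F: vector_space "fscale :: 'k \<Rightarrow> ('v, 'k) tensor2 \<Rightarrow> ('v, 'k) tensor2"
    by (rule vector_space_fscale)
  have "Vector_Spaces.linear scale fscale (pure2 u)"
    and "Vector_Spaces.linear scale fscale (\<lambda>u. pure2 u v)" for u v
    by (unfold_locales;
        force simp: pure2_def fscale_def fun_eq_iff bilinear_map_def Vector_Spaces.linear_iff)+
  then show ?thesis
    by (simp add: bilinear_map_def)
qed

lemma (in tensor_powers) tsum2_pure2:
  assumes "bilinear_map scale scale fscale F"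
  shows "tsum2 (pure2 x y) F = F x y"
proof -
  have "bilinear_map scale scale (*) (\<lambda>x y. F x y \<beta>)" for \<beta>
    using assms vector_space_mult
    by (auto simp: bilinear_map_def Vector_Spaces.linear_iff fscale_def)
  then show ?thesis
    by (simp add: tsum2_def pure2_def)
qed

lemma tsum2_add: "tsum2 (s + t) F = tsum2 s F + tsum2 t F"
  by (simp add: tsum2_def fun_eq_iff)

lemma tsum2_scale: "tsum2 (fscale c t) F = fscale c (tsum2 t F)"
  by (simp add: tsum2_def fscale_def)

lemma tensor_product_universal:
  assumes T: "tensor_product sV sW sT tens" and f: "bilinear_map sV sW sX f"
  shows "\<exists>!h. Vector_Spaces.linear sT sX h \<and> (\<forall>v w. h (tens v w) = f v w)"
proof -
  define S where "S = {tens v w | v w. True}"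
  have bil: "bilinear_map sV sW sT tens" and span: "module.span sT S = UNIV"
    and form: "\<And>\<beta>. bilinear_map sV sW (*) \<beta> \<Longrightarrow>
      \<exists>h. Vector_Spaces.linear sT (*) h \<and> (\<forall>v w. h (tens v w) = \<beta> v w)"
    using T by (auto simp: tensor_product_def S_def)
  interpret T: vector_space sT
    using bil by (auto simp: bilinear_map_def Vector_Spaces.linear_iff)
  interpret X: vector_space sX
    using f by (auto simp: bilinear_map_def Vector_Spaces.linear_iff)
  interpret k: vector_space "(*) :: 'a \<Rightarrow> 'a \<Rightarrow> 'a"
    by (rule vector_space_mult)
  interpret TX: vector_space_pair sT sX ..
  interpret Xk: vector_space_pair sX "(*) :: 'a \<Rightarrow> 'a \<Rightarrow> 'a" ..
  interpret Tk: vector_space_pair sT "(*) :: 'a \<Rightarrow> 'a \<Rightarrow> 'a" ..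
  obtain B where B: "B \<subseteq> S" "T.independent B" "S \<subseteq> T.span B"
    using T.maximal_independent_subset by metis
  have spanB: "T.span B = UNIV"
    using T.span_mono[OF B(3)] span by (auto simp: T.span_span)
  have "\<forall>t \<in> B. \<exists>v w. t = tens v w"
    using B(1) by (auto simp: S_def)
  then obtain a b where ab: "\<And>t. t \<in> B \<Longrightarrow> t = tens (a t) (b t)"
    by metis
  obtain h where h: "Vector_Spaces.linear sT sX h" "\<And>t. t \<in> B \<Longrightarrow> h t = f (a t) (b t)"
    using TX.linear_independent_extend[OF B(2), of "\<lambda>t. f (a t) (b t)"] by metis
  have "h (tens v w) = f v w" for v w
  proof (rule ccontr)
    define d where "d = h (tens v w) - f v w"
    assume "h (tens v w) \<noteq> f v w"
    then have "X.independent {d}"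
      by (simp add: d_def X.dependent_single)
    then obtain \<psi> where psi: "Vector_Spaces.linear sX (*) \<psi>" "\<psi> d = 1"
      using Xk.linear_independent_extend[of "{d}" "\<lambda>_. 1"] by auto
    have "bilinear_map sV sW (*) (\<lambda>v w. \<psi> (f v w))"
      using f psi(1) by (auto simp: bilinear_map_def Vector_Spaces.linear_iff)
    then obtain g where g: "Vector_Spaces.linear sT (*) g" "\<And>v w. g (tens v w) = \<psi> (f v w)"
      using form by metis
    have lin: "Vector_Spaces.linear sT (*) (\<lambda>t. \<psi> (h t))"
      using h(1) psi(1) by (auto simp: Vector_Spaces.linear_iff)
    have "\<psi> (h t) = g t" if "t \<in> B" for t
      using g(2)[of "a t" "b t"] ab[OF that] h(2)[OF that] by simp
    then have "\<psi> (h t) = g t" for t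
      using Tk.linear_eq_on[OF lin g(1), of t B] spanB by simp
    then have "\<psi> d = 0"
      using psi(1) g(2) by (simp add: d_def Xk.linear_diff)
    with psi(2) show False by simp
  qed
  moreover have "h' = h" if "Vector_Spaces.linear sT sX h'" "\<forall>v w. h' (tens v w) = f v w" for h'
  proof
    fix t
    have "h' t = h t" if "t \<in> S" for t
      using that \<open>\<forall>v w. h' (tens v w) = f v w\<close> \<open>\<And>v w. h (tens v w) = f v w\<close>
      by (auto simp: S_def)
    then show "h' t = h t"
      using TX.linear_eq_on[OF that(1) h(1), of t S] span by simp
  qed
  ultimately show ?thesis
    using h(1) by blast
qed

section \<open>Poisson bialgebras\<close>

locale poisson_algebra = tensor_powers scale
  for scale :: "'k::field \<Rightarrow> 'p::ab_group_add \<Rightarrow> 'p" +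
  fixes mul :: "'p \<Rightarrow> 'p \<Rightarrow> 'p" (infixl "\<cdot>" 70)
    and brk :: "'p \<Rightarrow> 'p \<Rightarrow> 'p"
  assumes mul_bilinear: "bilinear_map scale scale scale mul"
    and mul_comm: "p \<cdot> q = q \<cdot> p"
    and mul_assoc: "(p1 \<cdot> p2) \<cdot> p3 = p1 \<cdot> (p2 \<cdot> p3)"
    and brk_bilinear: "bilinear_map scale scale scale brk"
    and brk_alternating: "brk p p = 0"
    and brk_jacobi: "brk p1 (brk p2 p3) + brk p2 (brk p3 p1) + brk p3 (brk p1 p2) = 0"
    and brk_mul: "brk p1 (p2 \<cdot> p3) = brk p1 p2 \<cdot> p3 + p2 \<cdot> brk p1 p3"
begin

definition Delta_of :: "('p, 'k) tensor2 \<Rightarrow> 'p \<Rightarrow> ('p, 'k) tensor2" where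
  "Delta_of r p = map2 id (mul p) r - map2 (mul p) id r"

definition delta_of :: "('p, 'k) tensor2 \<Rightarrow> 'p \<Rightarrow> ('p, 'k) tensor2" where
  "delta_of r p = map2 id (brk p) r + map2 (brk p) id r"

definition poi_invariant :: "('p, 'k) tensor2 \<Rightarrow> bool" where
  "poi_invariant r \<longleftrightarrow> (\<forall>p. Delta_of r p = 0) \<and> (\<forall>p. delta_of r p = 0)"

definition YBE_A :: "('p, 'k) tensor2 \<Rightarrow> ('p, 'k) tensor3" where
  "YBE_A r = tsum2 r (\<lambda>xi yi. tsum2 r (\<lambda>xj yj.
     pure3 (xi \<cdot> xj) yi yj + pure3 xi xj (yi \<cdot> yj) - pure3 xj (xi \<cdot> yj) yi))"

definition YBE_C :: "('p, 'k) tensor2 \<Rightarrow> ('p, 'k) tensor3" where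
  "YBE_C r = tsum2 r (\<lambda>xi yi. tsum2 r (\<lambda>xj yj.
     pure3 (brk xi xj) yi yj + pure3 xi xj (brk yi yj) + pure3 xi (brk yi xj) yj))"

definition PoiYBE :: "('p, 'k) tensor2 \<Rightarrow> bool" where
  "PoiYBE r \<longleftrightarrow> YBE_A r = 0 \<and> YBE_C r = 0"

end

locale poisson_coalgebra = tensor_powers scale
  for scale :: "'k::field \<Rightarrow> 'p::ab_group_add \<Rightarrow> 'p" +
  fixes \<Delta> \<delta> :: "'p \<Rightarrow> ('p, 'k) tensor2"
  assumes Delta_in: "\<Delta> p \<in> tprod UNIV UNIV"
    and delta_in: "\<delta> p \<in> tprod UNIV UNIV"
    and Delta_linear: "Vector_Spaces.linear scale fscale \<Delta>"
    and delta_linear: "Vector_Spaces.linear scale fscale \<delta>"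
    and Delta_cocomm: "flip (\<Delta> p) = \<Delta> p"
    and Delta_coassoc: "lmap3 \<Delta> (\<Delta> p) = rmap3 \<Delta> (\<Delta> p)"
    and delta_coskew: "flip (\<delta> p) = - \<delta> p"
    and delta_cojacobi: "rmap3 \<delta> (\<delta> p) - flip12 (rmap3 \<delta> (\<delta> p)) = lmap3 \<delta> (\<delta> p)"
    and coLeibniz: "rmap3 \<Delta> (\<delta> p) = lmap3 \<delta> (\<Delta> p) + flip12 (rmap3 \<delta> (\<Delta> p))"

locale poisson_bialgebra =
  poisson_algebra scale mul brk + poisson_coalgebra scale \<Delta> \<delta>
  for scale :: "'k::field \<Rightarrow> 'p::ab_group_add \<Rightarrow> 'p"
    and mul :: "'p \<Rightarrow> 'p \<Rightarrow> 'p" (infixl "\<cdot>" 70)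
    and brk :: "'p \<Rightarrow> 'p \<Rightarrow> 'p"
    and \<Delta> \<delta> :: "'p \<Rightarrow> ('p, 'k) tensor2" +
  assumes Delta_mul: "\<Delta> (p1 \<cdot> p2) = map2 (mul p2) id (\<Delta> p1) + map2 id (mul p1) (\<Delta> p2)"
    and delta_brk: "\<delta> (brk p1 p2) =
      (map2 (brk p1) id (\<delta> p2) + map2 id (brk p1) (\<delta> p2)) -
      (map2 (brk p2) id (\<delta> p1) + map2 id (brk p2) (\<delta> p1))"
    and Delta_brk: "\<Delta> (brk p1 p2) =
      (map2 (brk p1) id (\<Delta> p2) + map2 id (brk p1) (\<Delta> p2)) +
      (map2 (mul p2) id (\<delta> p1) - map2 id (mul p2) (\<delta> p1))"
    and delta_mul: "\<delta> (p1 \<cdot> p2) =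
      map2 (mul p1) id (\<delta> p2) + map2 (mul p2) id (\<delta> p1) +
      map2 id (brk p1) (\<Delta> p2) + map2 id (brk p2) (\<Delta> p1)"
begin

definition coboundary :: bool where
  "coboundary \<longleftrightarrow> (\<exists>r \<in> tprod UNIV UNIV. \<Delta> = Delta_of r \<and> \<delta> = delta_of r)"

definition quasi_triangular :: bool where
  "quasi_triangular \<longleftrightarrow> (\<exists>r \<in> tprod UNIV UNIV. \<Delta> = Delta_of r \<and> \<delta> = delta_of r \<and>
     PoiYBE r \<and> poi_invariant (r + flip r))"

definition triangular :: bool where
  "triangular \<longleftrightarrow> (\<exists>r \<in> tprod UNIV UNIV. \<Delta> = Delta_of r \<and> \<delta> = delta_of r \<and>
     PoiYBE r \<and> flip r = - r)"

end

section \<open>Graded spaces and completed tensor products\<close>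

text \<open>
  A formal sum \<open>\<Sum>\<^sub>j u\<^sub>j\<close> of families indexed by degrees \<open>\<kappa>\<close> is computed degreewise; it makes
  sense if every degree receives only finitely many nonzero contributions
  (otherwise the component is set to 0).
\<close>
definition locally_finite :: "'j set \<Rightarrow> ('j \<Rightarrow> 'd \<Rightarrow> 't::comm_monoid_add) \<Rightarrow> bool" where
  "locally_finite J u \<longleftrightarrow> (\<forall>\<kappa>. finite {j \<in> J. u j \<kappa> \<noteq> 0})"

definition formal_sum :: "'j set \<Rightarrow> ('j \<Rightarrow> 'd \<Rightarrow> 't::comm_monoid_add) \<Rightarrow> 'd \<Rightarrow> 't" where
  "formal_sum J u = (\<lambda>\<kappa>. \<Sum>j \<in> {j \<in> J. u j \<kappa> \<noteq> 0}. u j \<kappa>)"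

text \<open>Elements of \<open>\<Prod>\<^bsub>i,j\<^esub> A\<^sub>i \<otimes> A\<^sub>j\<close> and \<open>\<Prod>\<^bsub>i,j,k\<^esub> A\<^sub>i \<otimes> A\<^sub>j \<otimes> A\<^sub>k\<close> as families of components.\<close>
type_synonym ('v, 'k) ctensor2 = "int \<times> int \<Rightarrow> ('v, 'k) tensor2"
type_synonym ('v, 'k) ctensor3 = "int \<times> int \<times> int \<Rightarrow> ('v, 'k) tensor3"

definition cscale :: "'k::field \<Rightarrow> ('d \<Rightarrow> 'x \<Rightarrow> 'k) \<Rightarrow> 'd \<Rightarrow> 'x \<Rightarrow> 'k" where
  "cscale c t = (\<lambda>\<kappa>. fscale c (t \<kappa>))"

text \<open>
  For a formal sum \<open>t = \<Sum>\<^sub>\<alpha> x\<^sub>\<alpha> \<otimes> y\<^sub>\<alpha>\<close> of homogeneous pure tensors and a bilinear \<open>G\<close> with values in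
  a completed tensor product, \<open>csum t G\<close> is \<open>\<Sum>\<^sub>\<alpha> G x\<^sub>\<alpha> y\<^sub>\<alpha>\<close>; the contributions are grouped
  according to the homogeneous components of \<open>t\<close>, which are finite sums.
\<close>
definition csum_terms ::
    "('v, 'k::field) ctensor2 \<Rightarrow> ('v \<Rightarrow> 'v \<Rightarrow> 'd \<Rightarrow> 'x \<Rightarrow> 'k) \<Rightarrow> int \<times> int \<Rightarrow> 'd \<Rightarrow> 'x \<Rightarrow> 'k" where
  "csum_terms t G = (\<lambda>ij \<kappa>. tsum2 (t ij) (\<lambda>x y. G x y \<kappa>))"

definition csum ::
    "('v, 'k::field) ctensor2 \<Rightarrow> ('v \<Rightarrow> 'v \<Rightarrow> 'd \<Rightarrow> 'x \<Rightarrow> 'k) \<Rightarrow> 'd \<Rightarrow> 'x \<Rightarrow> 'k" where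
  "csum t G = formal_sum UNIV (csum_terms t G)"

definition csummable ::
    "('v, 'k::field) ctensor2 \<Rightarrow> ('v \<Rightarrow> 'v \<Rightarrow> 'd \<Rightarrow> 'x \<Rightarrow> 'k) \<Rightarrow> bool" where
  "csummable t G \<longleftrightarrow> locally_finite UNIV (csum_terms t G)"

locale graded_space = tensor_powers scale
  for scale :: "'k::field \<Rightarrow> 'a::ab_group_add \<Rightarrow> 'a" +
  fixes gr :: "int \<Rightarrow> 'a set"
  assumes gr_finite_dim: "\<exists>S. finite S \<and> gr i = span S"
    and gr_direct_sum:
      "\<exists>!c. (\<forall>i. c i \<in> gr i) \<and> finite {i. c i \<noteq> 0} \<and> a = (\<Sum>i | c i \<noteq> 0. c i)"
begin

definition hcomp :: "int \<Rightarrow> 'a \<Rightarrow> 'a" where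
  "hcomp i a =
     (THE c. (\<forall>i. c i \<in> gr i) \<and> finite {i. c i \<noteq> 0} \<and> a = (\<Sum>i | c i \<noteq> 0. c i)) i"

definition ctensor :: "('a, 'k) ctensor2 set" where
  "ctensor = {t. \<forall>i j. t (i, j) \<in> tprod (gr i) (gr j)}"

text \<open>\<open>x \<otimes> y\<close> and \<open>x \<otimes> y \<otimes> z\<close> as elements of the completed tensor products\<close>
definition cpure2 :: "'a \<Rightarrow> 'a \<Rightarrow> ('a, 'k) ctensor2" where
  "cpure2 x y = (\<lambda>(i, j). pure2 (hcomp i x) (hcomp j y))"

definition cpure3 :: "'a \<Rightarrow> 'a \<Rightarrow> 'a \<Rightarrow> ('a, 'k) ctensor3" where
  "cpure3 x y z = (\<lambda>(i, j, k). pure3 (hcomp i x) (hcomp j y) (hcomp k z))"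

definition cflip :: "('a, 'k) ctensor2 \<Rightarrow> ('a, 'k) ctensor2" where
  "cflip t = (\<lambda>(i, j). flip (t (j, i)))"

definition cflip12 :: "('a, 'k) ctensor3 \<Rightarrow> ('a, 'k) ctensor3" where
  "cflip12 t = (\<lambda>(i, j, k). flip12 (t (j, i, k)))"

definition cmap2 :: "('a \<Rightarrow> 'a) \<Rightarrow> ('a \<Rightarrow> 'a) \<Rightarrow> ('a, 'k) ctensor2 \<Rightarrow> ('a, 'k) ctensor2" where
  "cmap2 f g t = csum t (\<lambda>x y. cpure2 (f x) (g y))"

text \<open>
  \<open>f \<otimes> id\<close> and \<open>id \<otimes> f\<close> for linear \<open>f\<close> from \<open>A\<close> to its completed tensor square. The inner sum is
  locally finite for every \<open>f\<close>; finiteness of the outer one is a condition on \<open>f\<close> and \<open>t\<close>.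
\<close>
definition clmap3 :: "('a \<Rightarrow> ('a, 'k) ctensor2) \<Rightarrow> ('a, 'k) ctensor2 \<Rightarrow> ('a, 'k) ctensor3" where
  "clmap3 f t = csum t (\<lambda>x y. csum (f x) (\<lambda>x' x''. cpure3 x' x'' y))"

definition crmap3 :: "('a \<Rightarrow> ('a, 'k) ctensor2) \<Rightarrow> ('a, 'k) ctensor2 \<Rightarrow> ('a, 'k) ctensor3" where
  "crmap3 f t = csum t (\<lambda>x y. csum (f y) (\<lambda>y' y''. cpure3 x y' y''))"

definition clmap3_defined :: "('a \<Rightarrow> ('a, 'k) ctensor2) \<Rightarrow> ('a, 'k) ctensor2 \<Rightarrow> bool" where
  "clmap3_defined f t \<longleftrightarrow> csummable t (\<lambda>x y. csum (f x) (\<lambda>x' x''. cpure3 x' x'' y))"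

definition crmap3_defined :: "('a \<Rightarrow> ('a, 'k) ctensor2) \<Rightarrow> ('a, 'k) ctensor2 \<Rightarrow> bool" where
  "crmap3_defined f t \<longleftrightarrow> csummable t (\<lambda>x y. csum (f y) (\<lambda>y' y''. cpure3 x y' y''))"

end

section \<open>Quadratic graded perm algebras\<close>

locale graded_perm_algebra = graded_space scale gr
  for scale :: "'k::field \<Rightarrow> 'a::ab_group_add \<Rightarrow> 'a" and gr :: "int \<Rightarrow> 'a set" +
  fixes circ :: "'a \<Rightarrow> 'a \<Rightarrow> 'a" (infixl "\<odot>" 70)
  assumes circ_bilinear: "bilinear_map scale scale scale circ"
    and circ_graded: "x \<in> gr i \<Longrightarrow> y \<in> gr j \<Longrightarrow> x \<odot> y \<in> gr (i + j)"
    and circ_assoc: "a1 \<odot> (a2 \<odot> a3) = (a1 \<odot> a2) \<odot> a3"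
    and circ_perm: "(a1 \<odot> a2) \<odot> a3 = (a2 \<odot> a1) \<odot> a3"

locale quadratic_graded_perm_algebra = graded_perm_algebra scale gr circ
  for scale :: "'k::field \<Rightarrow> 'b::ab_group_add \<Rightarrow> 'b" and gr :: "int \<Rightarrow> 'b set"
    and circ :: "'b \<Rightarrow> 'b \<Rightarrow> 'b" (infixl "\<odot>" 70) +
  fixes \<omega> :: "'b \<Rightarrow> 'b \<Rightarrow> 'k"
  assumes form_bilinear: "bilinear_map scale scale (*) \<omega>"
    and form_skew: "\<omega> x y = - \<omega> y x"
    and form_nondegenerate: "(\<forall>y. \<omega> x y = 0) \<Longrightarrow> x = 0"
    and form_invariant: "\<omega> (b1 \<odot> b2) b3 = \<omega> b1 (b2 \<odot> b3 - b3 \<odot> b2)"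
    and form_graded: "\<exists>m. \<forall>i j. i + j + m \<noteq> 0 \<longrightarrow> (\<forall>x \<in> gr i. \<forall>y \<in> gr j. \<omega> x y = 0)"
begin

text \<open>Only finitely many components of \<open>t\<close> pair nontrivially with \<open>b \<otimes> b'\<close>.\<close>
definition form_hat :: "('b, 'k) ctensor2 \<Rightarrow> 'b \<Rightarrow> 'b \<Rightarrow> 'k" where
  "form_hat t b b' =
     (\<Sum>ij | t ij (\<lambda>x y. \<omega> x b * \<omega> y b') \<noteq> 0. t ij (\<lambda>x y. \<omega> x b * \<omega> y b'))"

definition nu_form :: "'b \<Rightarrow> ('b, 'k) ctensor2" where
  "nu_form b = (THE t. t \<in> ctensor \<and> (\<forall>b2 b3. form_hat t b2 b3 = - \<omega> b (b2 \<odot> b3)))"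

definition homogeneous_dual_bases :: "'j set \<Rightarrow> ('j \<Rightarrow> 'b) \<Rightarrow> ('j \<Rightarrow> 'b) \<Rightarrow> bool" where
  "homogeneous_dual_bases \<Omega> e f \<longleftrightarrow>
     inj_on e \<Omega> \<and> independent (e ` \<Omega>) \<and> span (e ` \<Omega>) = UNIV \<and>
     (\<forall>j \<in> \<Omega>. \<exists>i. e j \<in> gr i) \<and> (\<forall>j \<in> \<Omega>. \<exists>i. f j \<in> gr i) \<and>
     (\<forall>i \<in> \<Omega>. \<forall>j \<in> \<Omega>. \<omega> (f i) (e j) = (if i = j then 1 else 0))"

end

section \<open>Completed DPP bialgebras\<close>

locale graded_dpp_algebra = graded_perm_algebra scale gr circ
  for scale :: "'k::field \<Rightarrow> 'a::ab_group_add \<Rightarrow> 'a" and gr :: "int \<Rightarrow> 'a set"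
    and circ :: "'a \<Rightarrow> 'a \<Rightarrow> 'a" (infixl "\<odot>" 70) +
  fixes ast :: "'a \<Rightarrow> 'a \<Rightarrow> 'a" (infixl "\<star>" 70)
  assumes ast_bilinear: "bilinear_map scale scale scale ast"
    and ast_graded: "x \<in> gr i \<Longrightarrow> y \<in> gr j \<Longrightarrow> x \<star> y \<in> gr (i + j)"
    and ast_leibniz: "a1 \<star> (a2 \<star> a3) = (a1 \<star> a2) \<star> a3 + a2 \<star> (a1 \<star> a3)"
    and circ_ast: "(a1 \<odot> a2) \<star> a3 = a1 \<odot> (a2 \<star> a3) + a2 \<odot> (a1 \<star> a3)"
    and ast_circ: "(a1 \<star> a2) \<odot> a3 = a1 \<star> (a2 \<odot> a3) - a2 \<odot> (a1 \<star> a3)"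
    and ast_circ_skew: "(a1 \<star> a2) \<odot> a3 = - ((a2 \<star> a1) \<odot> a3)"
begin

abbreviation "L a \<equiv> (\<lambda>b. a \<odot> b)"
abbreviation "R a \<equiv> (\<lambda>b. b \<odot> a)"
abbreviation "L' a \<equiv> (\<lambda>b. a \<star> b)"
abbreviation "R' a \<equiv> (\<lambda>b. b \<star> a)"

definition nu_of :: "('a, 'k) ctensor2 \<Rightarrow> 'a \<Rightarrow> ('a, 'k) ctensor2" where
  "nu_of s a = cmap2 id (R a) s + cmap2 (R a - L a) id s"

definition theta_of :: "('a, 'k) ctensor2 \<Rightarrow> 'a \<Rightarrow> ('a, 'k) ctensor2" where
  "theta_of s a = cmap2 (L' a + R' a) id s - cmap2 id (R' a) s"

definition dp_invariant :: "('a, 'k) ctensor2 \<Rightarrow> bool" where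
  "dp_invariant s \<longleftrightarrow> (\<forall>a. nu_of s a = 0) \<and> (\<forall>a. theta_of s a = 0)"

text \<open>
  For \<open>s = \<Sum>\<^sub>\<alpha> x\<^sub>\<alpha> \<otimes> y\<^sub>\<alpha>\<close> and \<open>G\<close> quadrilinear, the double sum \<open>\<Sum>\<^bsub>\<alpha>,\<beta>\<^esub> G x\<^sub>\<alpha> y\<^sub>\<alpha> x\<^sub>\<beta> y\<^sub>\<beta>\<close>, together with the
  condition that it is locally finite. Contributions are indexed by the pair of homogeneous
  components of \<open>s\<close> they come from.
\<close>
definition double_terms ::
    "('a, 'k) ctensor2 \<Rightarrow> ('a \<Rightarrow> 'a \<Rightarrow> 'a \<Rightarrow> 'a \<Rightarrow> ('a, 'k) ctensor3) \<Rightarrow>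
     (int \<times> int) \<times> (int \<times> int) \<Rightarrow> ('a, 'k) ctensor3" where
  "double_terms s G = (\<lambda>(ij, kl) \<kappa>. tsum2 (s ij) (\<lambda>x y. tsum2 (s kl) (\<lambda>x' y'. G x y x' y' \<kappa>)))"

definition double_sum ::
    "('a, 'k) ctensor2 \<Rightarrow> ('a \<Rightarrow> 'a \<Rightarrow> 'a \<Rightarrow> 'a \<Rightarrow> ('a, 'k) ctensor3) \<Rightarrow> ('a, 'k) ctensor3" where
  "double_sum s G = formal_sum UNIV (double_terms s G)"

definition double_summable ::
    "('a, 'k) ctensor2 \<Rightarrow> ('a \<Rightarrow> 'a \<Rightarrow> 'a \<Rightarrow> 'a \<Rightarrow> ('a, 'k) ctensor3) \<Rightarrow> bool" where
  "double_summable s G \<longleftrightarrow> locally_finite UNIV (double_terms s G)"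

definition DPYBE_defined :: "('a, 'k) ctensor2 \<Rightarrow> bool" where
  "DPYBE_defined s \<longleftrightarrow>
     double_summable s (\<lambda>x y x' y'. cpure3 x (y \<odot> x') y') \<and>
     double_summable s (\<lambda>x y x' y'. cpure3 x x' (y \<odot> y')) \<and>
     double_summable s (\<lambda>x y x' y'. cpure3 (x \<odot> x') y y') \<and>
     double_summable s (\<lambda>x y x' y'. cpure3 (x \<odot> x') y' y) \<and>
     double_summable s (\<lambda>x y x' y'. cpure3 (x \<star> x') y y') \<and>
     double_summable s (\<lambda>x y x' y'. cpure3 x (y \<star> x') y') \<and>
     double_summable s (\<lambda>x y x' y'. cpure3 x' (x \<star> y') y) \<and>
     double_summable s (\<lambda>x y x' y'. cpure3 x' x (y \<star> y'))"

definition DPYBE :: "('a, 'k) ctensor2 \<Rightarrow> bool" where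
  "DPYBE s \<longleftrightarrow> DPYBE_defined s \<and>
     double_sum s (\<lambda>x y x' y'. cpure3 x (y \<odot> x') y' - cpure3 x x' (y \<odot> y')
       + cpure3 (x \<odot> x') y y' - cpure3 (x \<odot> x') y' y) = 0 \<and>
     double_sum s (\<lambda>x y x' y'. cpure3 (x \<star> x') y y' - cpure3 x (y \<star> x') y'
       - cpure3 x' (x \<star> y') y + cpure3 x' x (y \<star> y')) = 0"

end

locale completed_dpp_coalgebra = graded_space scale gr
  for scale :: "'k::field \<Rightarrow> 'a::ab_group_add \<Rightarrow> 'a" and gr :: "int \<Rightarrow> 'a set" +
  fixes \<nu> \<theta> :: "'a \<Rightarrow> ('a, 'k) ctensor2"
  assumes nu_in: "\<nu> a \<in> ctensor"
    and theta_in: "\<theta> a \<in> ctensor"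
    and nu_linear: "Vector_Spaces.linear scale cscale \<nu>"
    and theta_linear: "Vector_Spaces.linear scale cscale \<theta>"
    and composites_defined:
      "\<lbrakk>f \<in> {\<nu>, \<theta>}; g \<in> {\<nu>, \<theta>}\<rbrakk> \<Longrightarrow> clmap3_defined f (g a) \<and> crmap3_defined f (g a)"
    and nu_coassoc: "clmap3 \<nu> (\<nu> a) = crmap3 \<nu> (\<nu> a)"
    and nu_coperm: "crmap3 \<nu> (\<nu> a) = cflip12 (clmap3 \<nu> (\<nu> a))"
    and theta_coleibniz:
      "crmap3 \<theta> (\<theta> a) = clmap3 \<theta> (\<theta> a) + cflip12 (crmap3 \<theta> (\<theta> a))"
    and nu_theta: "crmap3 \<nu> (\<theta> a) = clmap3 \<theta> (\<nu> a) + cflip12 (crmap3 \<theta> (\<nu> a))"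
    and nu_theta': "clmap3 \<nu> (\<theta> a) = crmap3 \<theta> (\<nu> a) + cflip12 (crmap3 \<theta> (\<nu> a))"
    and theta_nu_skew: "clmap3 \<theta> (\<nu> a) = - cflip12 (clmap3 \<theta> (\<nu> a))"
begin

abbreviation "nu_minus a \<equiv> \<nu> a - cflip (\<nu> a)"
abbreviation "theta_plus a \<equiv> \<theta> a + cflip (\<theta> a)"

end

locale completed_dpp_bialgebra =
  graded_dpp_algebra scale gr circ ast + completed_dpp_coalgebra scale gr \<nu> \<theta>
  for scale :: "'k::field \<Rightarrow> 'a::ab_group_add \<Rightarrow> 'a" and gr :: "int \<Rightarrow> 'a set"
    and circ :: "'a \<Rightarrow> 'a \<Rightarrow> 'a" (infixl "\<odot>" 70)
    and ast :: "'a \<Rightarrow> 'a \<Rightarrow> 'a" (infixl "\<star>" 70)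
    and \<nu> \<theta> :: "'a \<Rightarrow> ('a, 'k) ctensor2" +
  assumes perm1: "cmap2 (R a1) id (\<nu> a2) = cflip (cmap2 (R a2) id (\<nu> a1))"
    and perm2: "\<nu> (a1 \<odot> a2) = cmap2 (L a1 - R a1) id (\<nu> a2) + cmap2 id (R a2) (\<nu> a1)"
    and perm3: "\<nu> (a1 \<odot> a2) = cmap2 id (L a1) (\<nu> a2) + cmap2 (L a2 - R a2) id (nu_minus a1)"
    and leib1: "cflip (cmap2 (R' a2) id (\<theta> a1)) = cmap2 (R' a1) id (\<theta> a2)"
    and leib2: "\<theta> (a1 \<star> a2) =
      (cmap2 id (R' a2) (theta_plus a1) - cmap2 (L' a2 + R' a2) id (theta_plus a1)) +
      (cmap2 id (L' a1) (\<theta> a2) + cmap2 (L' a1) id (\<theta> a2))"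
    and compat1: "\<nu> (a1 \<star> a2) =
      (cmap2 id (L' a1) (\<nu> a2) + cmap2 (L' a1) id (\<nu> a2)) +
      (cmap2 (L a2 - R a2) id (theta_plus a1) - cmap2 id (R a2) (theta_plus a1))"
    and compat2: "\<theta> (a1 \<odot> a2) =
      cmap2 id (L a1) (\<theta> a2) + cmap2 id (R a2) (\<theta> a1)
      - cmap2 (L' a1 + R' a1) id (\<nu> a2) - cmap2 (L' a2 + R' a2) id (nu_minus a1)"
    and compat3: "cmap2 id (R' a1) (cflip (\<nu> a2)) = - cmap2 (R a2) id (\<theta> a1)"
    and compat4: "\<nu> (a1 \<star> a2) =
      (cmap2 id (L a1) (\<theta> a2) - cmap2 (L a1) id (\<theta> a2)) +
      (cmap2 id (R' a2) (nu_minus a1) - cmap2 (L' a2 + R' a2) id (nu_minus a1))"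
    and compat5: "theta_plus (a1 \<odot> a2) =
      cmap2 id (L a1) (theta_plus a2) + cmap2 id (L a2) (theta_plus a1)
      - cmap2 (L' a1) id (nu_minus a2) - cmap2 (L' a2) id (nu_minus a1)"
    and compat6: "\<theta> (a1 \<odot> a2) =
      cmap2 (L a1) id (\<theta> a2) - cmap2 id (R' a2) (nu_minus a1)
      + cmap2 id (L' a1) (\<nu> a2) + cmap2 (L a2 - R a2) id (theta_plus a1)"
    and compat7: "\<nu> (a1 \<star> a2 + a2 \<star> a1) =
      cmap2 id (L' a1 + R' a1) (\<nu> a2) + cmap2 (L' a1 + R' a1) id (cflip (\<nu> a2))
      + cmap2 id (L a2 - R a2) (\<theta> a1) + cmap2 (L a2 - R a2) id (cflip (\<theta> a1))"
begin

definition coboundary :: bool where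
  "coboundary \<longleftrightarrow> (\<exists>s \<in> ctensor. \<nu> = nu_of s \<and> \<theta> = theta_of s)"

definition quasi_triangular :: bool where
  "quasi_triangular \<longleftrightarrow> (\<exists>s \<in> ctensor. \<nu> = nu_of s \<and> \<theta> = theta_of s \<and>
     DPYBE s \<and> dp_invariant (s - cflip s))"

definition triangular :: bool where
  "triangular \<longleftrightarrow> (\<exists>s \<in> ctensor. \<nu> = nu_of s \<and> \<theta> = theta_of s \<and>
     DPYBE s \<and> cflip s = s)"

end

section \<open>The structures on \<open>P \<otimes> B\<close>\<close>

text \<open>\<open>tens :: 'p \<Rightarrow> 'b \<Rightarrow> 'a\<close> below is the canonical map \<open>P \<times> B \<rightarrow> P \<otimes> B\<close>.\<close>

definition tensor_grading ::
    "('k::field \<Rightarrow> 'a::ab_group_add \<Rightarrow> 'a) \<Rightarrow> ('p \<Rightarrow> 'b \<Rightarrow> 'a) \<Rightarrow> (int \<Rightarrow> 'b set) \<Rightarrow> int \<Rightarrow> 'a set" where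
  "tensor_grading sA tens grB i = module.span sA {tens p b | p b. b \<in> grB i}"

text \<open>The element \<open>t \<bullet> n\<close> for \<open>t\<close> in \<open>P \<otimes> P\<close> and \<open>n\<close> in the completed tensor square of \<open>B\<close>.\<close>
definition bullet ::
    "('k::field \<Rightarrow> 'a::ab_group_add \<Rightarrow> 'a) \<Rightarrow> ('p \<Rightarrow> 'b \<Rightarrow> 'a) \<Rightarrow>
     ('p, 'k) tensor2 \<Rightarrow> ('b, 'k) ctensor2 \<Rightarrow> ('a, 'k) ctensor2" where
  "bullet sA tens t n = (\<lambda>ij. tsum2 t (\<lambda>p' p''. tsum2 (n ij) (\<lambda>b1 b2.
     tensor_powers.pure2 sA (tens p' b1) (tens p'' b2))))"

text \<open>The terms \<open>(x\<^sub>i \<otimes> e\<^sub>j) \<otimes> (y\<^sub>i \<otimes> f\<^sub>j)\<close> of the formal sum lifting \<open>r = \<Sum>\<^sub>i x\<^sub>i \<otimes> y\<^sub>i\<close>.\<close>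
definition lift_terms ::
    "('k::field \<Rightarrow> 'a::ab_group_add \<Rightarrow> 'a) \<Rightarrow> (int \<Rightarrow> 'a set) \<Rightarrow> ('p \<Rightarrow> 'b \<Rightarrow> 'a) \<Rightarrow>
     ('i \<Rightarrow> 'p) \<Rightarrow> ('i \<Rightarrow> 'p) \<Rightarrow> ('j \<Rightarrow> 'b) \<Rightarrow> ('j \<Rightarrow> 'b) \<Rightarrow> 'i \<times> 'j \<Rightarrow> ('a, 'k) ctensor2" where
  "lift_terms sA gr tens x y e f =
     (\<lambda>(i, j). graded_space.cpure2 sA gr (tens (x i) (e j)) (tens (y i) (f j)))"

end

(* The form \<omega> turns the completed tensor square of P \<otimes> B into the space of all bilinear maps
   B \<times> B \<rightarrow> P \<otimes> P, by pairing both factors B. Under this identification \<nu> (p \<otimes> b) is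
   (b1, b2) \<mapsto> \<omega> (b1 b2) b \<cdot> \<Delta> p, likewise for \<theta> and \<delta>, the lift of r is
   (b1, b2) \<mapsto> \<omega> b2 b1 \<cdot> r, and left or right multiplication by p \<otimes> b becomes an operator on P
   combined with its \<omega>-adjoint on the argument b1 or b2. Every identity of a completed DPP bialgebra
   thereby becomes an identity between values of \<omega> on perm products, weighted by tensors over P.
   The values \<omega> (xyz) w of four elements span only a three-dimensional space, and comparing
   coefficients there leaves exactly the identities of the Poisson bialgebra; in the same way the
   two equations of the DPYBE become multiples of A_r = 0 and C_r = 0. *)
theory Submission
  imports Defs
begin

section \<open>Tensors as functionals on bilinear forms\<close>

text \<open>A completed tensor has infinitely many components, so a general bilinear form on
  \<open>A\<close> cannot be evaluated on it. Pairing with fixed \<open>b\<close> and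
  \<open>b'\<close> is legitimate because \<open>\<omega>\<close> has a fixed degree: a given
  \<open>b\<close> meets only finitely many degrees. All calculations are therefore restricted to
  forms supported in finitely many degrees, and operators have to pull such forms back to such
  forms. Multiplication by an inhomogeneous element does not respect the grading, but it shifts
  degrees by finitely many amounts only, which suffices. Conversely, finite-dimensional degree
  pieces with dual bases recover each component from finitely many pairings. Signs change between
  the two sides because \<open>\<omega>\<close> is skew: the sum of all
  \<open>e j \<otimes> f j\<close> is antisymmetric, so skew \<open>r\<close> have symmetric lifts,
  and \<open>r + \<tau> r\<close> corresponds to the lift minus its flip. Homogeneous dual bases
  also have to be constructed from nondegeneracy, since the claims on coboundary, quasi-triangular
  and triangular structures supply none.\<close>

lemma sum_fun_apply: "(\<Sum>a\<in>A. f a) x = (\<Sum>a\<in>A. f a x)"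
  by (induction A rule: infinite_finite_induct) auto

lemma bilinear_map_iff:
  assumes "vector_space sU" "vector_space sV" "vector_space sW"
  shows "bilinear_map sU sV sW f \<longleftrightarrow>
    (\<forall>u v v'. f u (v + v') = f u v + f u v') \<and> (\<forall>u c v. f u (sV c v) = sW c (f u v)) \<and>
    (\<forall>u u' v. f (u + u') v = f u v + f u' v) \<and> (\<forall>c u v. f (sU c u) v = sW c (f u v))"
  using assms by (auto simp: bilinear_map_def Vector_Spaces.linear_iff)

lemma additive_zero:
  fixes f :: "'a::ab_group_add \<Rightarrow> 'b::ab_group_add"
  assumes "\<And>x y. f (x + y) = f x + f y"
  shows "f 0 = 0"
  using assms[of 0 0] by simp

lemma additive_minus:
  fixes f :: "'a::ab_group_add \<Rightarrow> 'b::ab_group_add"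
  assumes "\<And>x y. f (x + y) = f x + f y"
  shows "f (- x) = - f x"
  using assms[of x "- x"] additive_zero[of f, OF assms] by (simp add: eq_neg_iff_add_eq_0 add.commute)

lemma additive_diff:
  fixes f :: "'a::ab_group_add \<Rightarrow> 'b::ab_group_add"
  assumes "\<And>x y. f (x + y) = f x + f y"
  shows "f (x - y) = f x - f y"
  using assms[of x "- y"] additive_minus[of f y, OF assms] by simp

lemma additive_sum:
  fixes f :: "'a::ab_group_add \<Rightarrow> 'b::ab_group_add"
  assumes "\<And>x y. f (x + y) = f x + f y"
  shows "f (\<Sum>a\<in>A. g a) = (\<Sum>a\<in>A. f (g a))"
  using additive_zero[of f, OF assms] by (induction A rule: infinite_finite_induct) (auto simp: assms)

context tensor_powers
begin

abbreviation bil :: "('v \<Rightarrow> 'v \<Rightarrow> 'k) \<Rightarrow> bool" where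
  "bil \<equiv> bilinear_map scale scale (*)"

lemma bil_iff: "bil \<beta> \<longleftrightarrow>
    (\<forall>x y y'. \<beta> x (y + y') = \<beta> x y + \<beta> x y') \<and> (\<forall>x c y. \<beta> x (scale c y) = c * \<beta> x y) \<and>
    (\<forall>x x' y. \<beta> (x + x') y = \<beta> x y + \<beta> x' y) \<and> (\<forall>c x y. \<beta> (scale c x) y = c * \<beta> x y)"
  by (rule bilinear_map_iff) (auto intro: vector_space_mult vector_space_axioms)

lemma tri_iff: "trilinear_form scale \<beta> \<longleftrightarrow>
    (\<forall>x x' y z. \<beta> (x + x') y z = \<beta> x y z + \<beta> x' y z) \<and> (\<forall>c x y z. \<beta> (scale c x) y z = c * \<beta> x y z) \<and>
    (\<forall>x y y' z. \<beta> x (y + y') z = \<beta> x y z + \<beta> x y' z) \<and> (\<forall>c x y z. \<beta> x (scale c y) z = c * \<beta> x y z) \<and>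
    (\<forall>x y z z'. \<beta> x y (z + z') = \<beta> x y z + \<beta> x y z') \<and> (\<forall>c x y z. \<beta> x y (scale c z) = c * \<beta> x y z)"
  using vector_space_mult vector_space_axioms
  by (auto simp: trilinear_form_def Vector_Spaces.linear_iff)

lemma bil_swap: "bil \<beta> \<Longrightarrow> bil (\<lambda>x y. \<beta> y x)"
  by (simp add: bil_iff)

lemma bil_diff:
  assumes "bil \<beta>"
  shows "\<beta> (x - x') y = \<beta> x y - \<beta> x' y" "\<beta> x (y - y') = \<beta> x y - \<beta> x y'"
    "\<beta> 0 y = 0" "\<beta> x 0 = 0" "\<beta> (- x) y = - \<beta> x y" "\<beta> x (- y) = - \<beta> x y"
    "\<beta> (\<Sum>a\<in>A. f a) y = (\<Sum>a\<in>A. \<beta> (f a) y)" "\<beta> x (\<Sum>a\<in>A. f a) = (\<Sum>a\<in>A. \<beta> x (f a))"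
proof -
  have 1: "\<beta> (x + x') y = \<beta> x y + \<beta> x' y" "\<beta> x (y + y') = \<beta> x y + \<beta> x y'" for x x' y y'
    using assms by (auto simp: bil_iff)
  show "\<beta> (x - x') y = \<beta> x y - \<beta> x' y" "\<beta> 0 y = 0" "\<beta> (- x) y = - \<beta> x y"
      "\<beta> (\<Sum>a\<in>A. f a) y = (\<Sum>a\<in>A. \<beta> (f a) y)"
    by (rule additive_diff[of "\<lambda>x. \<beta> x y"] additive_zero[of "\<lambda>x. \<beta> x y"]
        additive_minus[of "\<lambda>x. \<beta> x y"] additive_sum[of "\<lambda>x. \<beta> x y"]; rule 1)+
  show "\<beta> x (y - y') = \<beta> x y - \<beta> x y'" "\<beta> x 0 = 0" "\<beta> x (- y) = - \<beta> x y"
      "\<beta> x (\<Sum>a\<in>A. f a) = (\<Sum>a\<in>A. \<beta> x (f a))"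
    by (rule additive_diff[of "\<beta> x"] additive_zero[of "\<beta> x"]
        additive_minus[of "\<beta> x"] additive_sum[of "\<beta> x"]; rule 1)+
qed

lemma bil_zero [simp]: "bil (\<lambda>_ _. 0)"
  by (simp add: bil_iff)

lemma bil_add: "bil \<beta> \<Longrightarrow> bil \<beta>' \<Longrightarrow> bil (\<lambda>x y. \<beta> x y + \<beta>' x y)"
  by (simp add: bil_iff algebra_simps)

lemma bil_minus: "bil \<beta> \<Longrightarrow> bil \<beta>' \<Longrightarrow> bil (\<lambda>x y. \<beta> x y - \<beta>' x y)"
  by (simp add: bil_iff algebra_simps)

lemma bil_scale: "bil \<beta> \<Longrightarrow> bil (\<lambda>x y. c * \<beta> x y)"
  by (simp add: bil_iff algebra_simps)

lemma bil_sum: "(\<And>i. i \<in> I \<Longrightarrow> bil (\<beta> i)) \<Longrightarrow> bil (\<lambda>x y. \<Sum>i\<in>I. \<beta> i x y)"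
  by (induction I rule: infinite_finite_induct) (auto intro: bil_add)

lemma bil_comp:
  assumes "bil \<beta>"
    and "\<And>x y. f (x + y) = f x + f y" "\<And>c x. f (s c x) = scale c (f x)"
    and "\<And>x y. g (x + y) = g x + g y" "\<And>c x. g (s c x) = scale c (g x)"
    and "vector_space s"
  shows "bilinear_map s s (*) (\<lambda>x y. \<beta> (f x) (g y))"
  unfolding bilinear_map_iff[OF assms(6) assms(6) vector_space_mult]
  using assms by (auto simp: bil_iff)

text \<open>Scalars are absorbed into the left factor, which is why \<open>V\<close> has to be a
  subspace; no coefficients remain. All rules for evaluating a tensor on forms thereby become
  statements on finite sums.\<close>

lemma tprodE:
  assumes "t \<in> tprod V W" "subspace V"
  obtains n :: nat and x y where "\<And>i. i < n \<Longrightarrow> x i \<in> V" "\<And>i. i < n \<Longrightarrow> y i \<in> W"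
    "t = (\<Sum>i<n. pure2 (x i) (y i))"
proof -
  interpret F: vector_space "fscale :: 'k \<Rightarrow> ('v, 'k) tensor2 \<Rightarrow> ('v, 'k) tensor2"
    by (rule vector_space_fscale)
  have "\<exists>n::nat. \<exists>x y. (\<forall>i<n. x i \<in> V \<and> y i \<in> W) \<and> t = (\<Sum>i<n. pure2 (x i) (y i))"
    using assms(1) unfolding tprod_def
  proof (induction rule: F.span_induct_alt)
    case base
    show ?case by (rule exI[of _ 0]) auto
  next
    case (step c s t)
    then obtain u v where uv: "u \<in> V" "v \<in> W" "s = pure2 u v" by auto
    from step obtain n :: nat and x y where n: "\<forall>i<n. x i \<in> V \<and> y i \<in> W"
      "t = (\<Sum>i<n. pure2 (x i) (y i))" by auto
    have s: "fscale c s = pure2 (scale c u) v"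
      using bilinear_map_pure2 uv(3) by (simp add: bilinear_map_def Vector_Spaces.linear_iff)
    have "(\<Sum>i<Suc n. pure2 ((x(n := scale c u)) i) ((y(n := v)) i)) = fscale c s + t"
      by (simp add: s n(2) add.commute)
    moreover have "scale c u \<in> V" using assms(2) uv(1) by (simp add: subspace_def)
    ultimately show ?case
      using n(1) uv by (intro exI[of _ "Suc n"] exI[of _ "x(n := scale c u)"] exI[of _ "y(n := v)"])
        auto
  qed
  then show ?thesis using that by blast
qed

lemma pure2_apply: "bil \<beta> \<Longrightarrow> pure2 x y \<beta> = \<beta> x y"
  by (simp add: pure2_def)

lemma sum_pure2_apply: "bil \<beta> \<Longrightarrow> (\<Sum>i\<in>I. pure2 (x i) (y i)) \<beta> = (\<Sum>i\<in>I. \<beta> (x i) (y i))"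
  by (simp add: pure2_def sum_fun_apply)

lemma subspace_tprod:
  shows tprod_zero: "0 \<in> tprod V W"
    and tprod_add: "s \<in> tprod V W \<Longrightarrow> t \<in> tprod V W \<Longrightarrow> s + t \<in> tprod V W"
    and tprod_diff: "s \<in> tprod V W \<Longrightarrow> t \<in> tprod V W \<Longrightarrow> s - t \<in> tprod V W"
    and tprod_minus: "s \<in> tprod V W \<Longrightarrow> - s \<in> tprod V W"
    and tprod_sum: "(\<And>i. i \<in> I \<Longrightarrow> f i \<in> tprod V W) \<Longrightarrow> (\<Sum>i\<in>I. f i) \<in> tprod V W"
    and tprod_pure2: "x \<in> V \<Longrightarrow> y \<in> W \<Longrightarrow> pure2 x y \<in> tprod V W"
proof -
  interpret F: vector_space "fscale :: 'k \<Rightarrow> ('v, 'k) tensor2 \<Rightarrow> ('v, 'k) tensor2"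
    by (rule vector_space_fscale)
  show "0 \<in> tprod V W"
    "s \<in> tprod V W \<Longrightarrow> t \<in> tprod V W \<Longrightarrow> s + t \<in> tprod V W"
    "s \<in> tprod V W \<Longrightarrow> t \<in> tprod V W \<Longrightarrow> s - t \<in> tprod V W"
    "s \<in> tprod V W \<Longrightarrow> - s \<in> tprod V W"
    "(\<And>i. i \<in> I \<Longrightarrow> f i \<in> tprod V W) \<Longrightarrow> (\<Sum>i\<in>I. f i) \<in> tprod V W"
    "x \<in> V \<Longrightarrow> y \<in> W \<Longrightarrow> pure2 x y \<in> tprod V W"
    unfolding tprod_def
    by (auto intro: F.span_zero F.span_add F.span_diff F.span_neg F.span_scale F.span_sum F.span_base)
qed

lemma tprod_mono: "V \<subseteq> V' \<Longrightarrow> W \<subseteq> W' \<Longrightarrow> tprod V W \<subseteq> tprod V' W'"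
proof -
  interpret F: vector_space "fscale :: 'k \<Rightarrow> ('v, 'k) tensor2 \<Rightarrow> ('v, 'k) tensor2"
    by (rule vector_space_fscale)
  assume "V \<subseteq> V'" "W \<subseteq> W'"
  then show ?thesis unfolding tprod_def by (intro F.span_mono) auto
qed

context
  fixes t V W
  assumes t: "t \<in> tprod V W"
begin

lemma tprod_UNIV: "t \<in> tprod UNIV UNIV"
  using t tprod_mono[of V UNIV W UNIV] by auto

lemma tprod_not_bil: "\<not> bil \<beta> \<Longrightarrow> t \<beta> = 0"
  by (rule tprodE[OF tprod_UNIV subspace_UNIV]) (simp add: pure2_def sum_fun_apply)

lemma tprod_add_form: "bil \<beta> \<Longrightarrow> bil \<beta>' \<Longrightarrow> t (\<lambda>x y. \<beta> x y + \<beta>' x y) = t \<beta> + t \<beta>'"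
  by (rule tprodE[OF tprod_UNIV subspace_UNIV]) (simp add: sum_pure2_apply bil_add sum.distrib)

lemma tprod_diff_form: "bil \<beta> \<Longrightarrow> bil \<beta>' \<Longrightarrow> t (\<lambda>x y. \<beta> x y - \<beta>' x y) = t \<beta> - t \<beta>'"
  by (rule tprodE[OF tprod_UNIV subspace_UNIV]) (simp add: sum_pure2_apply bil_minus sum_subtractf)

lemma tprod_zero_form: "t (\<lambda>_ _. 0) = 0"
  by (rule tprodE[OF tprod_UNIV subspace_UNIV]) (simp add: sum_pure2_apply)

lemma tprod_scale_form: "bil \<beta> \<Longrightarrow> t (\<lambda>x y. c * \<beta> x y) = c * t \<beta>"
  by (rule tprodE[OF tprod_UNIV subspace_UNIV]) (simp add: sum_pure2_apply bil_scale sum_distrib_left)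

lemma tprod_sum_form: "(\<And>i. i \<in> I \<Longrightarrow> bil (\<beta> i)) \<Longrightarrow> t (\<lambda>x y. \<Sum>i\<in>I. \<beta> i x y) = (\<Sum>i\<in>I. t (\<beta> i))"
  by (induction I rule: infinite_finite_induct) (auto simp: tprod_zero_form tprod_add_form bil_sum)

lemma tprod_cong:
  assumes "subspace V" "bil \<beta>" "bil \<beta>'" "\<And>x y. x \<in> V \<Longrightarrow> y \<in> W \<Longrightarrow> \<beta> x y = \<beta>' x y"
  shows "t \<beta> = t \<beta>'"
  by (rule tprodE[OF t assms(1)]) (simp add: sum_pure2_apply assms)

end

lemma tprod_eq_zero:
  assumes "t \<in> tprod V W" "subspace V" "bil \<beta>" "\<And>x y. x \<in> V \<Longrightarrow> y \<in> W \<Longrightarrow> \<beta> x y = 0"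
  shows "t \<beta> = 0"
  using tprod_cong[OF assms(1,2,3) bil_zero] assms tprod_zero_form[OF assms(1)] by simp

text \<open>Tensors are functionals with the default value 0 off the bilinear forms, so agreement on
  bilinear forms is already equality of functions.\<close>

lemma tprod_eqI:
  assumes "s \<in> tprod V W" "t \<in> tprod V' W'" "\<And>\<beta>. bil \<beta> \<Longrightarrow> s \<beta> = t \<beta>"
  shows "s = t"
proof
  show "s \<beta> = t \<beta>" for \<beta>
    using tprod_not_bil[OF assms(1), of \<beta>] tprod_not_bil[OF assms(2), of \<beta>] assms(3)[of \<beta>]
    by (cases "bil \<beta>") auto
qed

text \<open>With \<open>s\<close> and \<open>t\<close> written as finite sums of pure tensors, this
  is the interchange of two finite sums.\<close>

lemma tprod_Fubini:
  assumes "s \<in> tprod V W" "t \<in> tprod V' W'"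
    and "\<And>x y. bil (H x y)" "\<And>x' y'. bil (\<lambda>x y. H x y x' y')"
  shows "s (\<lambda>x y. t (H x y)) = t (\<lambda>x' y'. s (\<lambda>x y. H x y x' y'))"
proof -
  obtain n :: nat and x y where s: "s = (\<Sum>i<n. pure2 (x i) (y i))"
    by (rule tprodE[OF tprod_UNIV[OF assms(1)] subspace_UNIV]) metis
  obtain m :: nat and x' y' where t: "t = (\<Sum>i<m. pure2 (x' i) (y' i))"
    by (rule tprodE[OF tprod_UNIV[OF assms(2)] subspace_UNIV]) metis
  have "s (\<lambda>x y. t (H x y)) = (\<Sum>i<n. \<Sum>j<m. H (x i) (y i) (x' j) (y' j))"
    using assms(3,4) by (simp add: s t sum_pure2_apply bil_sum)
  moreover have "t (\<lambda>x' y'. s (\<lambda>x y. H x y x' y')) = (\<Sum>j<m. \<Sum>i<n. H (x i) (y i) (x' j) (y' j))"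
    using assms(3,4) by (simp add: s t sum_pure2_apply bil_sum)
  ultimately show ?thesis by (simp add: sum.swap[of _ "{..<n}"])
qed

lemma flip_apply: "bil \<beta> \<Longrightarrow> flip t \<beta> = t (\<lambda>x y. \<beta> y x)"
  by (simp add: flip_def tsum2_def pure2_apply)

lemma flip_in: "t \<in> tprod V W \<Longrightarrow> subspace V \<Longrightarrow> flip t \<in> tprod W V"
proof -
  assume a: "t \<in> tprod V W" "subspace V"
  from tprodE[OF this] obtain n :: nat and x y where n: "\<And>i. i < n \<Longrightarrow> x i \<in> V" "\<And>i. i < n \<Longrightarrow> y i \<in> W"
    "t = (\<Sum>i<n. pure2 (x i) (y i))" by metis
  have "flip t \<beta> = (\<Sum>i<n. pure2 (y i) (x i)) \<beta>" for \<beta>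
  proof (cases "bil \<beta>")
    case True
    then show ?thesis by (simp add: flip_apply n(3) sum_pure2_apply bil_swap)
  next
    \<comment> \<open>Here both sides take the default value 0; on the left this is the value of
      \<open>t\<close> at the zero form.\<close>
    case False
    then show ?thesis
      by (simp add: flip_def tsum2_def pure2_def sum_fun_apply tprod_zero_form[OF a(1)])
  qed
  then have "flip t = (\<Sum>i<n. pure2 (y i) (x i))" by blast
  then show ?thesis using n by (auto intro: tprod_sum tprod_pure2)
qed

lemma map2_apply: "bil \<beta> \<Longrightarrow> map2 f g t \<beta> = t (\<lambda>x y. \<beta> (f x) (g y))"
  by (simp add: map2_def tsum2_def pure2_apply)

lemma pure3_apply: "pure3 x y z \<beta> = (if trilinear_form scale \<beta> then \<beta> x y z else 0)"
  by (simp add: pure3_def)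

lemma lmap3_apply:
  "trilinear_form scale \<beta> \<Longrightarrow> lmap3 f t \<beta> = t (\<lambda>x y. f x (\<lambda>x' x''. \<beta> x' x'' y))"
  by (simp add: lmap3_def tsum2_def pure3_def)

lemma rmap3_apply:
  "trilinear_form scale \<beta> \<Longrightarrow> rmap3 f t \<beta> = t (\<lambda>x y. f y (\<lambda>y' y''. \<beta> x y' y''))"
  by (simp add: rmap3_def tsum2_def pure3_def)

lemma flip12_apply: "trilinear_form scale \<beta> \<Longrightarrow> flip12 t \<beta> = t (\<lambda>x y z. \<beta> y x z)"
  by (simp add: flip12_def tsum3_def pure3_def)

end

section \<open>Pairing completed tensors with admissible forms\<close>

lemma formal_sum_eq:
  assumes "finite S" "\<And>j. j \<in> J \<Longrightarrow> j \<notin> S \<Longrightarrow> u j \<kappa> = 0" "S \<subseteq> J"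
  shows "formal_sum J u \<kappa> = (\<Sum>j\<in>S. u j \<kappa>)"
proof -
  have "(\<Sum>j\<in>{j \<in> J. u j \<kappa> \<noteq> 0}. u j \<kappa>) = (\<Sum>j\<in>S. u j \<kappa>)"
    using assms by (intro sum.mono_neutral_left) auto
  then show ?thesis by (simp add: formal_sum_def)
qed

lemma csum_apply:
  assumes "finite S" "\<And>ij \<beta>. ij \<notin> S \<Longrightarrow> t ij (\<lambda>x y. G x y \<kappa> \<beta>) = 0"
  shows "csum t G \<kappa> \<beta> = (\<Sum>ij\<in>S. t ij (\<lambda>x y. G x y \<kappa> \<beta>))"
proof -
  have "csum t G \<kappa> = (\<Sum>ij\<in>S. csum_terms t G ij \<kappa>)"
    unfolding csum_def using assms
    by (intro formal_sum_eq) (auto simp: csum_terms_def tsum2_def fun_eq_iff)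
  then show ?thesis
    by (simp add: sum_fun_apply csum_terms_def tsum2_def)
qed

lemma csummableI:
  assumes "\<And>\<kappa>. finite (S \<kappa>)" "\<And>\<kappa> ij \<beta>. ij \<notin> S \<kappa> \<Longrightarrow> t ij (\<lambda>x y. G x y \<kappa> \<beta>) = 0"
  shows "csummable t G"
  unfolding csummable_def locally_finite_def
proof
  fix \<kappa>
  have "{ij \<in> UNIV. csum_terms t G ij \<kappa> \<noteq> 0} \<subseteq> S \<kappa>"
    using assms(2) by (auto simp: csum_terms_def tsum2_def fun_eq_iff)
  then show "finite {ij \<in> UNIV. csum_terms t G ij \<kappa> \<noteq> 0}"
    using assms(1) finite_subset by blast
qed

text \<open>On a tensor product, projections onto the degrees are easier to construct than unique
  decompositions. Uniqueness follows since projection \<open>j\<close>, applied to any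
  decomposition, returns its component of degree \<open>j\<close>.\<close>

lemma graded_spaceI:
  assumes "vector_space s" "\<And>i. \<exists>S. finite S \<and> gr i = module.span s S"
    and add: "\<And>i x y. h i (x + y) = h i x + h i y"
    and h_in: "\<And>i x. h i x \<in> gr i"
    and h_hom: "\<And>i j x. x \<in> gr i \<Longrightarrow> h j x = (if i = j then x else 0)"
    and h_fin: "\<And>x. finite {i. h i x \<noteq> 0}"
    and h_sum: "\<And>x. x = (\<Sum>i | h i x \<noteq> 0. h i x)"
  shows "graded_space s gr"
proof -
  have "\<exists>!c. (\<forall>i. c i \<in> gr i) \<and> finite {i. c i \<noteq> 0} \<and> a = (\<Sum>i | c i \<noteq> 0. c i)" for a
  proof (rule ex1I[of _ "\<lambda>i. h i a"])
    show "(\<forall>i. h i a \<in> gr i) \<and> finite {i. h i a \<noteq> 0} \<and> a = (\<Sum>i | h i a \<noteq> 0. h i a)"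
      using h_in h_fin h_sum by blast
    fix c
    assume c: "(\<forall>i. c i \<in> gr i) \<and> finite {i. c i \<noteq> 0} \<and> a = (\<Sum>i | c i \<noteq> 0. c i)"
    show "c = (\<lambda>i. h i a)"
    proof
      fix j
      have "h j a = h j (\<Sum>i | c i \<noteq> 0. c i)" using c by simp
      also have "\<dots> = (\<Sum>i | c i \<noteq> 0. h j (c i))"
        by (rule additive_sum) (rule add)
      also have "\<dots> = (\<Sum>i | c i \<noteq> 0. if i = j then c i else 0)"
        using c h_hom by (intro sum.cong) auto
      also have "\<dots> = c j" using c by (simp add: sum.delta)
      finally show "c j = h j a" by simp
    qed
  qed
  then show ?thesis
    using assms(1,2)
    by (auto simp: graded_space_def graded_space_axioms_def tensor_powers_def)
qed

context graded_space
begin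

lemma gr_subspace: "subspace (gr i)"
  using gr_finite_dim[of i] by auto

lemma gr_zero [simp]: "0 \<in> gr i"
  and gr_add: "x \<in> gr i \<Longrightarrow> y \<in> gr i \<Longrightarrow> x + y \<in> gr i"
  and gr_scale: "x \<in> gr i \<Longrightarrow> scale c x \<in> gr i"
  using gr_subspace[of i] by (auto simp: subspace_def)

lemma hcomp_decomposition:
  "(\<forall>i. hcomp i a \<in> gr i) \<and> finite {i. hcomp i a \<noteq> 0} \<and> a = (\<Sum>i | hcomp i a \<noteq> 0. hcomp i a)"
  using theI'[OF gr_direct_sum[of a]] unfolding hcomp_def .

lemma hcomp_in [simp]: "hcomp i a \<in> gr i"
  and finite_hcomp: "finite {i. hcomp i a \<noteq> 0}"
  and sum_hcomp: "(\<Sum>i | hcomp i a \<noteq> 0. hcomp i a) = a"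
  using hcomp_decomposition[of a] by auto

lemma sum_hcomp_superset:
  assumes "finite S" "\<And>i. i \<notin> S \<Longrightarrow> hcomp i a = 0"
  shows "(\<Sum>i\<in>S. hcomp i a) = a"
proof -
  have "(\<Sum>i | hcomp i a \<noteq> 0. hcomp i a) = (\<Sum>i\<in>S. hcomp i a)"
    using assms by (intro sum.mono_neutral_left) auto
  then show ?thesis by (simp add: sum_hcomp)
qed

lemma hcomp_eqI:
  assumes "finite S" "\<And>i. c i \<in> gr i" "\<And>i. i \<notin> S \<Longrightarrow> c i = 0" "a = (\<Sum>i\<in>S. c i)"
  shows "hcomp i a = c i"
proof -
  have S: "{i. c i \<noteq> 0} \<subseteq> S" using assms(3) by auto
  have "(\<Sum>i | c i \<noteq> 0. c i) = (\<Sum>i\<in>S. c i)"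
    using assms(1) S by (intro sum.mono_neutral_left) auto
  then have "(\<forall>i. c i \<in> gr i) \<and> finite {i. c i \<noteq> 0} \<and> a = (\<Sum>i | c i \<noteq> 0. c i)"
    using assms S finite_subset by metis
  then have "(THE c. (\<forall>i. c i \<in> gr i) \<and> finite {i. c i \<noteq> 0} \<and> a = (\<Sum>i | c i \<noteq> 0. c i)) = c"
    by (rule the1_equality[OF gr_direct_sum])
  then show ?thesis unfolding hcomp_def by (rule fun_cong)
qed

lemma hcomp_add: "hcomp i (a + b) = hcomp i a + hcomp i b"
proof -
  define S where "S = {i. hcomp i a \<noteq> 0} \<union> {i. hcomp i b \<noteq> 0}"
  have fin: "finite S" using finite_hcomp by (simp add: S_def)
  have "(\<Sum>i\<in>S. hcomp i a) = a" "(\<Sum>i\<in>S. hcomp i b) = b"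
    by (rule sum_hcomp_superset[OF fin]; simp add: S_def)+
  then have "a + b = (\<Sum>i\<in>S. hcomp i a + hcomp i b)"
    by (simp only: sum.distrib)
  then show ?thesis
    by (intro hcomp_eqI[OF fin]) (auto simp: S_def intro: gr_add)
qed

lemma hcomp_scale: "hcomp i (scale c a) = scale c (hcomp i a)"
proof (rule hcomp_eqI[of "{i. hcomp i a \<noteq> 0}"])
  show "scale c a = (\<Sum>i\<in>{i. hcomp i a \<noteq> 0}. scale c (hcomp i a))"
    using finite_hcomp by (simp add: sum_hcomp scale_sum_right[symmetric])
qed (auto intro: gr_scale finite_hcomp)

lemma hcomp_hom: "x \<in> gr i \<Longrightarrow> hcomp j x = (if i = j then x else 0)"
  by (rule hcomp_eqI[of "{i}"]) auto

lemma hcomp_zero [simp]: "hcomp i 0 = 0"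
  using hcomp_hom[of 0 i i] by simp

lemma bil_hcomp: "bil \<beta> \<Longrightarrow> bil (\<lambda>x y. \<beta> (hcomp i x) (hcomp j y))"
  by (rule bil_comp) (auto simp: hcomp_add hcomp_scale vector_space_axioms)

text \<open>
  Bilinear forms that vanish outside finitely many pairs of degrees pair with the whole
  completed tensor product, and elements of the latter are determined by these pairings.
\<close>
definition supp :: "('a \<Rightarrow> 'a \<Rightarrow> 'k) \<Rightarrow> (int \<times> int) set \<Rightarrow> bool" where
  "supp \<beta> S \<longleftrightarrow> (\<forall>i j. (i, j) \<notin> S \<longrightarrow> (\<forall>x\<in>gr i. \<forall>y\<in>gr j. \<beta> x y = 0))"

definition adm :: "('a \<Rightarrow> 'a \<Rightarrow> 'k) \<Rightarrow> bool" where
  "adm \<beta> \<longleftrightarrow> bil \<beta> \<and> (\<exists>S. finite S \<and> supp \<beta> S)"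

definition ev :: "('a, 'k) ctensor2 \<Rightarrow> ('a \<Rightarrow> 'a \<Rightarrow> 'k) \<Rightarrow> 'k" where
  "ev t \<beta> = (\<Sum>ij | t ij \<beta> \<noteq> 0. t ij \<beta>)"

lemma adm_bil: "adm \<beta> \<Longrightarrow> bil \<beta>"
  by (simp add: adm_def)

lemma ctensorD: "t \<in> ctensor \<Longrightarrow> t (i, j) \<in> tprod (gr i) (gr j)"
  by (simp add: ctensor_def)

lemma ctensorD': "t \<in> ctensor \<Longrightarrow> t ij \<in> tprod (gr (fst ij)) (gr (snd ij))"
  by (cases ij) (simp add: ctensor_def)

lemma ctensor_not_bil: "t \<in> ctensor \<Longrightarrow> \<not> bil \<beta> \<Longrightarrow> t ij \<beta> = 0"
  using tprod_not_bil[OF ctensorD'] by blast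

lemma ctensor_eq_zero:
  assumes "t \<in> ctensor" "bil \<beta>" "\<And>x y. x \<in> gr i \<Longrightarrow> y \<in> gr j \<Longrightarrow> \<beta> x y = 0"
  shows "t (i, j) \<beta> = 0"
  by (rule tprod_eq_zero[OF ctensorD[OF assms(1)] gr_subspace assms(2,3)])

lemma ctensor_cong:
  assumes "t \<in> ctensor" "bil \<beta>" "bil \<beta>'" "\<And>x y. x \<in> gr i \<Longrightarrow> y \<in> gr j \<Longrightarrow> \<beta> x y = \<beta>' x y"
  shows "t (i, j) \<beta> = t (i, j) \<beta>'"
  by (rule tprod_cong[OF ctensorD[OF assms(1)] gr_subspace assms(2,3,4)])

lemma ctensor_supp: "t \<in> ctensor \<Longrightarrow> bil \<beta> \<Longrightarrow> supp \<beta> S \<Longrightarrow> ij \<notin> S \<Longrightarrow> t ij \<beta> = 0"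
  using ctensor_eq_zero[of t \<beta> "fst ij" "snd ij"] by (cases ij) (simp add: supp_def)

lemma ev_eq:
  assumes "t \<in> ctensor" "bil \<beta>" "finite S" "supp \<beta> S"
  shows "ev t \<beta> = (\<Sum>ij\<in>S. t ij \<beta>)"
  unfolding ev_def
proof (rule sum.mono_neutral_left)
  show "{ij. t ij \<beta> \<noteq> 0} \<subseteq> S" using ctensor_supp[OF assms(1,2,4)] by auto
qed (use assms in auto)

lemma ctensor_zero: "0 \<in> ctensor"
  and ctensor_add: "s \<in> ctensor \<Longrightarrow> t \<in> ctensor \<Longrightarrow> s + t \<in> ctensor"
  and ctensor_diff: "s \<in> ctensor \<Longrightarrow> t \<in> ctensor \<Longrightarrow> s - t \<in> ctensor"
  and ctensor_minus: "s \<in> ctensor \<Longrightarrow> - s \<in> ctensor"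
  by (auto simp: ctensor_def intro: subspace_tprod)

lemma cflip_in: "t \<in> ctensor \<Longrightarrow> cflip t \<in> ctensor"
  by (auto simp: ctensor_def cflip_def intro: flip_in gr_subspace)

context
  fixes \<beta> assumes \<beta>: "adm \<beta>"
begin

lemma adm_obtain:
  obtains S where "finite S" "supp \<beta> S"
  using \<beta> by (auto simp: adm_def)

lemma ev_zero: "ev 0 \<beta> = 0"
  by (simp add: ev_def)

lemma ev_add: "s \<in> ctensor \<Longrightarrow> t \<in> ctensor \<Longrightarrow> ev (s + t) \<beta> = ev s \<beta> + ev t \<beta>"
  by (rule adm_obtain) (simp add: ev_eq adm_bil[OF \<beta>] ctensor_add sum.distrib)

lemma ev_diff: "s \<in> ctensor \<Longrightarrow> t \<in> ctensor \<Longrightarrow> ev (s - t) \<beta> = ev s \<beta> - ev t \<beta>"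
  by (rule adm_obtain) (simp add: ev_eq adm_bil[OF \<beta>] ctensor_diff sum_subtractf)

lemma ev_minus: "s \<in> ctensor \<Longrightarrow> ev (- s) \<beta> = - ev s \<beta>"
  by (rule adm_obtain) (simp add: ev_eq adm_bil[OF \<beta>] ctensor_minus sum_negf)

lemma adm_scale: "adm (\<lambda>x y. c * \<beta> x y)"
proof (rule adm_obtain)
  fix S assume "finite S" "supp \<beta> S"
  moreover from this have "supp (\<lambda>x y. c * \<beta> x y) S" by (auto simp: supp_def)
  ultimately show ?thesis using bil_scale[OF adm_bil[OF \<beta>]] by (auto simp: adm_def)
qed

lemma ev_scale_form: "t \<in> ctensor \<Longrightarrow> ev t (\<lambda>x y. c * \<beta> x y) = c * ev t \<beta>"
proof (rule adm_obtain)
  fix S assume t: "t \<in> ctensor" and S: "finite S" "supp \<beta> S"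
  have S': "supp (\<lambda>x y. c * \<beta> x y) S" using S by (auto simp: supp_def)
  show ?thesis
    using ev_eq[OF t adm_bil[OF adm_scale] S(1) S'] ev_eq[OF t adm_bil[OF \<beta>] S]
    by (simp add: tprod_scale_form[OF ctensorD'[OF t]] adm_bil[OF \<beta>] sum_distrib_left)
qed

lemma adm_swap: "adm (\<lambda>x y. \<beta> y x)"
proof (rule adm_obtain)
  fix S assume S: "finite S" "supp \<beta> S"
  have "supp (\<lambda>x y. \<beta> y x) (prod.swap ` S)"
    unfolding supp_def
  proof (intro allI impI ballI)
    fix i j x y assume "(i, j) \<notin> prod.swap ` S" "x \<in> gr i" "y \<in> gr j"
    moreover from this(1) have "(j, i) \<notin> S" by force
    ultimately show "\<beta> y x = 0" using S(2) by (auto simp: supp_def)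
  qed
  then show ?thesis using \<beta> S bil_swap by (auto simp: adm_def)
qed

lemma ev_cflip: 
  assumes t: "t \<in> ctensor"
  shows "ev (cflip t) \<beta> = ev t (\<lambda>x y. \<beta> y x)"
proof -
  have "cflip t (i, j) \<beta> = t (j, i) (\<lambda>x y. \<beta> y x)" for i j
    by (simp add: cflip_def flip_apply adm_bil[OF \<beta>])
  then have "(\<Sum>ij | cflip t ij \<beta> \<noteq> 0. cflip t ij \<beta>) =
      (\<Sum>ij | t ij (\<lambda>x y. \<beta> y x) \<noteq> 0. t ij (\<lambda>x y. \<beta> y x))"
    by (intro sum.reindex_bij_witness[of _ prod.swap prod.swap]) auto
  then show ?thesis by (simp add: ev_def)
qed

text \<open>Of the expansion of both arguments into homogeneous components only the degree pairs in
  \<open>S\<close> survive. An admissible form is thus a finite sum of forms that each see a single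
  component of a tensor.\<close>

lemma adm_sum_hcomp:
  assumes S: "finite S" "supp \<beta> S"
  shows "\<beta> x y = (\<Sum>(k, l)\<in>S. \<beta> (hcomp k x) (hcomp l y))"
proof -
  let ?X = "{i. hcomp i x \<noteq> 0}" and ?Y = "{j. hcomp j y \<noteq> 0}"
  note bd = bil_diff[OF adm_bil[OF \<beta>]]
  have "\<beta> x y = \<beta> (\<Sum>k\<in>?X. hcomp k x) (\<Sum>l\<in>?Y. hcomp l y)"
    by (simp add: sum_hcomp)
  also have "\<dots> = (\<Sum>k\<in>?X. \<Sum>l\<in>?Y. \<beta> (hcomp k x) (hcomp l y))"
    by (simp only: bd, rule sum.swap)
  also have "\<dots> = (\<Sum>(k, l)\<in>?X \<times> ?Y. \<beta> (hcomp k x) (hcomp l y))"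
    by (simp add: sum.cartesian_product)
  \<comment> \<open>Neither index set need contain the other, so the sum is first enlarged to the
    union and then cut down to \<open>S\<close>.\<close>
  also have "\<dots> = (\<Sum>(k, l)\<in>S \<union> ?X \<times> ?Y. \<beta> (hcomp k x) (hcomp l y))"
    using S(1) finite_hcomp by (intro sum.mono_neutral_left) (auto simp: bd)
  also have "\<dots> = (\<Sum>(k, l)\<in>S. \<beta> (hcomp k x) (hcomp l y))"
    using S finite_hcomp by (intro sum.mono_neutral_right) (auto simp: supp_def)
  finally show ?thesis .
qed

end

lemma adm_combine:
  assumes "adm \<beta>" "adm \<beta>'"
  shows adm_add: "adm (\<lambda>x y. \<beta> x y + \<beta>' x y)"
    and adm_common: "\<exists>S. finite S \<and> supp \<beta> S \<and> supp \<beta>' S"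
proof -
  obtain S S' where "finite S" "supp \<beta> S" "finite S'" "supp \<beta>' S'"
    using assms by (auto simp: adm_def)
  then have S: "finite (S \<union> S')" "supp \<beta> (S \<union> S')" "supp \<beta>' (S \<union> S')"
    by (auto simp: supp_def)
  then show "\<exists>S. finite S \<and> supp \<beta> S \<and> supp \<beta>' S" by blast
  have "supp (\<lambda>x y. \<beta> x y + \<beta>' x y) (S \<union> S')"
    using S by (auto simp: supp_def)
  then show "adm (\<lambda>x y. \<beta> x y + \<beta>' x y)"
    using S(1) bil_add adm_bil assms unfolding adm_def by blast
qed

lemma adm_zero: "adm (\<lambda>_ _. 0)"
  by (auto simp: adm_def supp_def)

lemma ev_add_form:
  assumes t: "t \<in> ctensor" and "adm \<beta>" "adm \<beta>'"
  shows "ev t (\<lambda>x y. \<beta> x y + \<beta>' x y) = ev t \<beta> + ev t \<beta>'"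
proof -
  obtain S where S: "finite S" "supp \<beta> S" "supp \<beta>' S"
    using adm_common assms by blast
  then have S': "supp (\<lambda>x y. \<beta> x y + \<beta>' x y) S"
    by (auto simp: supp_def)
  note b = adm_bil[OF assms(2)] adm_bil[OF assms(3)]
  show ?thesis
    using b S S' by (simp add: ev_eq[OF t] bil_add sum.distrib tprod_add_form[OF ctensorD'[OF t]])
qed

lemma adm_sum: "(\<And>i. i \<in> I \<Longrightarrow> adm (\<beta> i)) \<Longrightarrow> adm (\<lambda>x y. \<Sum>i\<in>I. \<beta> i x y)"
  by (induction I rule: infinite_finite_induct) (auto intro: adm_add adm_zero)

lemma ev_sum_form:
  "t \<in> ctensor \<Longrightarrow> (\<And>i. i \<in> I \<Longrightarrow> adm (\<beta> i)) \<Longrightarrow> ev t (\<lambda>x y. \<Sum>i\<in>I. \<beta> i x y) = (\<Sum>i\<in>I. ev t (\<beta> i))"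
proof (induction I rule: infinite_finite_induct)
  case (insert i I)
  then show ?case using ev_add_form[of t "\<beta> i" "\<lambda>x y. \<Sum>i\<in>I. \<beta> i x y"] adm_sum[of I \<beta>] by simp
qed (auto simp: ev_def tprod_zero_form[OF ctensorD'])

lemma supp_hcomp: "bil \<beta> \<Longrightarrow> supp (\<lambda>x y. \<beta> (hcomp i x) (hcomp j y)) {(i, j)}"
  by (auto simp: supp_def hcomp_hom bil_diff)

lemma adm_hcomp: "bil \<beta> \<Longrightarrow> adm (\<lambda>x y. \<beta> (hcomp i x) (hcomp j y))"
  using supp_hcomp bil_hcomp by (auto simp: adm_def)

text \<open>Projecting both arguments of a form to single degrees isolates one component of the
  tensor. This is why pairings with admissible forms lose nothing.\<close>

lemma component_eq_ev:
  assumes "t \<in> ctensor" "bil \<beta>"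
  shows "t (i, j) \<beta> = ev t (\<lambda>x y. \<beta> (hcomp i x) (hcomp j y))"
proof -
  have "t (i, j) \<beta> = t (i, j) (\<lambda>x y. \<beta> (hcomp i x) (hcomp j y))"
    by (rule ctensor_cong[OF assms bil_hcomp[OF assms(2)]]) (simp add: hcomp_hom)
  then show ?thesis
    using ev_eq[OF assms(1) bil_hcomp[OF assms(2)] _ supp_hcomp[OF assms(2)]] by simp
qed

lemma ctensor_eqI:
  assumes "s \<in> ctensor" "t \<in> ctensor" "\<And>\<beta>. adm \<beta> \<Longrightarrow> ev s \<beta> = ev t \<beta>"
  shows "s = t"
proof
  fix ij
  show "s ij = t ij"
  proof (rule tprod_eqI[OF ctensorD'[OF assms(1)] ctensorD'[OF assms(2)]])
    fix \<beta> :: "'a \<Rightarrow> 'a \<Rightarrow> 'k" assume "bil \<beta>"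
    then show "s ij \<beta> = t ij \<beta>"
      using component_eq_ev[of s \<beta>] component_eq_ev[of t \<beta>] assms adm_hcomp
      by (cases ij) simp
  qed
qed

text \<open>Multiplication by an element with several components maps no degree into a single one,
  so graded maps would be too narrow. What \<open>f \<otimes> g\<close> needs on a completed tensor
  is that each target degree is reached from finitely many source degrees.\<close>

definition locfin :: "('a \<Rightarrow> 'a) \<Rightarrow> bool" where
  "locfin f \<longleftrightarrow> (\<forall>x y. f (x + y) = f x + f y) \<and> (\<forall>c x. f (scale c x) = scale c (f x)) \<and>
    (\<forall>k. finite {i. \<exists>x\<in>gr i. hcomp k (f x) \<noteq> 0})"

lemma locfin_id: "locfin id"
proof -
  have "{i. \<exists>x\<in>gr i. hcomp k x \<noteq> 0} \<subseteq> {k}" for k by (auto simp: hcomp_hom split: if_splits)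
  then show ?thesis by (auto simp: locfin_def intro: finite_subset)
qed

lemma locfin_add: assumes "locfin f" "locfin g" shows "locfin (f + g)"
proof -
  have "{i. \<exists>x\<in>gr i. hcomp k ((f + g) x) \<noteq> 0} \<subseteq>
      {i. \<exists>x\<in>gr i. hcomp k (f x) \<noteq> 0} \<union> {i. \<exists>x\<in>gr i. hcomp k (g x) \<noteq> 0}" for k
    by (auto simp: hcomp_add)
  then have "finite {i. \<exists>x\<in>gr i. hcomp k ((f + g) x) \<noteq> 0}" for k
    by (rule finite_subset) (use assms in \<open>auto simp: locfin_def\<close>)
  then show ?thesis using assms by (auto simp: locfin_def scale_right_distrib)
qed

lemma hcomp_diff: "hcomp i (a - b) = hcomp i a - hcomp i b"
  by (rule additive_diff) (rule hcomp_add)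

lemma locfin_diff: assumes "locfin f" "locfin g" shows "locfin (f - g)"
proof -
  have "{i. \<exists>x\<in>gr i. hcomp k ((f - g) x) \<noteq> 0} \<subseteq>
      {i. \<exists>x\<in>gr i. hcomp k (f x) \<noteq> 0} \<union> {i. \<exists>x\<in>gr i. hcomp k (g x) \<noteq> 0}" for k
    by (auto simp: hcomp_diff)
  then have "finite {i. \<exists>x\<in>gr i. hcomp k ((f - g) x) \<noteq> 0}" for k
    by (rule finite_subset) (use assms in \<open>auto simp: locfin_def\<close>)
  then show ?thesis using assms by (auto simp: locfin_def scale_right_diff_distrib)
qed

context
  fixes f g :: "'a \<Rightarrow> 'a"
  assumes f: "locfin f" and g: "locfin g"
begin

lemma bil_locfin: "bil \<beta> \<Longrightarrow> bil (\<lambda>x y. \<beta> (f x) (g y))"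
  by (rule bil_comp) (use f g in \<open>auto simp: locfin_def vector_space_axioms\<close>)

lemma locfin_supp:
  obtains S where "\<And>k l. finite (S k l)"
    "\<And>k l \<beta>. bil \<beta> \<Longrightarrow> supp (\<lambda>x y. \<beta> (hcomp k (f x)) (hcomp l (g y))) (S k l)"
proof
  let ?S = "\<lambda>k l. {i. \<exists>x\<in>gr i. hcomp k (f x) \<noteq> 0} \<times> {j. \<exists>y\<in>gr j. hcomp l (g y) \<noteq> 0}"
  show "finite (?S k l)" for k l using f g by (auto simp: locfin_def)
  show "supp (\<lambda>x y. \<beta> (hcomp k (f x)) (hcomp l (g y))) (?S k l)" if "bil \<beta>" for k l \<beta>
    unfolding supp_def
  proof (intro allI impI ballI)
    fix i j x y assume "(i, j) \<notin> ?S k l" "x \<in> gr i" "y \<in> gr j"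
    then have "hcomp k (f x) = 0 \<or> hcomp l (g y) = 0" by auto
    then show "\<beta> (hcomp k (f x)) (hcomp l (g y)) = 0"
      using bil_diff[OF that] by auto
  qed
qed

text \<open>The pullback of a form living in one degree pair is supported in finitely many pairs by
  local finiteness; a general admissible form is a finite sum of such forms.\<close>

lemma adm_locfin:
  assumes "adm \<beta>"
  shows "adm (\<lambda>x y. \<beta> (f x) (g y))"
proof -
  obtain S where S: "finite S" "supp \<beta> S" using adm_obtain[OF assms] .
  have "adm (\<lambda>x y. \<beta> (hcomp (fst kl) (f x)) (hcomp (snd kl) (g y)))" for kl
    using bil_locfin[OF bil_hcomp[OF adm_bil[OF assms]]] adm_bil[OF assms]
    by (metis adm_def locfin_supp)
  then have "adm (\<lambda>x y. \<Sum>kl\<in>S. \<beta> (hcomp (fst kl) (f x)) (hcomp (snd kl) (g y)))"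
    by (rule adm_sum)
  moreover have "(\<lambda>x y. \<beta> (f x) (g y)) =
      (\<lambda>x y. \<Sum>kl\<in>S. \<beta> (hcomp (fst kl) (f x)) (hcomp (snd kl) (g y)))"
    by (intro ext, subst adm_sum_hcomp[OF assms S]) (simp add: case_prod_unfold)
  ultimately show ?thesis by simp
qed

context
  fixes t assumes t: "t \<in> ctensor"
begin

lemma cmap2_apply:
  assumes "bil \<beta>"
  shows "cmap2 f g t (k, l) \<beta> = ev t (\<lambda>x y. \<beta> (hcomp k (f x)) (hcomp l (g y)))"
proof (rule locfin_supp)
  fix S assume S: "\<And>k l. finite (S k l)"
    "\<And>k l \<beta>. bil \<beta> \<Longrightarrow> supp (\<lambda>x y. \<beta> (hcomp k (f x)) (hcomp l (g y))) (S k l)"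
  have "cmap2 f g t (k, l) \<beta> = (\<Sum>ij\<in>S k l. t ij (\<lambda>x y. cpure2 (f x) (g y) (k, l) \<beta>))"
    unfolding cmap2_def
  proof (rule csum_apply)
    fix ij and \<beta> :: "'a \<Rightarrow> 'a \<Rightarrow> 'k" assume "ij \<notin> S k l"
    then have "bil \<beta> \<Longrightarrow> t ij (\<lambda>x y. \<beta> (hcomp k (f x)) (hcomp l (g y))) = 0"
      by (intro ctensor_supp[OF t _ S(2)[of \<beta> k l]] bil_locfin[of "\<lambda>x y. \<beta> (hcomp k x) (hcomp l y)"]
          bil_hcomp)
    then show "t ij (\<lambda>x y. cpure2 (f x) (g y) (k, l) \<beta>) = 0"
      using tprod_zero_form[OF ctensorD'[OF t]]
      by (cases "bil \<beta>") (auto simp: cpure2_def pure2_def)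
  qed (rule S)
  then show ?thesis
    using ev_eq[OF t bil_locfin[OF bil_hcomp[OF assms]] S(1) S(2)[OF assms]] assms
    by (simp add: cpure2_def pure2_def)
qed

lemma cmap2_in: "cmap2 f g t \<in> ctensor"
proof -
  have "tsum2 (t ij) (\<lambda>x y. pure2 (hcomp k (f x)) (hcomp l (g y))) \<in> tprod (gr k) (gr l)" for ij k l
  proof -
    obtain n :: nat and x y where n: "t ij = (\<Sum>i<n. pure2 (x i) (y i))"
      by (rule tprodE[OF ctensorD'[OF t] gr_subspace])
    have "tsum2 (t ij) (\<lambda>x y. pure2 (hcomp k (f x)) (hcomp l (g y))) =
        (\<Sum>i<n. pure2 (hcomp k (f (x i))) (hcomp l (g (y i))))"
    proof
      show "tsum2 (t ij) (\<lambda>x y. pure2 (hcomp k (f x)) (hcomp l (g y))) \<beta> =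
        (\<Sum>i<n. pure2 (hcomp k (f (x i))) (hcomp l (g (y i)))) \<beta>" for \<beta>
        using bil_locfin[OF bil_hcomp, of \<beta>]
        by (cases "bil \<beta>") (auto simp: tsum2_def n sum_fun_apply pure2_def)
    qed
    then show ?thesis by (simp only:) (intro tprod_sum tprod_pure2 hcomp_in)
  qed
  then show ?thesis
    by (auto simp: ctensor_def cmap2_def csum_def formal_sum_def csum_terms_def cpure2_def
        intro!: tprod_sum)
qed

text \<open>Transposition: instead of applying \<open>f \<otimes> g\<close> to an infinite family,
  the form is pulled back. Later calculations with operators rest on this duality and not on the
  formal sum that defines \<open>cmap2\<close>.\<close>

lemma ev_cmap2:
  assumes \<beta>: "adm \<beta>"
  shows "ev (cmap2 f g t) \<beta> = ev t (\<lambda>x y. \<beta> (f x) (g y))"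
proof -
  obtain S where S: "finite S" "supp \<beta> S" using adm_obtain[OF \<beta>] .
  have "ev (cmap2 f g t) \<beta> = (\<Sum>kl\<in>S. cmap2 f g t kl \<beta>)"
    by (rule ev_eq[OF cmap2_in adm_bil[OF \<beta>] S])
  also have "\<dots> = (\<Sum>kl\<in>S. ev t (\<lambda>x y. \<beta> (hcomp (fst kl) (f x)) (hcomp (snd kl) (g y))))"
    using cmap2_apply[OF adm_bil[OF \<beta>]] by (intro sum.cong) auto
  also have "\<dots> = ev t (\<lambda>x y. \<Sum>kl\<in>S. \<beta> (hcomp (fst kl) (f x)) (hcomp (snd kl) (g y)))"
    by (subst ev_sum_form[OF t]) (auto intro!: adm_locfin adm_hcomp adm_bil \<beta>)
  also have "(\<lambda>x y. \<Sum>kl\<in>S. \<beta> (hcomp (fst kl) (f x)) (hcomp (snd kl) (g y))) = (\<lambda>x y. \<beta> (f x) (g y))"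
    by (intro ext, subst (2) adm_sum_hcomp[OF \<beta> S]) (simp add: case_prod_unfold)
  finally show ?thesis .
qed

end

end

context
  fixes f g t
  assumes f: "locfin f" and g: "locfin g" and t: "t \<in> ctensor"
begin

lemma cmap2_add: "s \<in> ctensor \<Longrightarrow> cmap2 f g (t + s) = cmap2 f g t + cmap2 f g s"
  by (rule ctensor_eqI)
    (simp_all add: cmap2_in ctensor_add ev_cmap2 ev_add adm_locfin f g t)

lemma cmap2_add_left:
  assumes h: "locfin h"
  shows "cmap2 (f + h) g t = cmap2 f g t + cmap2 h g t"
proof (rule ctensor_eqI)
  fix \<beta> assume \<beta>: "adm \<beta>"
  have "(\<lambda>x y. \<beta> ((f + h) x) (g y)) = (\<lambda>x y. \<beta> (f x) (g y) + \<beta> (h x) (g y))"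
    using adm_bil[OF \<beta>] by (simp add: bil_iff fun_eq_iff)
  then show "ev (cmap2 (f + h) g t) \<beta> = ev (cmap2 f g t + cmap2 h g t) \<beta>"
    using \<beta> by (simp only: ev_cmap2 ev_add ev_add_form locfin_add cmap2_in adm_locfin f g h t)
qed (simp_all only: cmap2_in ctensor_add locfin_add f g h t)

lemma cmap2_add_right:
  assumes h: "locfin h"
  shows "cmap2 f (g + h) t = cmap2 f g t + cmap2 f h t"
proof (rule ctensor_eqI)
  fix \<beta> assume \<beta>: "adm \<beta>"
  have "(\<lambda>x y. \<beta> (f x) ((g + h) y)) = (\<lambda>x y. \<beta> (f x) (g y) + \<beta> (f x) (h y))"
    using adm_bil[OF \<beta>] by (simp add: bil_iff fun_eq_iff)
  then show "ev (cmap2 f (g + h) t) \<beta> = ev (cmap2 f g t + cmap2 f h t) \<beta>"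
    using \<beta> by (simp only: ev_cmap2 ev_add ev_add_form locfin_add cmap2_in adm_locfin f g h t)
qed (simp_all only: cmap2_in ctensor_add locfin_add f g h t)

end

lemma cflip_add: "s \<in> ctensor \<Longrightarrow> t \<in> ctensor \<Longrightarrow> cflip (s + t) = cflip s + cflip t"
  by (rule ctensor_eqI)
    (simp_all add: cflip_in ctensor_add ev_cflip ev_add adm_swap)

text \<open>The element \<open>a\<close> has finitely many components, and multiplication by the one
  of degree \<open>j\<close> reaches degree \<open>k\<close> only from degree
  \<open>k - j\<close>.\<close>

lemma locfin_graded_op:
  assumes bil: "bilinear_map scale scale scale h"
    and gr: "\<And>x y i j. x \<in> gr i \<Longrightarrow> y \<in> gr j \<Longrightarrow> h x y \<in> gr (i + j)"
  shows "locfin (h a)" "locfin (\<lambda>x. h x a)"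
proof -
  have lin: "h x (y + y') = h x y + h x y'" "h x (scale c y) = scale c (h x y)"
      "h (x + x') y = h x y + h x' y" "h (scale c x) y = scale c (h x y)" for x x' y y' c
    using bil bilinear_map_iff[OF vector_space_axioms vector_space_axioms vector_space_axioms] by auto
  have h1: "hcomp k (h (hcomp j a) x) = (if j + i = k then h (hcomp j a) x else 0)"
    and h2: "hcomp k (h x (hcomp j a)) = (if j + i = k then h x (hcomp j a) else 0)"
    if "x \<in> gr i" for x i j k
    using hcomp_hom[OF gr[OF hcomp_in that]] hcomp_hom[OF gr[OF that hcomp_in]]
    by (auto simp: add.commute)
  have s1: "hcomp k (h a x) = (\<Sum>j | hcomp j a \<noteq> 0. hcomp k (h (hcomp j a) x))"
    and s2: "hcomp k (h x a) = (\<Sum>j | hcomp j a \<noteq> 0. hcomp k (h x (hcomp j a)))" for x k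
    using additive_sum[of "\<lambda>a. hcomp k (h a x)" "\<lambda>j. hcomp j a" "{j. hcomp j a \<noteq> 0}"]
      additive_sum[of "\<lambda>a. hcomp k (h x a)" "\<lambda>j. hcomp j a" "{j. hcomp j a \<noteq> 0}"]
    by (simp_all add: lin hcomp_add sum_hcomp)
  have "i \<in> (\<lambda>j. k - j) ` {j. hcomp j a \<noteq> 0}"
    if x: "x \<in> gr i" and nz: "hcomp k (h a x) \<noteq> 0 \<or> hcomp k (h x a) \<noteq> 0" for i k x
  proof -
    obtain j where j: "hcomp j a \<noteq> 0"
      "hcomp k (h (hcomp j a) x) \<noteq> 0 \<or> hcomp k (h x (hcomp j a)) \<noteq> 0"
      using nz unfolding s1 s2 by (metis (mono_tags, lifting) mem_Collect_eq sum.neutral)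
    then have "i = k - j" using h1[OF x] h2[OF x] by (auto split: if_splits)
    then show ?thesis using j(1) by blast
  qed
  then have "{i. \<exists>x\<in>gr i. hcomp k (h a x) \<noteq> 0} \<subseteq> (\<lambda>j. k - j) ` {j. hcomp j a \<noteq> 0}"
    "{i. \<exists>x\<in>gr i. hcomp k (h x a) \<noteq> 0} \<subseteq> (\<lambda>j. k - j) ` {j. hcomp j a \<noteq> 0}" for k
    by blast+
  note sub = this
  have "finite {i. \<exists>x\<in>gr i. hcomp k (h a x) \<noteq> 0}"
    "finite {i. \<exists>x\<in>gr i. hcomp k (h x a) \<noteq> 0}" for k
    by (rule finite_subset[OF sub(1) finite_imageI[OF finite_hcomp]],
        rule finite_subset[OF sub(2) finite_imageI[OF finite_hcomp]])
  then show "locfin (h a)" "locfin (\<lambda>x. h x a)"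
    by (auto simp: locfin_def lin)
qed

text \<open>The finiteness condition ensures that \<open>F \<otimes> id\<close> and \<open>id \<otimes> F\<close> are defined.\<close>
definition locfin2 :: "('a \<Rightarrow> ('a, 'k) ctensor2) \<Rightarrow> bool" where
  "locfin2 F \<longleftrightarrow> (\<forall>x. F x \<in> ctensor) \<and> (\<forall>x y. F (x + y) = F x + F y) \<and>
    (\<forall>c x. F (scale c x) = cscale c (F x)) \<and> (\<forall>k l. finite {i. \<exists>x\<in>gr i. F x (k, l) \<noteq> 0})"

lemma tri_bil:
  assumes "trilinear_form scale \<beta>"
  shows "bil (\<lambda>x y. \<beta> x y z)" "bil (\<lambda>x y. \<beta> x z y)" "bil (\<beta> z)"
  using assms by (auto simp: bil_iff tri_iff)

text \<open>The degrees of the two legs taken from \<open>t\<close> determine the component of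
  \<open>t\<close> they come from, so the formal sum collapses to one term. The case distinction is
  the default value of \<open>pure3\<close> off the trilinear forms.\<close>

lemma csum_cpure3:
  assumes t: "t \<in> ctensor"
  shows "csum t (\<lambda>x' x''. cpure3 x' x'' y) (k, l, n) \<beta> =
      (if trilinear_form scale \<beta> then t (k, l) (\<lambda>x' x''. \<beta> x' x'' (hcomp n y)) else 0)"
    and "csum t (\<lambda>x' x''. cpure3 y x' x'') (n, k, l) \<beta> =
      (if trilinear_form scale \<beta> then t (k, l) (\<lambda>x' x''. \<beta> (hcomp n y) x' x'') else 0)"
proof -
  note z = tprod_zero_form[OF ctensorD'[OF t]]
  have zero: "t ij (\<lambda>x' x''. \<gamma> (hcomp k x') (hcomp l x'')) = 0" if "ij \<noteq> (k, l)" "bil \<gamma>" for ij \<gamma>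
    using ctensor_supp[OF t bil_hcomp[OF that(2)] supp_hcomp[OF that(2)], of ij k l] that by auto
  have eq: "t (k, l) (\<lambda>x' x''. \<gamma> (hcomp k x') (hcomp l x'')) = t (k, l) \<gamma>" if "bil \<gamma>" for \<gamma>
    by (rule ctensor_cong[OF t bil_hcomp[OF that] that]) (simp add: hcomp_hom)
  have "t ij (\<lambda>x' x''. cpure3 x' x'' y (k, l, n) \<beta>) = 0"
    "t ij (\<lambda>x' x''. cpure3 y x' x'' (n, k, l) \<beta>) = 0" if "ij \<notin> {(k, l)}" for ij \<beta>
    using that z zero[OF _ tri_bil(1)[of \<beta> "hcomp n y"], of ij] zero[OF _ tri_bil(3)[of \<beta> "hcomp n y"], of ij]
    by (cases "trilinear_form scale \<beta>"; simp add: cpure3_def pure3_def)+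
  note terms = this
  have "csum t (\<lambda>x' x''. cpure3 x' x'' y) (k, l, n) \<beta> =
      (\<Sum>ij\<in>{(k, l)}. t ij (\<lambda>x' x''. cpure3 x' x'' y (k, l, n) \<beta>))"
    by (rule csum_apply) (use terms(1) in auto)
  then show "csum t (\<lambda>x' x''. cpure3 x' x'' y) (k, l, n) \<beta> =
      (if trilinear_form scale \<beta> then t (k, l) (\<lambda>x' x''. \<beta> x' x'' (hcomp n y)) else 0)"
    by (auto simp: cpure3_def pure3_def z eq[OF tri_bil(1)])
  have "csum t (\<lambda>x' x''. cpure3 y x' x'') (n, k, l) \<beta> =
      (\<Sum>ij\<in>{(k, l)}. t ij (\<lambda>x' x''. cpure3 y x' x'' (n, k, l) \<beta>))"
    by (rule csum_apply) (use terms(2) in auto)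
  then show "csum t (\<lambda>x' x''. cpure3 y x' x'') (n, k, l) \<beta> =
      (if trilinear_form scale \<beta> then t (k, l) (\<lambda>x' x''. \<beta> (hcomp n y) x' x'') else 0)"
    by (auto simp: cpure3_def pure3_def z eq[OF tri_bil(3)])
qed

context
  fixes F t
  assumes F: "locfin2 F" and t: "t \<in> ctensor"
begin

lemma locfin2_rules:
  "F x \<in> ctensor" "F (x + y) = F x + F y" "F (scale c x) = cscale c (F x)"
  "finite {i. \<exists>x\<in>gr i. F x (k, l) \<noteq> 0}"
  using F by (auto simp: locfin2_def)

lemma bil_locfin2:
  assumes "trilinear_form scale \<beta>"
  shows "bil (\<lambda>x y. F x (k, l) (\<lambda>x' x''. \<beta> x' x'' (hcomp n y)))"
    and "bil (\<lambda>x y. F y (k, l) (\<lambda>y' y''. \<beta> (hcomp n x) y' y''))"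
proof -
  have b: "bil (\<lambda>x y. \<beta> x y z)" "bil (\<beta> z)" for z using tri_bil[OF assms] by auto
  have "(\<lambda>x' x''. \<beta> x' x'' (hcomp n (y + y'))) =
      (\<lambda>x' x''. \<beta> x' x'' (hcomp n y) + \<beta> x' x'' (hcomp n y'))"
    "\<beta> (hcomp n (y + y')) = (\<lambda>x' x''. \<beta> (hcomp n y) x' x'' + \<beta> (hcomp n y') x' x'')"
    "(\<lambda>x' x''. \<beta> x' x'' (hcomp n (scale c y))) = (\<lambda>x' x''. c * \<beta> x' x'' (hcomp n y))"
    "\<beta> (hcomp n (scale c y)) = (\<lambda>x' x''. c * \<beta> (hcomp n y) x' x'')" for c y y'
    using assms by (auto simp: fun_eq_iff hcomp_add hcomp_scale tri_iff)
  then show "bil (\<lambda>x y. F x (k, l) (\<lambda>x' x''. \<beta> x' x'' (hcomp n y)))"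
    "bil (\<lambda>x y. F y (k, l) (\<lambda>y' y''. \<beta> (hcomp n x) y' y''))"
    using tprod_add_form[OF ctensorD'[OF locfin2_rules(1)] b(1) b(1)]
      tprod_add_form[OF ctensorD'[OF locfin2_rules(1)] b(2) b(2)]
      tprod_scale_form[OF ctensorD'[OF locfin2_rules(1)] b(1)]
      tprod_scale_form[OF ctensorD'[OF locfin2_rules(1)] b(2)]
    by (auto simp: bil_iff locfin2_rules cscale_def fscale_def)
qed

lemma supp_locfin2:
  assumes "trilinear_form scale \<beta>"
  shows "supp (\<lambda>x y. F x (k, l) (\<lambda>x' x''. \<beta> x' x'' (hcomp n y))) ({i. \<exists>x\<in>gr i. F x (k, l) \<noteq> 0} \<times> {n})"
    and "supp (\<lambda>x y. F y (k, l) (\<lambda>y' y''. \<beta> (hcomp n x) y' y'')) ({n} \<times> {i. \<exists>x\<in>gr i. F x (k, l) \<noteq> 0})"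
proof -
  have "\<beta> x y 0 = 0" "\<beta> 0 x y = 0" for x y
    using additive_zero[of "\<beta> x y"] additive_zero[of "\<lambda>z. \<beta> z x y"] assms by (auto simp: tri_iff)
  then have "F x (k, l) (\<lambda>x' x''. \<beta> x' x'' (hcomp n y)) = 0"
    "F x (k, l) (\<lambda>x' x''. \<beta> (hcomp n y) x' x'') = 0" if "y \<in> gr i" "i \<noteq> n" for x y i
    using that tprod_zero_form[OF ctensorD'[OF locfin2_rules(1)]] by (auto simp: hcomp_hom)
  moreover have "F x (k, l) \<gamma> = 0" if "x \<in> gr i" "i \<notin> {i. \<exists>x\<in>gr i. F x (k, l) \<noteq> 0}" for i x \<gamma>
  proof -
    have "F x (k, l) = 0" using that by blast
    then show ?thesis by simp
  qed
  ultimately show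
    "supp (\<lambda>x y. F x (k, l) (\<lambda>x' x''. \<beta> x' x'' (hcomp n y))) ({i. \<exists>x\<in>gr i. F x (k, l) \<noteq> 0} \<times> {n})"
    "supp (\<lambda>x y. F y (k, l) (\<lambda>y' y''. \<beta> (hcomp n x) y' y'')) ({n} \<times> {i. \<exists>x\<in>gr i. F x (k, l) \<noteq> 0})"
    unfolding supp_def by blast+
qed

lemma clmap3_term_zero:
  assumes "ij \<notin> {i. \<exists>x\<in>gr i. F x (k, l) \<noteq> 0} \<times> {n}"
  shows "t ij (\<lambda>x y. csum (F x) (\<lambda>x' x''. cpure3 x' x'' y) (k, l, n) \<beta>) = 0"
proof (cases "trilinear_form scale \<beta>")
  case True
  then show ?thesis
    unfolding csum_cpure3[OF locfin2_rules(1)]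
    using ctensor_supp[OF t bil_locfin2(1)[OF True] supp_locfin2(1)[OF True] assms] by simp
qed (simp add: csum_cpure3[OF locfin2_rules(1)] tprod_zero_form[OF ctensorD'[OF t]])

lemma crmap3_term_zero:
  assumes "ij \<notin> {n} \<times> {i. \<exists>x\<in>gr i. F x (k, l) \<noteq> 0}"
  shows "t ij (\<lambda>x y. csum (F y) (\<lambda>x' x''. cpure3 x x' x'') (n, k, l) \<beta>) = 0"
proof (cases "trilinear_form scale \<beta>")
  case True
  then show ?thesis
    unfolding csum_cpure3[OF locfin2_rules(1)]
    using ctensor_supp[OF t bil_locfin2(2)[OF True] supp_locfin2(2)[OF True] assms] by simp
qed (simp add: csum_cpure3[OF locfin2_rules(1)] tprod_zero_form[OF ctensorD'[OF t]])

lemma clmap3_defined: "clmap3_defined F t"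
  unfolding clmap3_defined_def
proof (rule csummableI[of "\<lambda>(k, l, n). {i. \<exists>x\<in>gr i. F x (k, l) \<noteq> 0} \<times> {n}"])
  fix \<kappa> :: "int \<times> int \<times> int"
  show "finite (case \<kappa> of (k, l, n) \<Rightarrow> {i. \<exists>x\<in>gr i. F x (k, l) \<noteq> 0} \<times> {n})"
    using locfin2_rules(4) by (cases \<kappa>) auto
  show "t ij (\<lambda>x y. csum (F x) (\<lambda>x' x''. cpure3 x' x'' y) \<kappa> \<beta>) = 0"
    if "ij \<notin> (case \<kappa> of (k, l, n) \<Rightarrow> {i. \<exists>x\<in>gr i. F x (k, l) \<noteq> 0} \<times> {n})" for ij \<beta>
    using that clmap3_term_zero by (cases \<kappa>) auto
qed

lemma crmap3_defined: "crmap3_defined F t"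
  unfolding crmap3_defined_def
proof (rule csummableI[of "\<lambda>(n, k, l). {n} \<times> {i. \<exists>x\<in>gr i. F x (k, l) \<noteq> 0}"])
  fix \<kappa> :: "int \<times> int \<times> int"
  show "finite (case \<kappa> of (n, k, l) \<Rightarrow> {n} \<times> {i. \<exists>x\<in>gr i. F x (k, l) \<noteq> 0})"
    using locfin2_rules(4) by (cases \<kappa>) auto
  show "t ij (\<lambda>x y. csum (F y) (\<lambda>x' x''. cpure3 x x' x'') \<kappa> \<beta>) = 0"
    if "ij \<notin> (case \<kappa> of (n, k, l) \<Rightarrow> {n} \<times> {i. \<exists>x\<in>gr i. F x (k, l) \<noteq> 0})" for ij \<beta>
    using that crmap3_term_zero by (cases \<kappa>) auto
qed

lemma clmap3_apply: "clmap3 F t (k, l, n) \<beta> = (if trilinear_form scale \<beta>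
    then ev t (\<lambda>x y. F x (k, l) (\<lambda>x' x''. \<beta> x' x'' (hcomp n y))) else 0)"
proof -
  let ?S = "{i. \<exists>x\<in>gr i. F x (k, l) \<noteq> 0} \<times> {n}"
  have S: "finite ?S" using locfin2_rules(4) by auto
  have *: "clmap3 F t (k, l, n) \<beta> =
      (\<Sum>ij\<in>?S. t ij (\<lambda>x y. csum (F x) (\<lambda>x' x''. cpure3 x' x'' y) (k, l, n) \<beta>))"
    unfolding clmap3_def by (rule csum_apply) (use S clmap3_term_zero in blast)+
  show ?thesis
  proof (cases "trilinear_form scale \<beta>")
    case True
    then show ?thesis
      using ev_eq[OF t bil_locfin2(1)[OF True] S supp_locfin2(1)[OF True]]
      by (simp add: * csum_cpure3[OF locfin2_rules(1)])
  qed (simp add: * csum_cpure3[OF locfin2_rules(1)] tprod_zero_form[OF ctensorD'[OF t]])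
qed

lemma crmap3_apply: "crmap3 F t (n, k, l) \<beta> = (if trilinear_form scale \<beta>
    then ev t (\<lambda>x y. F y (k, l) (\<lambda>y' y''. \<beta> (hcomp n x) y' y'')) else 0)"
proof -
  let ?S = "{n} \<times> {i. \<exists>x\<in>gr i. F x (k, l) \<noteq> 0}"
  have S: "finite ?S" using locfin2_rules(4) by auto
  have *: "crmap3 F t (n, k, l) \<beta> =
      (\<Sum>ij\<in>?S. t ij (\<lambda>x y. csum (F y) (\<lambda>x' x''. cpure3 x x' x'') (n, k, l) \<beta>))"
    unfolding crmap3_def by (rule csum_apply) (use S crmap3_term_zero in blast)+
  show ?thesis
  proof (cases "trilinear_form scale \<beta>")
    case True
    then show ?thesis
      using ev_eq[OF t bil_locfin2(2)[OF True] S supp_locfin2(2)[OF True]]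
      by (simp add: * csum_cpure3[OF locfin2_rules(1)])
  qed (simp add: * csum_cpure3[OF locfin2_rules(1)] tprod_zero_form[OF ctensorD'[OF t]])
qed

end

section \<open>Quadratic perm algebras and dual bases\<close>

text \<open>Projecting a linear relation to the degree of one of its vectors leaves a relation
  inside a single \<open>E i\<close>.\<close>

lemma independent_gr_Union:
  assumes E: "\<And>i. E i \<subseteq> gr i" "\<And>i. independent (E i)"
  shows "independent (\<Union>i. E i)"
proof
  assume "dependent (\<Union>i. E i)"
  then obtain T u v where T: "finite T" "T \<subseteq> (\<Union>i. E i)" "(\<Sum>w\<in>T. scale (u w) w) = 0"
    and v: "v \<in> T" "u v \<noteq> 0" unfolding dependent_explicit by blast
  from v T obtain i where i: "v \<in> E i" by blast
  have "0 = hcomp i (\<Sum>w\<in>T. scale (u w) w)" by (simp add: T(3))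
  also have "\<dots> = (\<Sum>w\<in>T. hcomp i (scale (u w) w))" by (rule additive_sum) (rule hcomp_add)
  also have "\<dots> = (\<Sum>w\<in>T \<inter> E i. scale (u w) w)"
  proof -
    have out: "hcomp i (scale (u w) w) = 0" if w: "w \<in> T - T \<inter> E i" for w
    proof -
      from w obtain j where "w \<in> E j" using T(2) by blast
      moreover from this w have "j \<noteq> i" by auto
      ultimately have "hcomp i w = 0" using E(1)[of j] hcomp_hom[of w j i] by auto
      then show "hcomp i (scale (u w) w) = 0" by (simp add: hcomp_scale)
    qed
    have "hcomp i (scale (u w) w) = scale (u w) w" if "w \<in> T \<inter> E i" for w
      using that E(1)[of i] hcomp_hom[of w i i] by (auto simp: hcomp_scale)
    then show ?thesis
      using T(1) out by (intro sum.mono_neutral_cong_right) auto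
  qed
  finally have "(\<Sum>w\<in>T \<inter> E i. scale (u w) w) = 0" by simp
  then have "u v = 0"
    using E(2)[of i] T(1) v(1) i unfolding dependent_explicit by blast
  with v show False by simp
qed

lemma span_gr_Union:
  assumes "\<And>i. gr i \<subseteq> span (E i)"
  shows "span (\<Union>i. E i) = UNIV"
proof -
  have "hcomp i x \<in> span (\<Union>i. E i)" for i x
    using assms[of i] span_mono[of "E i" "\<Union>i. E i"] hcomp_in[of i x] by blast
  then have "(\<Sum>i | hcomp i x \<noteq> 0. hcomp i x) \<in> span (\<Union>i. E i)" for x by (intro span_sum)
  then show ?thesis by (auto simp: sum_hcomp)
qed

end

lemma (in graded_perm_algebra) circ_lin:
  "x \<odot> (y + y') = x \<odot> y + x \<odot> y'" "x \<odot> scale c y = scale c (x \<odot> y)"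
  "(x + x') \<odot> y = x \<odot> y + x' \<odot> y" "scale c x \<odot> y = scale c (x \<odot> y)"
  using circ_bilinear bilinear_map_iff[OF vector_space_axioms vector_space_axioms vector_space_axioms]
  by auto

context quadratic_graded_perm_algebra
begin

lemma form_bil: "bil \<omega>"
  using form_bilinear .

lemmas form_lin = form_bil[unfolded bil_iff]
lemmas form_diff = bil_diff[OF form_bil]

text \<open>By invariance and skewness \<open>\<omega> z (x \<odot> y)\<close> is the difference of
  \<open>\<omega> x (z \<odot> y)\<close> and \<open>\<omega> x (y \<odot> z)\<close>. This
  difference changes sign under exchange of \<open>y\<close> and \<open>z\<close>.\<close>

lemma form_alternate: "\<omega> z (x \<odot> y) = - \<omega> y (x \<odot> z)"
proof -
  have 1: "\<omega> x (y \<odot> z) - \<omega> x (z \<odot> y) + \<omega> z (x \<odot> y) = 0" for x y z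
    by (simp only: form_skew[of z "x \<odot> y"] form_invariant form_diff) simp
  have "\<omega> z (x \<odot> y) + \<omega> y (x \<odot> z) =
      (\<omega> x (y \<odot> z) - \<omega> x (z \<odot> y) + \<omega> z (x \<odot> y)) + (\<omega> x (z \<odot> y) - \<omega> x (y \<odot> z) + \<omega> y (x \<odot> z))"
    by simp
  then show ?thesis unfolding 1 by (simp add: eq_neg_iff_add_eq_0)
qed

lemma form_cyclic: "\<omega> x (y \<odot> z) - \<omega> x (z \<odot> y) = \<omega> y (x \<odot> z)"
  using form_invariant[of x y z] form_skew[of "x \<odot> y" z] form_alternate[of z x y]
  by (simp add: form_diff)

text \<open>Left multiplications are self-adjoint, whereas the adjoint of right multiplication in
  \<open>form_R\<close> is a difference of a left and a right multiplication. These two rules yield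
  the adjoints of all operators on \<open>A\<close>.\<close>

lemma form_L: "\<omega> b (c \<odot> x) = \<omega> (c \<odot> b) x"
  using form_alternate[of b c x] form_skew[of "c \<odot> b" x] by simp

lemma form_R: "\<omega> b (x \<odot> c) = \<omega> (c \<odot> b - b \<odot> c) x"
proof -
  have "\<omega> b (x \<odot> c) = \<omega> b (c \<odot> x) + \<omega> x (b \<odot> c)"
    using form_cyclic[of b x c] by (simp add: algebra_simps)
  then show ?thesis
    by (simp add: form_diff form_L[of b c x] form_skew[of x "b \<odot> c"])
qed

text \<open>
  The pairings \<open>\<omega> (xyz) w\<close> of four elements span a three-dimensional space, since
  \<open>\<omega> (xyz) w = G w - G z\<close> with \<open>G\<close> independent of the order. The equations below express them
  by the three pairings with \<open>a\<close> in the last place.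
\<close>

lemma form_four:
  shows "\<omega> (a \<odot> (b \<odot> c)) d = \<omega> (b \<odot> (d \<odot> c)) a - \<omega> (b \<odot> (c \<odot> d)) a"
    and "\<omega> (a \<odot> (b \<odot> d)) c = \<omega> (b \<odot> (c \<odot> d)) a - \<omega> (b \<odot> (d \<odot> c)) a"
    and "\<omega> (a \<odot> (c \<odot> b)) d = \<omega> (c \<odot> (d \<odot> b)) a - \<omega> (b \<odot> (c \<odot> d)) a"
    and "\<omega> (a \<odot> (d \<odot> b)) c = \<omega> (c \<odot> (d \<odot> b)) a - \<omega> (b \<odot> (d \<odot> c)) a"
    and "\<omega> (b \<odot> (a \<odot> c)) d = \<omega> (b \<odot> (d \<odot> c)) a - \<omega> (b \<odot> (c \<odot> d)) a"
    and "\<omega> (b \<odot> (a \<odot> d)) c = \<omega> (b \<odot> (c \<odot> d)) a - \<omega> (b \<odot> (d \<odot> c)) a"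
    and "\<omega> (b \<odot> (c \<odot> a)) d = - \<omega> (b \<odot> (c \<odot> d)) a"
    and "\<omega> (b \<odot> (d \<odot> a)) c = - \<omega> (b \<odot> (d \<odot> c)) a"
    and "\<omega> (c \<odot> (a \<odot> b)) d = \<omega> (c \<odot> (d \<odot> b)) a - \<omega> (b \<odot> (c \<odot> d)) a"
    and "\<omega> (c \<odot> (b \<odot> a)) d = - \<omega> (b \<odot> (c \<odot> d)) a"
    and "\<omega> (d \<odot> (a \<odot> b)) c = \<omega> (c \<odot> (d \<odot> b)) a - \<omega> (b \<odot> (d \<odot> c)) a"
    and "\<omega> (d \<odot> (b \<odot> a)) c = - \<omega> (b \<odot> (d \<odot> c)) a"
proof -
  \<comment> \<open>Three relations generate the list: antisymmetry in the last two of the four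
    arguments, symmetry in the first two, and a three-term relation, which is
    \<open>form_cyclic\<close> with a product as one argument.\<close>
  have 1: "\<omega> (x \<odot> (y \<odot> z)) w = - \<omega> (x \<odot> (y \<odot> w)) z" for x y z w
    using form_alternate[of z "x \<odot> y" w] form_skew[of "x \<odot> (y \<odot> z)" w]
      form_skew[of "x \<odot> (y \<odot> w)" z] by (simp add: circ_assoc)
  have 2: "x \<odot> (y \<odot> z) = y \<odot> (x \<odot> z)" for x y z
    by (metis circ_assoc circ_perm)
  have 3: "\<omega> (x \<odot> (y \<odot> z)) w = \<omega> (x \<odot> (z \<odot> y)) w + \<omega> (x \<odot> (w \<odot> z)) y" for x y z w
  proof -
    have a: "\<omega> (x \<odot> (y \<odot> z)) w = - \<omega> w ((x \<odot> y) \<odot> z)"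
      by (subst form_skew) (simp only: circ_assoc)
    have b: "\<omega> (x \<odot> (z \<odot> y)) w = - \<omega> w (z \<odot> (x \<odot> y))"
      by (subst form_skew) (simp only: 2[of z x y])
    have c: "\<omega> (x \<odot> (w \<odot> z)) y = - \<omega> (x \<odot> y) (w \<odot> z)"
      by (simp only: form_skew[of "x \<odot> (w \<odot> z)" y] form_L[of y x "w \<odot> z"])
    show ?thesis
      unfolding a b c form_cyclic[of w "x \<odot> y" z, symmetric] by simp
  qed
  show "\<omega> (a \<odot> (b \<odot> c)) d = \<omega> (b \<odot> (d \<odot> c)) a - \<omega> (b \<odot> (c \<odot> d)) a"
    using 2[of a b c] 3[of b a c d] 1[of b c a d] 2[of b c d] 2[of b d c] by simp
  show "\<omega> (a \<odot> (b \<odot> d)) c = \<omega> (b \<odot> (c \<odot> d)) a - \<omega> (b \<odot> (d \<odot> c)) a"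
    using 2[of a b d] 3[of b a d c] 1[of b d a c] 2[of b d c] 2[of b c d] by simp
  show "\<omega> (a \<odot> (c \<odot> b)) d = \<omega> (c \<odot> (d \<odot> b)) a - \<omega> (b \<odot> (c \<odot> d)) a"
    using 2[of a c b] 3[of c a b d] 1[of c b a d] 2[of c b d] 2[of c d b] by simp
  show "\<omega> (a \<odot> (d \<odot> b)) c = \<omega> (c \<odot> (d \<odot> b)) a - \<omega> (b \<odot> (d \<odot> c)) a"
    using 2[of a d b] 3[of d a b c] 1[of d b a c] 2[of d b c] 2[of d c b] by simp
  show "\<omega> (b \<odot> (a \<odot> c)) d = \<omega> (b \<odot> (d \<odot> c)) a - \<omega> (b \<odot> (c \<odot> d)) a"
    using 2[of b a c] 3[of b a c d] 1[of b c a d] 2[of b c d] 2[of b d c] by simp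
  show "\<omega> (b \<odot> (a \<odot> d)) c = \<omega> (b \<odot> (c \<odot> d)) a - \<omega> (b \<odot> (d \<odot> c)) a"
    using 2[of b a d] 3[of b a d c] 1[of b d a c] 2[of b d c] 2[of b c d] by simp
  show "\<omega> (b \<odot> (c \<odot> a)) d = - \<omega> (b \<odot> (c \<odot> d)) a"
    using 1[of b c a d] 2[of b c d] by simp
  show "\<omega> (b \<odot> (d \<odot> a)) c = - \<omega> (b \<odot> (d \<odot> c)) a"
    using 1[of b d a c] 2[of b d c] by simp
  show "\<omega> (c \<odot> (a \<odot> b)) d = \<omega> (c \<odot> (d \<odot> b)) a - \<omega> (b \<odot> (c \<odot> d)) a"
    using 2[of c a b] 3[of c a b d] 1[of c b a d] 2[of c b d] 2[of c d b] by simp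
  show "\<omega> (c \<odot> (b \<odot> a)) d = - \<omega> (b \<odot> (c \<odot> d)) a"
    using 1[of c b a d] 2[of c b d] by simp
  show "\<omega> (d \<odot> (a \<odot> b)) c = \<omega> (c \<odot> (d \<odot> b)) a - \<omega> (b \<odot> (d \<odot> c)) a"
    using 2[of d a b] 3[of d a b c] 1[of d b a c] 2[of d b c] 2[of d c b] by simp
  show "\<omega> (d \<odot> (b \<odot> a)) c = - \<omega> (b \<odot> (d \<odot> c)) a"
    using 1[of d b a c] 2[of d b c] by simp
qed

text \<open>Gram-Schmidt for a pairing between two different spaces: degree \<open>i\<close> is
  paired with degree \<open>- m - i\<close>.\<close>

lemma dual_family:
  assumes "finite T" "independent T" "T \<subseteq> gr i"
    and m: "\<And>i j x y. i + j + m \<noteq> 0 \<Longrightarrow> x \<in> gr i \<Longrightarrow> y \<in> gr j \<Longrightarrow> \<omega> x y = 0"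
  shows "\<exists>g. (\<forall>t\<in>T. g t \<in> gr (- m - i)) \<and> (\<forall>s\<in>T. \<forall>t\<in>T. \<omega> (g s) t = (if s = t then 1 else 0))"
  using assms(1-3)
proof (induction T rule: finite_induct)
  case (insert v T)
  then obtain g where g: "\<And>t. t \<in> T \<Longrightarrow> g t \<in> gr (- m - i)"
    "\<And>s t. s \<in> T \<Longrightarrow> t \<in> T \<Longrightarrow> \<omega> (g s) t = (if s = t then 1 else 0)"
  proof -
    have "independent T" "T \<subseteq> gr i"
      using independent_mono[OF insert.prems(1)] insert.prems(2) by auto
    from insert.IH[OF this] show thesis using that by blast
  qed
  \<comment> \<open>The part of \<open>v\<close> that the dual vectors found so far do not see; it
    is nonzero because \<open>v\<close> lies outside the span of \<open>T\<close>.\<close>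
  define v' where "v' = v - (\<Sum>t\<in>T. scale (\<omega> (g t) v) t)"
  have "v \<notin> span T" using insert by (auto simp: independent_insert)
  then have "v' \<noteq> 0"
    using span_sum[of T "\<lambda>t. scale (\<omega> (g t) v) t" T] span_scale[OF span_base, of _ T]
    by (auto simp: v'_def)
  then obtain y where "\<omega> v' y \<noteq> 0" using form_nondegenerate by blast
  then have y: "\<omega> y v' \<noteq> 0" using form_skew[of v' y] by auto
  have v'gr: "v' \<in> gr i" unfolding v'_def using insert gr_subspace[of i]
    by (intro subspace_diff subspace_sum subspace_scale) auto
  \<comment> \<open>Nondegeneracy provides an inhomogeneous \<open>y\<close>. Only its component of
    degree \<open>- m - i\<close> can pair with \<open>v'\<close>.\<close>
  define z where "z = hcomp (- m - i) y"
  have "\<omega> y v' = \<omega> (\<Sum>j | hcomp j y \<noteq> 0. hcomp j y) v'" by (simp add: sum_hcomp)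
  also have "\<dots> = (\<Sum>j | hcomp j y \<noteq> 0. if j = - m - i then \<omega> z v' else 0)"
    unfolding form_diff using m[OF _ hcomp_in v'gr] by (intro sum.cong) (auto simp: z_def)
  finally have z: "\<omega> z v' \<noteq> 0" using y finite_hcomp[of y] by (auto simp: sum.delta split: if_splits)
  \<comment> \<open>The correction makes \<open>h0\<close> vanish on \<open>T\<close>. Its value at
    \<open>v\<close> is still \<open>\<omega> z v'\<close>, because the corrections of
    \<open>z\<close> and of \<open>v\<close> are transposes of each other.\<close>
  define h0 where "h0 = z - (\<Sum>t\<in>T. scale (\<omega> z t) (g t))"
  have h0T: "\<omega> h0 t = 0" if "t \<in> T" for t
  proof -
    have "(\<Sum>s\<in>T. \<omega> z s * \<omega> (g s) t) = (\<Sum>s\<in>T. if s = t then \<omega> z s else 0)"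
      using g(2) that by (intro sum.cong) auto
    then show ?thesis using insert(1) that by (simp add: h0_def form_diff form_lin)
  qed
  have h0v: "\<omega> h0 v = \<omega> z v'"
    by (simp add: h0_def v'_def form_diff form_lin mult.commute)
  define h where "h = scale (1 / \<omega> z v') h0"
  have hT: "\<omega> h t = 0" if "t \<in> T" for t using h0T[OF that] by (simp add: h_def form_lin)
  have hv: "\<omega> h v = 1" using h0v z by (simp add: h_def form_lin)
  have h0gr: "h0 \<in> gr (- m - i)" unfolding h0_def z_def using gr_subspace[of "- m - i"] g(1)
    by (intro subspace_diff subspace_sum subspace_scale) auto
  have hgr: "h \<in> gr (- m - i)" unfolding h_def by (intro gr_scale h0gr)
  show ?case
  \<comment> \<open>The dual vectors of \<open>T\<close> need not vanish on \<open>v\<close> and are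
    corrected by a multiple of \<open>h\<close>.\<close>
  proof (intro exI[of _ "\<lambda>t. if t = v then h else g t - scale (\<omega> (g t) v) h"] conjI ballI)
    fix t assume "t \<in> insert v T"
    then show "(if t = v then h else g t - scale (\<omega> (g t) v) h) \<in> gr (- m - i)"
      using hgr g(1) gr_subspace by (auto intro: subspace_diff subspace_scale)
  next
    fix s t assume "s \<in> insert v T" "t \<in> insert v T"
    then show "\<omega> (if s = v then h else g s - scale (\<omega> (g s) v) h) t = (if s = t then 1 else 0)"
      using g(2) hT hv insert(2) by (auto simp: form_diff form_lin)
  qed
qed auto

text \<open>Bases of the degree pieces can be dualised separately: the dual vectors of degree
  \<open>i\<close> lie in degree \<open>- m - i\<close>, which is orthogonal to every degree other
  than \<open>i\<close>.\<close>

lemma homogeneous_dual_bases_exist: "\<exists>(\<Omega> :: 'b set) e f. homogeneous_dual_bases \<Omega> e f"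
proof -
  obtain m where m: "\<And>i j x y. i + j + m \<noteq> 0 \<Longrightarrow> x \<in> gr i \<Longrightarrow> y \<in> gr j \<Longrightarrow> \<omega> x y = 0"
    using form_graded by blast
  have "\<exists>E. E \<subseteq> gr i \<and> independent E \<and> gr i \<subseteq> span E \<and> finite E" for i
  proof -
    obtain E where E: "E \<subseteq> gr i" "independent E" "gr i \<subseteq> span E"
      using maximal_independent_subset[of "gr i"] by blast
    obtain S where "finite S" "gr i = span S" using gr_finite_dim by blast
    then show ?thesis using E independent_span_bound[of S E] by auto
  qed
  then obtain E where E: "\<And>i. E i \<subseteq> gr i" "\<And>i. independent (E i)" "\<And>i. gr i \<subseteq> span (E i)"
    "\<And>i. finite (E i)" by metis
  have "\<exists>g. (\<forall>t\<in>E i. g t \<in> gr (- m - i)) \<and> (\<forall>s\<in>E i. \<forall>t\<in>E i. \<omega> (g s) t = (if s = t then 1 else 0))" for i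
    using dual_family[OF E(4,2,1) m] .
  then obtain g where g: "\<And>i t. t \<in> E i \<Longrightarrow> g i t \<in> gr (- m - i)"
    "\<And>i s t. s \<in> E i \<Longrightarrow> t \<in> E i \<Longrightarrow> \<omega> (g i s) t = (if s = t then 1 else 0)" by metis
  \<comment> \<open>The basis is indexed by its own vectors, so the degree of \<open>t\<close> has
    to be chosen; only the property \<open>ex\<close> of this choice is used.\<close>
  define f where "f t = g (SOME i. t \<in> E i) t" for t
  have ex: "\<exists>i. t \<in> E i \<and> f t = g i t" if "t \<in> (\<Union>i. E i)" for t
    using that someI[of "\<lambda>i. t \<in> E i"] unfolding f_def by blast
  have "homogeneous_dual_bases (\<Union>i. E i) id f"
    unfolding homogeneous_dual_bases_def
  proof (intro conjI ballI)
    show "independent (id ` (\<Union>i. E i))" using independent_gr_Union[OF E(1,2)] by simp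
    show "span (id ` (\<Union>i. E i)) = UNIV" using span_gr_Union[OF E(3)] by simp
    show "\<exists>i. id j \<in> gr i" "\<exists>i. f j \<in> gr i" if "j \<in> (\<Union>i. E i)" for j
      using ex[OF that] g(1) E(1) by fastforce+
    show "\<omega> (f s) (id t) = (if s = t then 1 else 0)" if s: "s \<in> (\<Union>i. E i)" and t: "t \<in> (\<Union>i. E i)" for s t
    proof -
      obtain i j where i: "s \<in> E i" "f s = g i s" and j: "t \<in> E j" using ex[OF s] t by auto
      show ?thesis
      proof (cases "t \<in> E i")
        case True
        then show ?thesis using g(2) i by simp
      next
        case False
        then have "i \<noteq> j" using j by auto
        then have "\<omega> (g i s) t = 0" using g(1)[OF i(1)] E(1) j by (intro m) auto
        then show ?thesis using False i by auto
      qed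
    qed
  qed simp
  then show ?thesis by blast
qed

end

text \<open>The degree shift \<open>m\<close>, whose mere existence is an axiom of the quadratic
  algebra, becomes a parameter so that degrees can be computed with it. The index type is free
  because the theorem quantifies over arbitrary dual bases.\<close>

locale quadratic_dual_bases = quadratic_graded_perm_algebra scale gr circ \<omega>
  for scale :: "'k::field \<Rightarrow> 'b::ab_group_add \<Rightarrow> 'b" and gr :: "int \<Rightarrow> 'b set"
    and circ :: "'b \<Rightarrow> 'b \<Rightarrow> 'b" (infixl "\<odot>" 70) and \<omega> :: "'b \<Rightarrow> 'b \<Rightarrow> 'k" +
  fixes m :: int and \<Omega> :: "'j set" and e f :: "'j \<Rightarrow> 'b"
  assumes form_degree: "i + j + m \<noteq> 0 \<Longrightarrow> x \<in> gr i \<Longrightarrow> y \<in> gr j \<Longrightarrow> \<omega> x y = 0"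
    and dual_bases: "homogeneous_dual_bases \<Omega> e f"
begin

definition idx :: "int \<Rightarrow> 'j set" where
  "idx i = {j \<in> \<Omega>. e j \<in> gr i}"

lemma dual: "i \<in> \<Omega> \<Longrightarrow> j \<in> \<Omega> \<Longrightarrow> \<omega> (f i) (e j) = (if i = j then 1 else 0)"
  using dual_bases by (simp add: homogeneous_dual_bases_def)

lemma e_nonzero: "j \<in> \<Omega> \<Longrightarrow> e j \<noteq> 0"
  using dual[of j j] form_diff(4) by force

lemma e_deg_unique: "j \<in> idx i \<Longrightarrow> j \<in> idx k \<Longrightarrow> i = k"
  using hcomp_hom[of "e j" i i] hcomp_hom[of "e j" k i] e_nonzero[of j]
  by (auto simp: idx_def split: if_splits)

lemma idx_ex: "j \<in> \<Omega> \<Longrightarrow> \<exists>i. j \<in> idx i"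
  using dual_bases by (auto simp: homogeneous_dual_bases_def idx_def)

lemma f_deg: "j \<in> idx i \<Longrightarrow> f j \<in> gr (- m - i)"
proof -
  assume j: "j \<in> idx i"
  then have j': "j \<in> \<Omega>" "e j \<in> gr i" by (auto simp: idx_def)
  then obtain k where k: "f j \<in> gr k" using dual_bases by (auto simp: homogeneous_dual_bases_def)
  have "k + i + m = 0" using form_degree[OF _ k j'(2)] dual[OF j'(1) j'(1)] by auto
  then have "k = - m - i" by simp
  then show ?thesis using k by simp
qed

lemma finite_idx: "finite (idx i)"
proof -
  obtain S where S: "finite S" "gr i = span S" using gr_finite_dim by blast
  have "independent (e ` idx i)"
    using dual_bases independent_mono[of "e ` \<Omega>" "e ` idx i"]
    by (auto simp: homogeneous_dual_bases_def idx_def)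
  moreover have "e ` idx i \<subseteq> span S" using S by (auto simp: idx_def)
  ultimately have "finite (e ` idx i)" using independent_span_bound[OF S(1)] by blast
  moreover have "inj_on e (idx i)"
    using dual_bases by (auto simp: homogeneous_dual_bases_def idx_def inj_on_def)
  ultimately show ?thesis by (rule finite_imageD)
qed

lemma hcomp_expand: "hcomp i x = (\<Sum>u\<in>idx i. scale (\<omega> (f u) x) (e u))"
proof -
  have "x \<in> span (e ` \<Omega>)" using dual_bases by (simp add: homogeneous_dual_bases_def)
  then show ?thesis
  proof (induction rule: span_induct_alt)
    case base
    then show ?case by (simp add: form_diff)
  next
    case (step c y z)
    then obtain w where w: "w \<in> \<Omega>" "y = e w" by auto
    then obtain k where k: "w \<in> idx k" using idx_ex by blast
    have "(\<Sum>u\<in>idx i. scale (\<omega> (f u) y) (e u)) = (\<Sum>u\<in>idx i. if u = w then e u else 0)"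
      using w by (intro sum.cong) (auto simp: dual idx_def)
    also have "\<dots> = (if w \<in> idx i then e w else 0)" using finite_idx by (simp add: sum.delta)
    also have "\<dots> = hcomp i y"
      using hcomp_hom[of y k i] w k e_deg_unique[OF k, of i] by (auto simp: idx_def)
    finally have y: "(\<Sum>u\<in>idx i. scale (\<omega> (f u) y) (e u)) = hcomp i y" .
    have "(\<Sum>u\<in>idx i. scale (\<omega> (f u) (scale c y + z)) (e u)) =
        scale c (\<Sum>u\<in>idx i. scale (\<omega> (f u) y) (e u)) + (\<Sum>u\<in>idx i. scale (\<omega> (f u) z) (e u))"
      by (simp add: form_lin scale_left_distrib sum.distrib scale_sum_right)
    then show ?case using step.IH by (simp add: y hcomp_add hcomp_scale)
  qed
qed

text \<open>Since only degrees adding up to \<open>- m\<close> pair nontrivially, both sides reduce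
  to the pairing of the same two homogeneous components.\<close>

lemma hcomp_form: "\<omega> x (hcomp i y) = \<omega> (hcomp (- m - i) x) y"
proof -
  have *: "\<omega> (hcomp k x) (hcomp i y) = 0" if "k + i + m \<noteq> 0" for k i
    using that by (rule form_degree) auto
  have "\<omega> x (hcomp i y) = \<omega> (\<Sum>k | hcomp k x \<noteq> 0. hcomp k x) (hcomp i y)" by (simp add: sum_hcomp)
  also have "\<dots> = (\<Sum>k | hcomp k x \<noteq> 0. \<omega> (hcomp k x) (hcomp i y))" by (simp add: form_diff)
  also have "\<dots> = (\<Sum>k | hcomp k x \<noteq> 0. if k = - m - i then \<omega> (hcomp (- m - i) x) (hcomp i y) else 0)"
    using * by (intro sum.cong) auto
  also have "\<dots> = \<omega> (hcomp (- m - i) x) (hcomp i y)"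
    using finite_hcomp[of x] by (auto simp: sum.delta form_diff)
  also have "\<dots> = (\<Sum>k | hcomp k y \<noteq> 0. if k = i then \<omega> (hcomp (- m - i) x) (hcomp i y) else 0)"
    using finite_hcomp[of y] by (auto simp: sum.delta form_diff)
  also have "\<dots> = (\<Sum>k | hcomp k y \<noteq> 0. \<omega> (hcomp (- m - i) x) (hcomp k y))"
    using *[of "- m - i"] by (intro sum.cong) auto
  also have "\<dots> = \<omega> (hcomp (- m - i) x) (\<Sum>k | hcomp k y \<noteq> 0. hcomp k y)" by (simp add: form_diff)
  finally show ?thesis by (simp add: sum_hcomp)
qed

section \<open>The graded space \<open>P \<otimes> B\<close>\<close>

definition casimir :: "('b, 'k) ctensor2" where
  "casimir = (\<lambda>(i, k). if i + k + m = 0 then \<Sum>u\<in>idx i. pure2 (e u) (f u) else 0)"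

lemma casimir_in: "casimir \<in> ctensor"
proof -
  have "(\<Sum>u\<in>idx i. pure2 (e u) (f u)) \<in> tprod (gr i) (gr k)" if "i + k + m = 0" for i k
  proof -
    have "k = - m - i" using that by simp
    then show ?thesis using f_deg by (auto simp: idx_def intro!: tprod_sum tprod_pure2)
  qed
  then show ?thesis by (auto simp: casimir_def ctensor_def tprod_zero)
qed

lemma adm_form: "adm (\<lambda>x y. \<omega> x b * \<omega> y b')"
proof -
  have "supp (\<lambda>x y. \<omega> x b * \<omega> y b') ({i. hcomp (- m - i) b \<noteq> 0} \<times> {i. hcomp (- m - i) b' \<noteq> 0})"
    (is "supp _ ?S")
    unfolding supp_def
  proof (intro allI impI ballI)
    fix i j x y
    assume ij: "(i, j) \<notin> ?S" and x: "x \<in> gr i" and y: "y \<in> gr j"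
    have "\<omega> x b = \<omega> x (hcomp (- m - i) b)" "\<omega> y b' = \<omega> y (hcomp (- m - j) b')"
      using hcomp_form[of x "- m - i" b] hcomp_form[of y "- m - j" b'] x y
      by (simp_all add: hcomp_hom)
    then show "\<omega> x b * \<omega> y b' = 0" using ij by (auto simp: form_diff)
  qed
  moreover have "finite {i. hcomp (- m - i) b \<noteq> 0}" for b
    using finite_vimageI[OF finite_hcomp[of b], of "\<lambda>i. - m - i"] by (simp add: vimage_def inj_def)
  moreover have "bil (\<lambda>x y. \<omega> x b * \<omega> y b')"
    by (auto simp: bil_iff form_lin algebra_simps)
  ultimately show ?thesis unfolding adm_def by (intro conjI exI[of _ ?S]) simp_all
qed

text \<open>The values \<open>\<omega> (f u) b'\<close> are the coordinates of \<open>b'\<close> in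
  the basis \<open>e\<close>. Summing the first legs with these coefficients rebuilds
  \<open>b'\<close>, hence the exchanged order of \<open>b\<close> and \<open>b'\<close>.\<close>

lemma ev_casimir: "ev casimir (\<lambda>x y. \<omega> x b * \<omega> y b') = \<omega> b' b"
proof -
  let ?\<beta> = "\<lambda>x y. \<omega> x b * \<omega> y b'"
  let ?S = "{i. hcomp (- m - i) b \<noteq> 0}"
  have b: "bil ?\<beta>" by (rule adm_bil[OF adm_form])
  have cas: "casimir (i, - m - i) ?\<beta> = \<omega> (hcomp i b') b" for i
    by (simp add: casimir_def sum_pure2_apply[OF b] hcomp_expand form_diff form_lin
        mult.commute)
  have fin: "finite ?S"
    using finite_vimageI[OF finite_hcomp[of b], of "\<lambda>i. - m - i"] by (simp add: vimage_def inj_def)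
  have flip: "\<omega> (hcomp i b') b = \<omega> b' (hcomp (- m - i) b)" for i
    using hcomp_form[of b' "- m - i" b] by simp
  have "ev casimir ?\<beta> = (\<Sum>ij\<in>(\<lambda>i. (i, - m - i)) ` ?S. casimir ij ?\<beta>)"
    unfolding ev_def
  proof (rule sum.mono_neutral_left)
    show "{ij. casimir ij ?\<beta> \<noteq> 0} \<subseteq> (\<lambda>i. (i, - m - i)) ` ?S"
    proof
      fix ij assume ij: "ij \<in> {ij. casimir ij ?\<beta> \<noteq> 0}"
      obtain i k where ik: "ij = (i, k)" by (cases ij)
      have "k = - m - i" using ij ik by (auto simp: casimir_def split: if_splits)
      then show "ij \<in> (\<lambda>i. (i, - m - i)) ` ?S"
        using ij ik cas[of i] flip[of i] form_diff(4) by force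
    qed
  qed (use fin in auto)
  also have "\<dots> = (\<Sum>i\<in>?S. \<omega> b' (hcomp (- m - i) b))"
    by (subst sum.reindex) (auto simp: inj_on_def cas flip)
  also have "\<dots> = \<omega> b' (\<Sum>i\<in>?S. hcomp (- m - i) b)" by (simp add: form_diff)
  also have "(\<Sum>i\<in>?S. hcomp (- m - i) b) = (\<Sum>i | hcomp i b \<noteq> 0. hcomp i b)"
    by (rule sum.reindex_bij_witness[of _ "\<lambda>i. - m - i" "\<lambda>i. - m - i"]) auto
  finally show ?thesis by (simp add: sum_hcomp)
qed

lemma form_hat_eq_ev: "form_hat t b b' = ev t (\<lambda>x y. \<omega> x b * \<omega> y b')"
  by (simp add: form_hat_def ev_def)

text \<open>On one component every bilinear form is a finite combination of the products
  \<open>\<omega> x (f u) * \<omega> y (f v)\<close>, by expansion in the dual bases. This gives the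
  uniqueness required by the definition of \<open>nu_form\<close>.\<close>

lemma form_hat_inject:
  assumes t: "t \<in> ctensor" and s: "s \<in> ctensor" and eq: "\<And>b b'. form_hat t b b' = form_hat s b b'"
  shows "t = s"
proof
  fix ij :: "int \<times> int"
  obtain i j where ij: "ij = (i, j)" by (cases ij)
  have expand: "t (i, j) \<beta> = (\<Sum>u\<in>idx i. \<Sum>v\<in>idx j. \<beta> (e u) (e v) * form_hat t (f u) (f v))"
    if t: "t \<in> ctensor" and \<beta>: "bil \<beta>" for t \<beta>
  proof -
    have "(\<lambda>x y. \<beta> (hcomp i x) (hcomp j y)) =
        (\<lambda>x y. \<Sum>u\<in>idx i. \<Sum>v\<in>idx j. \<beta> (e u) (e v) * (\<omega> x (f u) * \<omega> y (f v)))"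
    proof (intro ext)
      fix x y
      \<comment> \<open>Coordinates have \<open>f u\<close> on the left of \<open>\<omega>\<close>,
        whereas \<open>form_hat\<close> has it on the right; the two signs cancel.\<close>
      have skew: "\<omega> (f u) x * \<omega> (f v) y = \<omega> x (f u) * \<omega> y (f v)" for u v
        using form_skew[of "f u" x] form_skew[of "f v" y] by simp
      have "\<beta> (hcomp i x) (hcomp j y) = (\<Sum>u\<in>idx i. \<Sum>v\<in>idx j.
          \<beta> (scale (\<omega> (f u) x) (e u)) (scale (\<omega> (f v) y) (e v)))"
        by (simp only: hcomp_expand bil_diff(7)[OF \<beta>], simp only: bil_diff(8)[OF \<beta>])
      also have "\<dots> = (\<Sum>u\<in>idx i. \<Sum>v\<in>idx j. \<beta> (e u) (e v) * (\<omega> (f u) x * \<omega> (f v) y))"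
        using \<beta> by (simp add: bil_iff mult_ac)
      finally show "\<beta> (hcomp i x) (hcomp j y) =
          (\<Sum>u\<in>idx i. \<Sum>v\<in>idx j. \<beta> (e u) (e v) * (\<omega> x (f u) * \<omega> y (f v)))"
        by (simp only: skew)
    qed
    then show ?thesis
      using component_eq_ev[OF t \<beta>, of i j] t
      by (simp add: ev_sum_form adm_sum adm_scale adm_form ev_scale_form form_hat_eq_ev)
  qed
  show "t ij = s ij"
    by (rule tprod_eqI[OF ctensorD'[OF t] ctensorD'[OF s]]) (simp add: ij expand t s eq)
qed

text \<open>The witness for the definite description is the Casimir element with right
  multiplication by \<open>b\<close> applied to its second leg.\<close>

lemma nu_form: "nu_form b \<in> ctensor"
  and form_hat_nu_form: "form_hat (nu_form b) b2 b3 = - \<omega> b (b2 \<odot> b3)"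
proof -
  have R: "locfin (\<lambda>x. x \<odot> b)"
    using locfin_graded_op[OF circ_bilinear circ_graded] by auto
  let ?n = "cmap2 id (\<lambda>x. x \<odot> b) casimir"
  have n: "?n \<in> ctensor" by (rule cmap2_in[OF locfin_id R casimir_in])
  have hat: "form_hat ?n b2 b3 = - \<omega> b (b2 \<odot> b3)" for b2 b3
  proof -
    have "\<omega> (y \<odot> b) b3 = \<omega> y (b \<odot> b3 - b3 \<odot> b)" for y
      by (rule form_invariant)
    then have "form_hat ?n b2 b3 = \<omega> (b \<odot> b3 - b3 \<odot> b) b2"
      using ev_cmap2[OF locfin_id R casimir_in adm_form[of b2 b3]] ev_casimir[of b2 "b \<odot> b3 - b3 \<odot> b"]
      by (simp add: form_hat_eq_ev)
    then show ?thesis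
      using form_R[of b3 b2 b] form_alternate[of b3 b2 b] by simp
  qed
  have "\<exists>!t. t \<in> ctensor \<and> (\<forall>b2 b3. form_hat t b2 b3 = - \<omega> b (b2 \<odot> b3))"
  proof (rule ex1I[of _ ?n])
    fix t assume "t \<in> ctensor \<and> (\<forall>b2 b3. form_hat t b2 b3 = - \<omega> b (b2 \<odot> b3))"
    then have "t \<in> ctensor" "\<And>b2 b3. form_hat t b2 b3 = form_hat ?n b2 b3"
      using hat by auto
    then show "t = ?n" by (rule form_hat_inject[OF _ n])
  qed (use n hat in blast)
  from theI'[OF this, folded nu_form_def]
  show "nu_form b \<in> ctensor" "form_hat (nu_form b) b2 b3 = - \<omega> b (b2 \<odot> b3)" by auto
qed

end

section \<open>The tensor product of P and B and its contractions with elements of B\<close>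

locale affinization =
  P: poisson_algebra sP mul brk + B: quadratic_dual_bases sB grB circB \<omega> m \<Omega> e f
  for sP :: "'k::field \<Rightarrow> 'p::ab_group_add \<Rightarrow> 'p"
    and mul :: "'p \<Rightarrow> 'p \<Rightarrow> 'p" (infixl "\<cdot>" 70)
    and brk :: "'p \<Rightarrow> 'p \<Rightarrow> 'p"
    and sB :: "'k \<Rightarrow> 'b::ab_group_add \<Rightarrow> 'b" and grB :: "int \<Rightarrow> 'b set"
    and circB :: "'b \<Rightarrow> 'b \<Rightarrow> 'b" (infixl "\<odot>" 70) and \<omega> :: "'b \<Rightarrow> 'b \<Rightarrow> 'k"
    and m :: int and \<Omega> :: "'j set" and e f :: "'j \<Rightarrow> 'b" +
  fixes sA :: "'k \<Rightarrow> 'a::ab_group_add \<Rightarrow> 'a" and tens :: "'p \<Rightarrow> 'b \<Rightarrow> 'a" and grA :: "int \<Rightarrow> 'a set"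
  assumes tens: "tensor_product sP sB sA tens"
    and grA: "grA = tensor_grading sA tens grB"
    and finite_dim: "\<exists>basis. finite_dimensional_vector_space sP basis"
begin

lemma bilinear_tens: "bilinear_map sP sB sA tens"
  using tens by (simp add: tensor_product_def)

lemma vector_space_A: "vector_space sA"
  using bilinear_tens by (auto simp: bilinear_map_def Vector_Spaces.linear_iff)

sublocale A: vector_space sA
  by (rule vector_space_A)

lemma tens_lin:
  "tens p (b + b') = tens p b + tens p b'" "tens p (sB c b) = sA c (tens p b)"
  "tens (p + p') b = tens p b + tens p' b" "tens (sP c p) b = sA c (tens p b)"
  using bilinear_tens
    bilinear_map_iff[OF P.vector_space_axioms B.vector_space_axioms vector_space_A, of tens]
  by auto

lemma tens_diff:
  "tens p 0 = 0" "tens 0 b = 0"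
  "tens p (b - b') = tens p b - tens p b'" "tens (p - p') b = tens p b - tens p' b"
  "tens (- p) b = - tens p b" "tens p (- b) = - tens p b"
  "tens p (\<Sum>i\<in>I. g i) = (\<Sum>i\<in>I. tens p (g i))"
  by (rule additive_zero[of "tens p"] additive_zero[of "\<lambda>p. tens p b"] additive_diff[of "tens p"]
      additive_diff[of "\<lambda>p. tens p b"] additive_minus[of "tens p"] additive_minus[of "\<lambda>p. tens p b"]
      additive_sum[of "tens p"]; simp add: tens_lin)+

text \<open>Scalars are absorbed by the factor in \<open>P\<close>, so closure under addition is the
  only inductive step.\<close>

lemma tens_induct [case_names tens add]:
  assumes "\<And>p b. Q (tens p b)" "\<And>x y. Q x \<Longrightarrow> Q y \<Longrightarrow> Q (x + y)"
  shows "Q x"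
proof -
  have "x \<in> A.span {tens p b | p b. True}"
    using tens by (simp add: tensor_product_def)
  then show ?thesis
  proof (induction rule: A.span_induct_alt)
    case base
    show ?case using assms(1)[of 0 0] by (simp add: tens_diff)
  next
    case (step c x y)
    then show ?case using assms(1) assms(2) by (auto simp: tens_lin(4)[symmetric])
  qed
qed

lemma tens_extend:
  assumes "bilinear_map sP sB sX g"
  obtains h where "\<And>x y. h (x + y) = h x + h y" "\<And>c x. h (sA c x) = sX c (h x)"
    "\<And>p b. h (tens p b) = g p b"
proof -
  obtain h where h: "Vector_Spaces.linear sA sX h" "\<forall>p b. h (tens p b) = g p b"
    using tensor_product_universal[OF tens assms] by blast
  then show ?thesis using that[of h] by (auto simp: Vector_Spaces.linear_iff)
qed

lemma ex_proj: "\<exists>h. (\<forall>x y. h (x + y) = h x + h y) \<and> (\<forall>p b. h (tens p b) = tens p (B.hcomp i b))"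
proof -
  have "bilinear_map sP sB sA (\<lambda>p b. tens p (B.hcomp i b))"
    unfolding bilinear_map_iff[OF P.vector_space_axioms B.vector_space_axioms vector_space_A]
    by (auto simp: B.hcomp_add B.hcomp_scale tens_lin)
  then show ?thesis by (rule tens_extend) blast
qed

lemma tens_in: "b \<in> grB i \<Longrightarrow> tens p b \<in> grA i"
  unfolding grA tensor_grading_def by (rule A.span_base) blast

lemma grA_subspace: "A.subspace (grA i)"
  unfolding grA tensor_grading_def by (rule A.subspace_span)

lemma grA_induct [consumes 1, case_names tens add]:
  assumes "x \<in> grA i" "\<And>p b. b \<in> grB i \<Longrightarrow> Q (tens p b)" "\<And>x y. Q x \<Longrightarrow> Q y \<Longrightarrow> Q (x + y)"
  shows "Q x"
  using assms(1) unfolding grA tensor_grading_def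
proof (induction rule: A.span_induct_alt)
  case base
  show ?case using assms(2)[of 0 0] by (simp add: tens_diff)
next
  case (step c x y)
  then show ?case using assms(2,3) by (auto simp: tens_lin(4)[symmetric])
qed

text \<open>Finite dimension of \<open>P\<close> enters here: a basis of \<open>P\<close> and a
  finite spanning set of \<open>grB i\<close> together give finitely many pure tensors spanning
  \<open>grA i\<close>.\<close>

lemma grA_finite_dim: "\<exists>S. finite S \<and> grA i = A.span S"
proof -
  obtain basis where "finite_dimensional_vector_space sP basis" using finite_dim ..
  then interpret fP: finite_dimensional_vector_space sP basis .
  obtain S where S: "finite S" "grB i = B.span S" using B.gr_finite_dim by blast
  let ?T = "(\<lambda>(p, b). tens p b) ` (basis \<times> S)"
  have "tens p b \<in> A.span ?T" if b: "b \<in> B.span S" for p b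
  proof -
    have "p \<in> P.span basis" using fP.span_Basis by simp
    then show ?thesis
    proof (induction rule: P.span_induct_alt)
      case base
      show ?case by (simp add: tens_diff A.span_zero)
    next
      case (step c x y)
      have "tens x b \<in> A.span ?T" using b
      proof (induction rule: B.span_induct_alt)
        case base
        show ?case by (simp add: tens_diff A.span_zero)
      next
        case (step c' b' b'')
        have "tens x b' \<in> A.span ?T" using step(1) \<open>x \<in> basis\<close> by (intro A.span_base) auto
        then show ?case using step by (auto simp: tens_lin intro: A.span_add A.span_scale)
      qed
      then show ?case using step by (auto simp: tens_lin intro: A.span_add A.span_scale)
    qed
  qed
  then have "{tens p b | p b. b \<in> grB i} \<subseteq> A.span ?T" using S(2) by auto
  then have "grA i \<subseteq> A.span ?T"
    unfolding grA tensor_grading_def by (rule A.span_minimal) (rule A.subspace_span)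
  moreover have "A.span ?T \<subseteq> grA i"
    using tens_in S(2) B.span_base by (intro A.span_minimal grA_subspace) auto
  ultimately show ?thesis using S(1) fP.finite_Basis by (intro exI[of _ ?T]) auto
qed

definition proj :: "int \<Rightarrow> 'a \<Rightarrow> 'a" where
  "proj i = (SOME h. (\<forall>x y. h (x + y) = h x + h y) \<and> (\<forall>p b. h (tens p b) = tens p (B.hcomp i b)))"

lemma proj_add: "proj i (x + y) = proj i x + proj i y"
  and proj_tens: "proj i (tens p b) = tens p (B.hcomp i b)"
  using someI_ex[OF ex_proj[of i]] unfolding proj_def by auto

lemma proj_sum: "\<exists>S. finite S \<and> (\<forall>i. i \<notin> S \<longrightarrow> proj i x = 0) \<and> x = (\<Sum>i\<in>S. proj i x)"
proof (induction x rule: tens_induct)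
  case (tens p b)
  show ?case
    using B.finite_hcomp[of b]
    by (intro exI[of _ "{i. B.hcomp i b \<noteq> 0}"])
      (auto simp: proj_tens tens_diff B.sum_hcomp simp flip: tens_diff(7))
next
  case (add x y)
  then obtain S T where S: "finite S" "\<forall>i. i \<notin> S \<longrightarrow> proj i x = 0" "x = (\<Sum>i\<in>S. proj i x)"
    and T: "finite T" "\<forall>i. i \<notin> T \<longrightarrow> proj i y = 0" "y = (\<Sum>i\<in>T. proj i y)" by blast
  have "(\<Sum>i\<in>S. proj i x) = (\<Sum>i\<in>S \<union> T. proj i x)" "(\<Sum>i\<in>T. proj i y) = (\<Sum>i\<in>S \<union> T. proj i y)"
    using S(1,2) T(1,2) by (auto intro!: sum.mono_neutral_left)
  then have "x + y = (\<Sum>i\<in>S \<union> T. proj i (x + y))"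
    using S(3) T(3) by (simp add: proj_add sum.distrib)
  moreover have "proj i (x + y) = 0" if "i \<notin> S \<union> T" for i
    using that S(2) T(2) by (simp add: proj_add)
  ultimately show ?case using S(1) T(1) by (intro exI[of _ "S \<union> T"]) blast
qed

lemma graded_space_A: "graded_space sA grA"
proof (rule graded_spaceI[of sA grA proj])
  show "proj i x \<in> grA i" for i x
    by (induction x rule: tens_induct)
      (auto simp: proj_tens proj_add intro: tens_in A.subspace_add[OF grA_subspace])
  show "proj j x = (if i = j then x else 0)" if "x \<in> grA i" for i j x
    using that by (induction rule: grA_induct) (auto simp: proj_tens proj_add B.hcomp_hom tens_diff)
  fix x
  obtain S where S: "finite S" "\<forall>i. i \<notin> S \<longrightarrow> proj i x = 0" "x = (\<Sum>i\<in>S. proj i x)"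
    using proj_sum by blast
  have sub: "{i. proj i x \<noteq> 0} \<subseteq> S" using S(2) by auto
  then show "finite {i. proj i x \<noteq> 0}" using S(1) finite_subset by blast
  have "(\<Sum>i\<in>S. proj i x) = (\<Sum>i | proj i x \<noteq> 0. proj i x)"
    using S sub by (intro sum.mono_neutral_right) auto
  then show "x = (\<Sum>i | proj i x \<noteq> 0. proj i x)" using S(3) by simp
qed (use vector_space_A grA_finite_dim proj_add in auto)

sublocale A: graded_space sA grA
  by (rule graded_space_A)

lemma hcomp_tens: "A.hcomp i (tens p b) = tens p (B.hcomp i b)"
proof -
  have "A.hcomp i x = proj i x" for i x
  proof -
    obtain S where S: "finite S" "\<forall>i. i \<notin> S \<longrightarrow> proj i x = 0" "x = (\<Sum>i\<in>S. proj i x)"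
      using proj_sum by blast
    have "proj i y \<in> grA i" for i y
      by (induction y rule: tens_induct) (auto simp: proj_tens proj_add intro: tens_in A.gr_add)
    then show ?thesis using S by (intro A.hcomp_eqI[of S]) auto
  qed
  then show ?thesis by (simp add: proj_tens)
qed

text \<open>Contraction of the factor \<open>B\<close> with \<open>b\<close> through the form.
  Applied to both legs it turns tensors over \<open>A\<close> into tensors over
  \<open>P\<close>.\<close>

definition pr :: "'b \<Rightarrow> 'a \<Rightarrow> 'p" where
  "pr b = (SOME h. (\<forall>x y. h (x + y) = h x + h y) \<and> (\<forall>c x. h (sA c x) = sP c (h x)) \<and>
    (\<forall>p b'. h (tens p b') = sP (\<omega> b b') p))"

lemma pr_add: "pr b (x + y) = pr b x + pr b y"
  and pr_scale: "pr b (sA c x) = sP c (pr b x)"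
  and pr_tens: "pr b (tens p b') = sP (\<omega> b b') p"
proof -
  have "bilinear_map sP sB sP (\<lambda>p b'. sP (\<omega> b b') p)"
    unfolding bilinear_map_iff[OF P.vector_space_axioms B.vector_space_axioms P.vector_space_axioms]
    by (auto simp: B.form_lin P.scale_left_distrib P.scale_right_distrib mult.commute)
  then have "\<exists>h. (\<forall>x y. h (x + y) = h x + h y) \<and> (\<forall>c x. h (sA c x) = sP c (h x)) \<and>
    (\<forall>p b'. h (tens p b') = sP (\<omega> b b') p)"
    by (rule tens_extend) blast
  from someI_ex[OF this, folded pr_def]
  show "pr b (x + y) = pr b x + pr b y" "pr b (sA c x) = sP c (pr b x)"
    "pr b (tens p b') = sP (\<omega> b b') p" by auto
qed

lemma pr_add_left: "pr (b + c) x = pr b x + pr c x"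
  by (induction x rule: tens_induct)
    (auto simp: pr_tens pr_add B.form_lin P.scale_left_distrib)

lemma pr_diff_left: "pr (b - c) x = pr b x - pr c x"
  by (rule additive_diff) (rule pr_add_left)

lemma pr_zero: "pr 0 x = 0" "pr b 0 = 0"
  using additive_zero[of "\<lambda>b. pr b x"] pr_add_left additive_zero[of "pr b"] pr_add by auto

lemma pr_hcomp: "pr b (A.hcomp i x) = pr (B.hcomp (- m - i) b) x"
  by (induction x rule: tens_induct) (auto simp: hcomp_tens pr_tens pr_add A.hcomp_add B.hcomp_form)

lemma hcomp_expand_A: "A.hcomp i x = (\<Sum>u\<in>B.idx i. tens (pr (f u) x) (e u))"
  by (induction x rule: tens_induct)
    (auto simp: hcomp_tens pr_tens pr_add A.hcomp_add tens_lin sum.distrib B.hcomp_expand tens_diff)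

lemma pr_degree: "x \<in> grA i \<Longrightarrow> pr b x = pr (B.hcomp (- m - i) b) x"
  using pr_hcomp[of b i x] A.hcomp_hom[of x i i] by simp

definition pf :: "('p \<Rightarrow> 'p \<Rightarrow> 'k) \<Rightarrow> 'b \<Rightarrow> 'b \<Rightarrow> 'a \<Rightarrow> 'a \<Rightarrow> 'k" where
  "pf l b b' = (\<lambda>x y. l (pr b x) (pr b' y))"

text \<open>Degree \<open>i\<close> of \<open>A\<close> sees only the component of \<open>b\<close>
  of degree \<open>- m - i\<close>, and \<open>b\<close> has finitely many components.\<close>

lemma adm_pf: "P.bil l \<Longrightarrow> A.adm (pf l b b')"
proof -
  assume l: "P.bil l"
  have "A.bil (pf l b b')"
    unfolding pf_def by (rule P.bil_comp[OF l]) (auto simp: pr_add pr_scale vector_space_A)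
  moreover have "A.supp (pf l b b') ({i. B.hcomp (- m - i) b \<noteq> 0} \<times> {i. B.hcomp (- m - i) b' \<noteq> 0})"
    (is "A.supp _ ?S")
    unfolding A.supp_def pf_def
  proof (intro allI impI ballI)
    fix i j x y
    assume ij: "(i, j) \<notin> {i. B.hcomp (- m - i) b \<noteq> 0} \<times> {i. B.hcomp (- m - i) b' \<noteq> 0}"
      and "x \<in> grA i" "y \<in> grA j"
    then have "pr b x = 0 \<or> pr b' y = 0"
      using pr_degree[of x i b] pr_degree[of y j b'] pr_zero by auto
    then show "l (pr b x) (pr b' y) = 0" using P.bil_diff[OF l] by auto
  qed
  moreover have "finite {i. B.hcomp (- m - i) b \<noteq> 0}" for b
    using finite_vimageI[OF B.finite_hcomp[of b], of "\<lambda>i. - m - i"] by (simp add: vimage_def inj_def)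
  ultimately show ?thesis unfolding A.adm_def by (intro conjI exI[of _ ?S]) simp_all
qed

text \<open>For fixed \<open>b\<close> and \<open>b'\<close> this is the value at
  \<open>(b, b')\<close> of the bilinear map \<open>B \<times> B \<rightarrow> P \<otimes> P\<close>
  that belongs to \<open>t\<close>, tensors over \<open>P\<close> being functionals of
  \<open>l\<close>.\<close>

definition co :: "('a, 'k) ctensor2 \<Rightarrow> 'b \<Rightarrow> 'b \<Rightarrow> ('p \<Rightarrow> 'p \<Rightarrow> 'k) \<Rightarrow> 'k" where
  "co t b b' l = A.ev t (pf l b b')"

lemma bil_tens: "A.bil \<beta> \<Longrightarrow> P.bil (\<lambda>p q. \<beta> (tens p b) (tens q b'))"
  unfolding A.bil_iff P.bil_iff by (auto simp: tens_lin)

text \<open>Expanding both legs in dual bases expresses a component by finitely many values of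
  \<open>co\<close>. Hence \<open>ctensor_co_eqI\<close>, the test by which identities of completed
  tensors are checked.\<close>

lemma component_co:
  assumes t: "t \<in> A.ctensor" and \<beta>: "A.bil \<beta>"
  shows "t (i, j) \<beta> = (\<Sum>u\<in>B.idx i. \<Sum>v\<in>B.idx j. co t (f u) (f v) (\<lambda>p q. \<beta> (tens p (e u)) (tens q (e v))))"
proof -
  have "t (i, j) \<beta> = A.ev t (\<lambda>x y. \<beta> (A.hcomp i x) (A.hcomp j y))"
    by (rule A.component_eq_ev[OF assms])
  also have "(\<lambda>x y. \<beta> (A.hcomp i x) (A.hcomp j y)) =
      (\<lambda>x y. \<Sum>u\<in>B.idx i. \<Sum>v\<in>B.idx j. pf (\<lambda>p q. \<beta> (tens p (e u)) (tens q (e v))) (f u) (f v) x y)"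
    by (simp add: hcomp_expand_A pf_def A.bil_diff[OF \<beta>] sum.swap[of _ "B.idx j"])
  also have "A.ev t \<dots> = (\<Sum>u\<in>B.idx i. \<Sum>v\<in>B.idx j. co t (f u) (f v) (\<lambda>p q. \<beta> (tens p (e u)) (tens q (e v))))"
    by (simp add: A.ev_sum_form t A.adm_sum adm_pf bil_tens \<beta> co_def)
  finally show ?thesis .
qed

lemma ctensor_co_eqI:
  assumes "s \<in> A.ctensor" "t \<in> A.ctensor" "\<And>b b' l. P.bil l \<Longrightarrow> co s b b' l = co t b b' l"
  shows "s = t"
proof
  fix ij :: "int \<times> int"
  show "s ij = t ij"
    by (rule A.tprod_eqI[OF A.ctensorD'[OF assms(1)] A.ctensorD'[OF assms(2)]])
      (cases ij, simp add: component_co assms bil_tens)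
qed

context
  fixes t n
  assumes t: "t \<in> P.tprod UNIV UNIV" and n: "n \<in> B.ctensor"
begin

lemma bullet_apply:
  "A.bil \<beta> \<Longrightarrow> bullet sA tens t n ij \<beta> = t (\<lambda>p q. n ij (\<lambda>b b'. \<beta> (tens p b) (tens q b')))"
  by (simp add: bullet_def tsum2_def A.pure2_apply)

lemma bullet_in: "bullet sA tens t n \<in> A.ctensor"
proof -
  have "bullet sA tens t n (i, j) \<in> A.tprod (grA i) (grA j)" for i j
  proof -
    obtain N :: nat and x y where t': "t = (\<Sum>k<N. P.pure2 (x k) (y k))"
      by (rule P.tprodE[OF t P.subspace_UNIV])
    obtain M :: nat and b b' where n': "\<And>k. k < M \<Longrightarrow> b k \<in> grB i" "\<And>k. k < M \<Longrightarrow> b' k \<in> grB j"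
      "n (i, j) = (\<Sum>k<M. B.pure2 (b k) (b' k))"
      by (rule B.tprodE[OF B.ctensorD[OF n, of i j] B.gr_subspace], rule that)
    have "bullet sA tens t n (i, j) =
        (\<Sum>k<N. \<Sum>l<M. A.pure2 (tens (x k) (b l)) (tens (y k) (b' l)))" (is "_ = ?s")
    proof
      fix \<beta>
      show "bullet sA tens t n (i, j) \<beta> = ?s \<beta>"
      proof (cases "A.bil \<beta>")
        case True
        have 1: "B.bil (\<lambda>b b'. \<beta> (tens p b) (tens q b'))" for p q
          using True unfolding A.bil_iff B.bil_iff by (auto simp: tens_lin)
        have 2: "P.bil (\<lambda>p q. \<Sum>l<M. \<beta> (tens p (b l)) (tens q (b' l)))"
          using bil_tens[OF True] by (intro P.bil_sum)
        show ?thesis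
          by (simp only: bullet_apply[OF True] n'(3) B.sum_pure2_apply[OF 1] sum_fun_apply
              A.pure2_apply[OF True]) (simp only: t' P.sum_pure2_apply[OF 2])
      next
        case False
        then show ?thesis
          by (simp add: bullet_def tsum2_def A.pure2_def sum_fun_apply
              B.tprod_zero_form[OF B.ctensorD[OF n]] P.tprod_zero_form[OF t])
      qed
    qed
    then show ?thesis
      using n'(1,2) tens_in by (simp only:) (intro A.tprod_sum A.tprod_pure2; simp)
  qed
  then show ?thesis by (simp add: A.ctensor_def)
qed

lemma co_bullet:
  assumes l: "P.bil l"
  shows "co (bullet sA tens t n) b b' l = B.form_hat n b b' * t l"
proof -
  obtain S where S: "finite S" "A.supp (pf l b b') S"
    using A.adm_obtain[OF adm_pf[OF l]] by blast
  obtain S' where S': "finite S'" "B.supp (\<lambda>x y. \<omega> x b * \<omega> y b') S'"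
    using B.adm_obtain[OF B.adm_form] by blast
  \<comment> \<open>One finite set has to bound both supports, so that the pairings over
    \<open>A\<close> and over \<open>B\<close> become sums over the same components.\<close>
  have U: "finite (S \<union> S')" "A.supp (pf l b b') (S \<union> S')" "B.supp (\<lambda>x y. \<omega> x b * \<omega> y b') (S \<union> S')"
    using S S' unfolding A.supp_def B.supp_def by auto
  have b: "B.bil (\<lambda>x y. \<omega> x b * \<omega> y b')" by (rule B.adm_bil[OF B.adm_form])
  \<comment> \<open>Contraction puts \<open>b\<close> on the left of \<open>\<omega>\<close>,
    \<open>form_hat\<close> puts it on the right; the signs of the two legs cancel.\<close>
  have eq: "(\<lambda>c c'. pf l b b' (tens p c) (tens q c')) = (\<lambda>c c'. l p q * (\<omega> c b * \<omega> c' b'))" for p q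
  proof (intro ext)
    fix c c'
    have "\<omega> b c * \<omega> b' c' = \<omega> c b * \<omega> c' b'"
      using B.form_skew[of b c] B.form_skew[of b' c'] by simp
    moreover have "pf l b b' (tens p c) (tens q c') = l p q * (\<omega> b c * \<omega> b' c')"
      using l by (simp add: pf_def pr_tens P.bil_iff mult_ac)
    ultimately show "pf l b b' (tens p c) (tens q c') = l p q * (\<omega> c b * \<omega> c' b')"
      by simp
  qed
  have "bullet sA tens t n ij (pf l b b') = n ij (\<lambda>x y. \<omega> x b * \<omega> y b') * t l" for ij
  proof -
    have "bullet sA tens t n ij (pf l b b') = t (\<lambda>p q. l p q * n ij (\<lambda>x y. \<omega> x b * \<omega> y b'))"
      by (simp only: bullet_apply[OF A.adm_bil[OF adm_pf[OF l]]] eq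
          B.tprod_scale_form[OF B.ctensorD'[OF n] b])
    also have "\<dots> = t (\<lambda>p q. n ij (\<lambda>x y. \<omega> x b * \<omega> y b') * l p q)" by (simp only: mult.commute)
    also have "\<dots> = n ij (\<lambda>x y. \<omega> x b * \<omega> y b') * t l" by (rule P.tprod_scale_form[OF t l])
    finally show ?thesis .
  qed
  then show ?thesis
    using A.ev_eq[OF bullet_in A.adm_bil[OF adm_pf[OF l]] U(1,2)] B.ev_eq[OF n b U(1,3)]
    by (simp add: co_def B.form_hat_eq_ev sum_distrib_right)
qed

end

end

section \<open>Operators and their adjoints\<close>

lemma (in graded_perm_algebra) circ_diff:
  "x \<odot> (y - y') = x \<odot> y - x \<odot> y'" "(x - x') \<odot> y = x \<odot> y - x' \<odot> y" "x \<odot> 0 = 0" "0 \<odot> x = 0"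
  by (rule additive_diff[of "circ x"] additive_diff[of "\<lambda>x. circ x y"]
      additive_zero[of "circ x"] additive_zero[of "\<lambda>y. circ y x"]; simp add: circ_lin)+

context poisson_algebra
begin

lemma mul_lin:
  "x \<cdot> (y + y') = x \<cdot> y + x \<cdot> y'" "x \<cdot> scale c y = scale c (x \<cdot> y)"
  "(x + x') \<cdot> y = x \<cdot> y + x' \<cdot> y" "scale c x \<cdot> y = scale c (x \<cdot> y)"
  using mul_bilinear bilinear_map_iff[OF vector_space_axioms vector_space_axioms vector_space_axioms]
  by auto

lemma brk_lin:
  "brk x (y + y') = brk x y + brk x y'" "brk x (scale c y) = scale c (brk x y)"
  "brk (x + x') y = brk x y + brk x' y" "brk (scale c x) y = scale c (brk x y)"
  using brk_bilinear bilinear_map_iff[OF vector_space_axioms vector_space_axioms vector_space_axioms]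
  by auto

lemma brk_skew: "brk p q = - brk q p"
proof -
  have "brk p q + brk q p = 0"
    using brk_alternating[of "p + q"] unfolding brk_lin by (simp add: brk_alternating add.commute)
  then show ?thesis by (simp add: eq_neg_iff_add_eq_0)
qed

lemma brk_minus: "brk p (- q) = - brk p q" "brk (- p) q = - brk p q"
  by (rule additive_minus[of "brk p"] additive_minus[of "\<lambda>p. brk p q"]; simp add: brk_lin)+

lemma mul_minus: "p \<cdot> (- q) = - (p \<cdot> q)" "(- p) \<cdot> q = - (p \<cdot> q)"
  by (rule additive_minus[of "mul p"] additive_minus[of "\<lambda>p. p \<cdot> q"]; simp add: mul_lin)+

lemma bil_mul: "bil l \<Longrightarrow> bil (\<lambda>x y. l (p \<cdot> x) y)" "bil l \<Longrightarrow> bil (\<lambda>x y. l x (p \<cdot> y))"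
  and bil_brk: "bil l \<Longrightarrow> bil (\<lambda>x y. l (brk p x) y)" "bil l \<Longrightarrow> bil (\<lambda>x y. l x (brk p y))"
  by (auto simp: bil_iff mul_lin brk_lin)

end

locale affinization_algebra = affinization sP mul brk sB grB circB \<omega> m \<Omega> e f sA tens grA
  for sP :: "'k::field \<Rightarrow> 'p::ab_group_add \<Rightarrow> 'p"
    and mul :: "'p \<Rightarrow> 'p \<Rightarrow> 'p" (infixl "\<cdot>" 70)
    and brk :: "'p \<Rightarrow> 'p \<Rightarrow> 'p"
    and sB :: "'k \<Rightarrow> 'b::ab_group_add \<Rightarrow> 'b" and grB :: "int \<Rightarrow> 'b set"
    and circB :: "'b \<Rightarrow> 'b \<Rightarrow> 'b" (infixl "\<odot>" 70) and \<omega> :: "'b \<Rightarrow> 'b \<Rightarrow> 'k"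
    and m :: int and \<Omega> :: "'j set" and e f :: "'j \<Rightarrow> 'b"
    and sA :: "'k \<Rightarrow> 'a::ab_group_add \<Rightarrow> 'a" and tens :: "'p \<Rightarrow> 'b \<Rightarrow> 'a" and grA :: "int \<Rightarrow> 'a set" +
  fixes circ ast :: "'a \<Rightarrow> 'a \<Rightarrow> 'a"
  assumes circ_bilinear: "bilinear_map sA sA sA circ"
    and circ_tens: "circ (tens p1 b1) (tens p2 b2) = tens (p1 \<cdot> p2) (b1 \<odot> b2)"
    and ast_bilinear: "bilinear_map sA sA sA ast"
    and ast_tens: "ast (tens p1 b1) (tens p2 b2) = tens (brk p1 p2) (b1 \<odot> b2)"
begin

lemma circ_lin:
  "circ x (y + y') = circ x y + circ x y'" "circ x (sA c y) = sA c (circ x y)"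
  "circ (x + x') y = circ x y + circ x' y" "circ (sA c x) y = sA c (circ x y)"
  using circ_bilinear bilinear_map_iff[OF vector_space_A vector_space_A vector_space_A] by auto

lemma ast_lin:
  "ast x (y + y') = ast x y + ast x y'" "ast x (sA c y) = sA c (ast x y)"
  "ast (x + x') y = ast x y + ast x' y" "ast (sA c x) y = sA c (ast x y)"
  using ast_bilinear bilinear_map_iff[OF vector_space_A vector_space_A vector_space_A] by auto

lemma tens_induct3:
  assumes "\<And>p1 b1 p2 b2 p3 b3. Q (tens p1 b1) (tens p2 b2) (tens p3 b3)"
    and "\<And>x x' y z. Q x y z \<Longrightarrow> Q x' y z \<Longrightarrow> Q (x + x') y z"
    and "\<And>x y y' z. Q x y z \<Longrightarrow> Q x y' z \<Longrightarrow> Q x (y + y') z"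
    and "\<And>x y z z'. Q x y z \<Longrightarrow> Q x y z' \<Longrightarrow> Q x y (z + z')"
  shows "Q x y z"
proof (induction x rule: tens_induct)
  case (tens p b)
  show ?case
  proof (induction y rule: tens_induct)
    case (tens p' b')
    show ?case by (induction z rule: tens_induct) (auto intro: assms)
  qed (rule assms(3))
qed (rule assms(2))

text \<open>On pure tensors the factors in \<open>B\<close> of all terms of an axiom agree, because
  triple products in a perm algebra are symmetric in the first two arguments. What is left is an
  identity of the Poisson algebra.\<close>

lemma graded_dpp_algebra_A: "graded_dpp_algebra sA grA circ ast"
proof unfold_locales
  show "circ x y \<in> grA (i + j)" "ast x y \<in> grA (i + j)" if "x \<in> grA i" "y \<in> grA j" for x y i j
  proof -
    have "circ x y \<in> grA (i + j) \<and> ast x y \<in> grA (i + j)"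
      using that(1)
    proof (induction rule: grA_induct)
      case (tens p b)
      show ?case using that(2)
        by (induction rule: grA_induct)
          (auto simp: circ_tens ast_tens circ_lin ast_lin tens B.circ_graded intro!: tens_in A.gr_add)
    qed (auto simp: circ_lin ast_lin intro: A.gr_add)
    then show "circ x y \<in> grA (i + j)" "ast x y \<in> grA (i + j)" by auto
  qed
  note rules = circ_tens ast_tens B.circ_assoc circ_lin ast_lin
  show "circ a1 (circ a2 a3) = circ (circ a1 a2) a3" for a1 a2 a3
    by (rule tens_induct3[of _ a1 a2 a3]) (auto simp: rules P.mul_assoc)
  show "circ (circ a1 a2) a3 = circ (circ a2 a1) a3" for a1 a2 a3
    by (rule tens_induct3[of _ a1 a2 a3])
      (auto simp: rules P.mul_comm B.circ_perm[of _ _ "_"] intro: arg_cong2[of _ _ _ _ tens] B.circ_perm)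
  show "ast a1 (ast a2 a3) = ast (ast a1 a2) a3 + ast a2 (ast a1 a3)" for a1 a2 a3
  proof (rule tens_induct3[of _ a1 a2 a3])
    fix p1 b1 p2 b2 p3 b3
    have "brk p1 (brk p2 p3) = brk (brk p1 p2) p3 + brk p2 (brk p1 p3)"
      using P.brk_jacobi[of p1 p2 p3] P.brk_skew[of p3 "brk p1 p2"] P.brk_skew[of p3 p1]
      by (simp add: P.brk_minus algebra_simps)
    then show "ast (tens p1 b1) (ast (tens p2 b2) (tens p3 b3)) =
      ast (ast (tens p1 b1) (tens p2 b2)) (tens p3 b3) + ast (tens p2 b2) (ast (tens p1 b1) (tens p3 b3))"
      by (simp add: rules tens_lin B.circ_perm[of b2 b1])
  qed (auto simp: ast_lin algebra_simps)
  show "ast (circ a1 a2) a3 = circ a1 (ast a2 a3) + circ a2 (ast a1 a3)" for a1 a2 a3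
  proof (rule tens_induct3[of _ a1 a2 a3])
    fix p1 b1 p2 b2 p3 b3
    have "brk (p1 \<cdot> p2) p3 = p1 \<cdot> brk p2 p3 + p2 \<cdot> brk p1 p3"
      using P.brk_mul[of p3 p1 p2] P.brk_skew[of p3 "p1 \<cdot> p2"] P.brk_skew[of p3 p1] P.brk_skew[of p3 p2]
        P.mul_comm[of p2 "brk p1 p3"]
      by (simp add: P.mul_minus eq_neg_iff_add_eq_0 algebra_simps)
    then show "ast (circ (tens p1 b1) (tens p2 b2)) (tens p3 b3) =
      circ (tens p1 b1) (ast (tens p2 b2) (tens p3 b3)) + circ (tens p2 b2) (ast (tens p1 b1) (tens p3 b3))"
      by (simp add: rules tens_lin B.circ_perm[of b2 b1])
  qed (auto simp: ast_lin circ_lin algebra_simps)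
  show "circ (ast a1 a2) a3 = ast a1 (circ a2 a3) - circ a2 (ast a1 a3)" for a1 a2 a3
  proof (rule tens_induct3[of _ a1 a2 a3])
    fix p1 b1 p2 b2 p3 b3
    have "brk p1 p2 \<cdot> p3 = brk p1 (p2 \<cdot> p3) - p2 \<cdot> brk p1 p3"
      using P.brk_mul[of p1 p2 p3] by simp
    then show "circ (ast (tens p1 b1) (tens p2 b2)) (tens p3 b3) =
      ast (tens p1 b1) (circ (tens p2 b2) (tens p3 b3)) - circ (tens p2 b2) (ast (tens p1 b1) (tens p3 b3))"
      by (simp add: rules tens_diff B.circ_perm[of b2 b1])
  qed (auto simp: ast_lin circ_lin algebra_simps)
  show "circ (ast a1 a2) a3 = - circ (ast a2 a1) a3" for a1 a2 a3
  proof (rule tens_induct3[of _ a1 a2 a3])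
    fix p1 b1 p2 b2 p3 b3
    have "brk p1 p2 \<cdot> p3 = - (brk p2 p1 \<cdot> p3)"
      by (simp add: P.brk_skew[of p1 p2] P.mul_minus)
    then show "circ (ast (tens p1 b1) (tens p2 b2)) (tens p3 b3) =
        - circ (ast (tens p2 b2) (tens p1 b1)) (tens p3 b3)"
      by (simp add: circ_tens ast_tens tens_diff B.circ_perm[of b2 b1])
  qed (auto simp: ast_lin circ_lin algebra_simps)
qed (rule circ_bilinear ast_bilinear)+

sublocale D: graded_dpp_algebra sA grA circ ast
  by (rule graded_dpp_algebra_A)

lemma locfin_ops:
  "A.locfin (circ a)" "A.locfin (\<lambda>x. circ x a)" "A.locfin (ast a)" "A.locfin (\<lambda>x. ast x a)"
  using A.locfin_graded_op[OF circ_bilinear D.circ_graded] A.locfin_graded_op[OF ast_bilinear D.ast_graded]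
  by auto

text \<open>\<open>F\<close> is \<open>h\<close> on the factor \<open>P\<close>, and \<open>\<phi>\<close> is the \<open>\<omega>\<close>-adjoint of its factor on \<open>B\<close>.\<close>
definition adj :: "('a \<Rightarrow> 'a) \<Rightarrow> ('p \<Rightarrow> 'p) \<Rightarrow> ('b \<Rightarrow> 'b) \<Rightarrow> bool" where
  "adj F h \<phi> \<longleftrightarrow> A.locfin F \<and> (\<forall>x y. h (x + y) = h x + h y) \<and> (\<forall>c x. h (sP c x) = sP c (h x)) \<and>
    (\<forall>b x. pr b (F x) = h (pr (\<phi> b) x))"

lemma adj_id: "adj id id id"
  by (simp add: adj_def A.locfin_id)

text \<open>In \<open>adj_R'\<close> the sign from \<open>brk q p = - brk p q\<close> is moved into
  the factor on \<open>B\<close>. Left and right multiplications then carry the same operator on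
  \<open>P\<close> and can be combined: \<open>L - R\<close> and \<open>L' + R'\<close> both get the
  simple adjoint \<open>\<lambda>b. b \<odot> c\<close>.\<close>

lemma adj_ops:
  shows adj_L: "adj (circ (tens p c)) (mul p) (\<lambda>b. c \<odot> b)"
    and adj_R: "adj (\<lambda>x. circ x (tens p c)) (mul p) (\<lambda>b. c \<odot> b - b \<odot> c)"
    and adj_L': "adj (ast (tens p c)) (brk p) (\<lambda>b. c \<odot> b)"
    and adj_R': "adj (\<lambda>x. ast x (tens p c)) (brk p) (\<lambda>b. b \<odot> c - c \<odot> b)"
proof -
  have 1: "pr b (circ (tens p c) x) = p \<cdot> pr (c \<odot> b) x" for b x
    by (induction x rule: tens_induct)
      (auto simp: circ_tens pr_tens circ_lin pr_add P.mul_lin B.form_L[of b c])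
  have 2: "pr b (circ x (tens p c)) = p \<cdot> pr (c \<odot> b - b \<odot> c) x" for b x
    by (induction x rule: tens_induct)
      (auto simp: circ_tens pr_tens circ_lin pr_add P.mul_lin B.form_R[of b _ c] P.mul_comm)
  have 3: "pr b (ast (tens p c) x) = brk p (pr (c \<odot> b) x)" for b x
    by (induction x rule: tens_induct)
      (auto simp: ast_tens pr_tens ast_lin pr_add P.brk_lin B.form_L[of b c])
  have 4: "pr b (ast x (tens p c)) = brk p (pr (b \<odot> c - c \<odot> b) x)" for b x
  proof (induction x rule: tens_induct)
    case (tens q b')
    have "\<omega> (b \<odot> c - c \<odot> b) b' = - \<omega> b (b' \<odot> c)" by (simp add: B.form_R[of b b' c] B.form_diff)
    then show ?case using P.brk_skew[of q p]
      by (simp add: ast_tens pr_tens P.brk_lin P.brk_minus)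
  qed (simp add: ast_lin pr_add P.brk_lin)
  show "adj (circ (tens p c)) (mul p) (\<lambda>b. c \<odot> b)"
    "adj (\<lambda>x. circ x (tens p c)) (mul p) (\<lambda>b. c \<odot> b - b \<odot> c)"
    "adj (ast (tens p c)) (brk p) (\<lambda>b. c \<odot> b)"
    "adj (\<lambda>x. ast x (tens p c)) (brk p) (\<lambda>b. b \<odot> c - c \<odot> b)"
    unfolding adj_def using 1 2 3 4 locfin_ops P.mul_lin P.brk_lin by auto
qed

lemma adj_add: "adj F h \<phi> \<Longrightarrow> adj G h \<psi> \<Longrightarrow> adj (F + G) h (\<lambda>b. \<phi> b + \<psi> b)"
  unfolding adj_def by (auto simp: A.locfin_add pr_add pr_add_left)

lemma adj_diff: "adj F h \<phi> \<Longrightarrow> adj G h \<psi> \<Longrightarrow> adj (F - G) h (\<lambda>b. \<phi> b - \<psi> b)"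
proof -
  have "pr b (x - y) = pr b x - pr b y" for b x y by (rule additive_diff) (rule pr_add)
  then show "adj F h \<phi> \<Longrightarrow> adj G h \<psi> \<Longrightarrow> adj (F - G) h (\<lambda>b. \<phi> b - \<psi> b)"
    unfolding adj_def using additive_diff[of h] by (auto simp: A.locfin_diff pr_diff_left)
qed

lemma adj_LR: "adj (circ (tens p c) - (\<lambda>x. circ x (tens p c))) (mul p) (\<lambda>b. b \<odot> c)"
  and adj_RL: "adj ((\<lambda>x. circ x (tens p c)) - circ (tens p c)) (mul p) (\<lambda>b. - (b \<odot> c))"
  and adj_L'R': "adj (ast (tens p c) + (\<lambda>x. ast x (tens p c))) (brk p) (\<lambda>b. b \<odot> c)"
  using adj_diff[OF adj_L adj_R, of p c c] adj_diff[OF adj_R adj_L, of p c c]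
    adj_add[OF adj_L' adj_R', of p c c] by simp_all

lemma co_cmap2:
  assumes F: "adj F h \<phi>" and G: "adj G k \<psi>" and t: "t \<in> A.ctensor" and l: "P.bil l"
  shows "co (A.cmap2 F G t) b b' l = co t (\<phi> b) (\<psi> b') (\<lambda>x y. l (h x) (k y))"
proof -
  have "(\<lambda>x y. pf l b b' (F x) (G y)) = pf (\<lambda>x y. l (h x) (k y)) (\<phi> b) (\<psi> b')"
    using F G by (simp add: pf_def adj_def)
  then show ?thesis
    using A.ev_cmap2[OF _ _ t adm_pf[OF l], of F G] F G by (simp add: co_def adj_def)
qed

lemma co_left: "adj F h \<phi> \<Longrightarrow> t \<in> A.ctensor \<Longrightarrow> P.bil l \<Longrightarrow>
    co (A.cmap2 F id t) b b' l = co t (\<phi> b) b' (\<lambda>x y. l (h x) y)"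
  and co_right: "adj F h \<phi> \<Longrightarrow> t \<in> A.ctensor \<Longrightarrow> P.bil l \<Longrightarrow>
    co (A.cmap2 id F t) b b' l = co t b (\<phi> b') (\<lambda>x y. l x (h y))"
  using co_cmap2[OF _ adj_id] co_cmap2[OF adj_id] by auto

lemma co_arith:
  assumes "P.bil l" "s \<in> A.ctensor" "t \<in> A.ctensor"
  shows co_add: "co (s + t) b b' l = co s b b' l + co t b b' l"
    and co_diff: "co (s - t) b b' l = co s b b' l - co t b b' l"
  using adm_pf[OF assms(1)] assms by (simp_all add: co_def A.ev_add A.ev_diff)

lemma co_zero: "P.bil l \<Longrightarrow> co 0 b b' l = 0"
  using adm_pf[of l] by (simp add: co_def A.ev_zero)

lemma co_minus: "P.bil l \<Longrightarrow> t \<in> A.ctensor \<Longrightarrow> co (- t) b b' l = - co t b b' l"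
  using adm_pf[of l] by (simp add: co_def A.ev_minus)

lemma co_cflip: "P.bil l \<Longrightarrow> t \<in> A.ctensor \<Longrightarrow> co (A.cflip t) b b' l = co t b' b (\<lambda>x y. l y x)"
  using adm_pf[of l] by (simp add: co_def A.ev_cflip) (simp add: pf_def)

text \<open>Reducing an axiom to pure tensors requires both sides to be additive in the algebra
  elements. The closure rules of \<open>opfam\<close>, \<open>tfam\<close> and \<open>biadd\<close>
  mirror the term structure, so additivity can be read off from the shape of an axiom.\<close>

definition opfam :: "('a \<Rightarrow> 'a \<Rightarrow> 'a) \<Rightarrow> bool" where
  "opfam T \<longleftrightarrow> (\<forall>a a'. T (a + a') = T a + T a') \<and> (\<forall>a. A.locfin (T a))"

definition tfam :: "('a \<Rightarrow> ('a, 'k) ctensor2) \<Rightarrow> bool" where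
  "tfam F \<longleftrightarrow> (\<forall>a a'. F (a + a') = F a + F a') \<and> (\<forall>a. F a \<in> A.ctensor)"

definition biadd :: "('a \<Rightarrow> 'a \<Rightarrow> ('a, 'k) ctensor2) \<Rightarrow> bool" where
  "biadd F \<longleftrightarrow> (\<forall>a a' b. F (a + a') b = F a b + F a' b) \<and> (\<forall>a b b'. F a (b + b') = F a b + F a b') \<and>
    (\<forall>a b. F a b \<in> A.ctensor)"

lemma biadd_eqI:
  assumes "biadd F" "biadd G"
    and "\<And>p1 b1 p2 b2 b b' l. P.bil l \<Longrightarrow>
      co (F (tens p1 b1) (tens p2 b2)) b b' l = co (G (tens p1 b1) (tens p2 b2)) b b' l"
  shows "F x y = G x y"
proof (induction x rule: tens_induct)
  case (tens p b)
  show ?case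
  proof (induction y rule: tens_induct)
    case (tens p' b')
    show ?case by (rule ctensor_co_eqI) (use assms in \<open>auto simp: biadd_def\<close>)
  qed (use assms in \<open>auto simp: biadd_def\<close>)
qed (use assms in \<open>auto simp: biadd_def\<close>)

lemma opfam_rules:
  shows "opfam circ" "opfam (\<lambda>a x. circ x a)" "opfam ast" "opfam (\<lambda>a x. ast x a)"
    and "opfam S \<Longrightarrow> opfam T \<Longrightarrow> opfam (\<lambda>a. S a + T a)"
    and "opfam S \<Longrightarrow> opfam T \<Longrightarrow> opfam (\<lambda>a. S a - T a)"
  by (auto simp: opfam_def locfin_ops circ_lin ast_lin fun_eq_iff A.locfin_add A.locfin_diff)

lemma tfam_rules:
  shows "tfam F \<Longrightarrow> tfam G \<Longrightarrow> tfam (\<lambda>a. F a + G a)"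
    and "tfam F \<Longrightarrow> tfam G \<Longrightarrow> tfam (\<lambda>a. F a - G a)"
    and "tfam F \<Longrightarrow> tfam (\<lambda>a. A.cflip (F a))"
  by (auto simp: tfam_def A.ctensor_add A.ctensor_diff A.cflip_in A.cflip_add)

lemma biadd_rules:
  shows "biadd F \<Longrightarrow> biadd G \<Longrightarrow> biadd (\<lambda>a b. F a b + G a b)"
    and "biadd F \<Longrightarrow> biadd G \<Longrightarrow> biadd (\<lambda>a b. F a b - G a b)"
    and "biadd F \<Longrightarrow> biadd (\<lambda>a b. - F a b)"
    and "biadd F \<Longrightarrow> biadd (\<lambda>a b. A.cflip (F a b))"
  by (auto simp: biadd_def A.ctensor_add A.ctensor_diff A.ctensor_minus A.cflip_in A.cflip_add)

lemma biadd_tfam: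
  assumes F: "tfam F"
  shows "biadd (\<lambda>a b. F (circ a b))" "biadd (\<lambda>a b. F (ast a b))" "biadd (\<lambda>a b. F (ast a b + ast b a))"
  using F by (auto simp: biadd_def tfam_def circ_lin ast_lin algebra_simps A.ctensor_add)

lemma biadd_cmap2:
  assumes F: "tfam F" and T: "opfam T"
  shows "biadd (\<lambda>a b. A.cmap2 (T a) id (F b))" "biadd (\<lambda>a b. A.cmap2 id (T a) (F b))"
    "biadd (\<lambda>a b. A.cmap2 (T b) id (F a))" "biadd (\<lambda>a b. A.cmap2 id (T b) (F a))"
  using F T
  by (auto simp: biadd_def tfam_def opfam_def A.cmap2_in A.locfin_id A.cmap2_add A.cmap2_add_left
      A.cmap2_add_right)

section \<open>The completed coalgebra\<close>

text \<open>The last clause speaks of arbitrary \<open>a\<close>: contract \<open>a\<close> with the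
  product \<open>b \<odot> b'\<close>, then apply \<open>D\<close>. In this form it can be iterated,
  as the composites of coproducts require.\<close>

definition lifts :: "('a \<Rightarrow> ('a, 'k) ctensor2) \<Rightarrow> ('p \<Rightarrow> ('p, 'k) tensor2) \<Rightarrow> bool" where
  "lifts F D \<longleftrightarrow> (\<forall>a. F a \<in> A.ctensor) \<and> (\<forall>a a'. F (a + a') = F a + F a') \<and>
    (\<forall>c a. F (sA c a) = cscale c (F a)) \<and> (\<forall>p. D p \<in> P.tprod UNIV UNIV) \<and>
    (\<forall>p p'. D (p + p') = D p + D p') \<and> (\<forall>c p. D (sP c p) = fscale c (D p)) \<and>
    (\<forall>a b b' l. P.bil l \<longrightarrow> co (F a) b b' l = D (pr (b \<odot> b') a) l)"

context
  fixes F D assumes FD: "lifts F D"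
begin

lemma lifts_rules:
  "F a \<in> A.ctensor" "F (a + a') = F a + F a'" "F (sA c a) = cscale c (F a)"
  "D p \<in> P.tprod UNIV UNIV" "D (p + p') = D p + D p'" "D (sP c p) = fscale c (D p)"
  "P.bil l \<Longrightarrow> co (F a) b b' l = D (pr (b \<odot> b') a) l"
  using FD by (auto simp: lifts_def)

lemma lifts_component:
  "A.bil \<beta> \<Longrightarrow> F x (k, l) \<beta> = (\<Sum>u\<in>B.idx k. \<Sum>v\<in>B.idx l.
    D (pr (f u \<odot> f v) x) (\<lambda>p q. \<beta> (tens p (e u)) (tens q (e v))))"
  by (simp add: component_co lifts_rules bil_tens)

text \<open>The component of degree \<open>(k, l)\<close> is tested with products
  \<open>f u \<odot> f v\<close> of degree \<open>- 2 * m - k - l\<close>, which see only degree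
  \<open>m + k + l\<close> of \<open>A\<close>. So \<open>F\<close> changes the total degree by a
  constant.\<close>

lemma lifts_locfin2: "A.locfin2 F"
proof -
  have "F x (k, l) = 0" if "x \<in> grA i" "i \<noteq> m + k + l" for x i k l
  proof (rule A.tprod_eqI[OF A.ctensorD'[OF lifts_rules(1)] A.tprod_zero[of UNIV UNIV]])
    fix \<beta> assume \<beta>: "A.bil \<beta>"
    have "pr (f u \<odot> f v) x = 0" if "u \<in> B.idx k" "v \<in> B.idx l" for u v
    proof -
      have "f u \<odot> f v \<in> grB (- m - k + (- m - l))"
        using that by (intro B.circ_graded B.f_deg)
      then have "B.hcomp (- m - i) (f u \<odot> f v) = 0"
        using \<open>i \<noteq> m + k + l\<close> by (simp add: B.hcomp_hom)
      then show ?thesis using pr_degree[OF \<open>x \<in> grA i\<close>, of "f u \<odot> f v"] by (simp add: pr_zero)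
    qed
    moreover have "D 0 = 0" using additive_zero[of D] lifts_rules(5) by auto
    ultimately show "F x (k, l) \<beta> = 0 \<beta>"
      by (simp add: lifts_component[OF \<beta>])
  qed
  then have "{i. \<exists>x\<in>grA i. F x (k, l) \<noteq> 0} \<subseteq> {m + k + l}" for k l by blast
  then have "finite {i. \<exists>x\<in>grA i. F x (k, l) \<noteq> 0}" for k l
    by (rule finite_subset) simp
  then show ?thesis by (auto simp: A.locfin2_def lifts_rules)
qed

end

definition tri3 :: "('a \<Rightarrow> 'a \<Rightarrow> 'a \<Rightarrow> 'k) \<Rightarrow> 'j \<Rightarrow> 'j \<Rightarrow> 'j \<Rightarrow> 'p \<Rightarrow> 'p \<Rightarrow> 'p \<Rightarrow> 'k" where
  "tri3 \<beta> u v w = (\<lambda>p q r. \<beta> (tens p (e u)) (tens q (e v)) (tens r (e w)))"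

lemma tri3: "trilinear_form sA \<beta> \<Longrightarrow> trilinear_form sP (tri3 \<beta> u v w)"
  unfolding A.tri_iff P.tri_iff by (auto simp: tri3_def tens_lin)

lemma tri_sum:
  assumes "trilinear_form sA \<beta>"
  shows "\<beta> x y (\<Sum>i\<in>I. g i) = (\<Sum>i\<in>I. \<beta> x y (g i))" "\<beta> (\<Sum>i\<in>I. g i) x y = (\<Sum>i\<in>I. \<beta> (g i) x y)"
  using assms by (auto intro!: additive_sum[of "\<beta> x y"] additive_sum[of "\<lambda>z. \<beta> z x y"] simp: A.tri_iff)

lemma bil_slice:
  assumes "trilinear_form sP l" "\<And>p. D p \<in> P.tprod UNIV UNIV" "\<And>p p'. D (p + p') = D p + D p'"
    "\<And>c p. D (sP c p) = fscale c (D p)"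
  shows "P.bil (\<lambda>p q. D p (\<lambda>p' p''. l p' p'' q))" "P.bil (\<lambda>p q. D q (\<lambda>p' p''. l p p' p''))"
proof -
  have b: "P.bil (\<lambda>p' p''. l p' p'' q)" "P.bil (l q)" for q
    using assms(1) by (auto simp: P.tri_iff P.bil_iff)
  have s: "(\<lambda>p' p''. l p' p'' (q + q')) = (\<lambda>p' p''. l p' p'' q + l p' p'' q')"
    "(\<lambda>p' p''. l p' p'' (sP c q)) = (\<lambda>p' p''. c * l p' p'' q)"
    "l (q + q') = (\<lambda>p' p''. l q p' p'' + l q' p' p'')"
    "l (sP c q) = (\<lambda>p' p''. c * l q p' p'')" for c q q'
    using assms(1) by (auto simp: P.tri_iff fun_eq_iff)
  show "P.bil (\<lambda>p q. D p (\<lambda>p' p''. l p' p'' q))" "P.bil (\<lambda>p q. D q (\<lambda>p' p''. l p p' p''))"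
    unfolding P.bil_iff
    by (auto simp: s assms(3,4) fscale_def P.tprod_add_form[OF assms(2)] P.tprod_scale_form[OF assms(2)] b)
qed

context
  fixes F D G E assumes FD: "lifts F D" and GE: "lifts G E"
begin

text \<open>Two uses of \<open>lifts\<close>: the inner coproduct contracts the first leg of
  \<open>G a\<close> with \<open>f u \<odot> f v\<close>, and the outer one then contracts
  \<open>a\<close> with the triple product. Right composites give the same with the other
  bracketing.\<close>

lemma clmap3_lifts:
  "A.clmap3 F (G a) (k, l, n) \<beta> = (if trilinear_form sA \<beta> then
    \<Sum>u\<in>B.idx k. \<Sum>v\<in>B.idx l. \<Sum>w\<in>B.idx n. P.lmap3 D (E (pr (f u \<odot> f v \<odot> f w) a)) (tri3 \<beta> u v w) else 0)"
proof (cases "trilinear_form sA \<beta>")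
  case True
  have inner: "F x (k, l) (\<lambda>x' x''. \<beta> x' x'' (A.hcomp n y)) =
      (\<Sum>u\<in>B.idx k. \<Sum>v\<in>B.idx l. \<Sum>w\<in>B.idx n. D (pr (f u \<odot> f v) x) (\<lambda>p q. tri3 \<beta> u v w p q (pr (f w) y)))"
    for x y
  proof -
    have bil: "P.bil (\<lambda>p q. tri3 \<beta> u v w p q r)" for u v w r
      using tri3[OF True] by (auto simp: P.tri_iff P.bil_iff)
    have "(\<lambda>p q. \<beta> (tens p (e u)) (tens q (e v)) (A.hcomp n y)) =
        (\<lambda>p q. \<Sum>w\<in>B.idx n. tri3 \<beta> u v w p q (pr (f w) y))" for u v
      by (simp add: hcomp_expand_A tri_sum[OF True] tri3_def)
    then show ?thesis
      by (simp add: lifts_component[OF FD A.tri_bil(1)[OF True]]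
          P.tprod_sum_form[OF lifts_rules(4)[OF FD] bil])
  qed
  have b: "P.bil (\<lambda>p q. D p (\<lambda>p' p''. tri3 \<beta> u v w p' p'' q))" for u v w
    using bil_slice(1)[OF tri3[OF True]] lifts_rules[OF FD] by blast
  have "(\<lambda>x y. F x (k, l) (\<lambda>x' x''. \<beta> x' x'' (A.hcomp n y))) =
      (\<lambda>x y. \<Sum>u\<in>B.idx k. \<Sum>v\<in>B.idx l. \<Sum>w\<in>B.idx n.
        pf (\<lambda>p q. D p (\<lambda>p' p''. tri3 \<beta> u v w p' p'' q)) (f u \<odot> f v) (f w) x y)"
    by (simp add: inner pf_def)
  then have "A.clmap3 F (G a) (k, l, n) \<beta> = (\<Sum>u\<in>B.idx k. \<Sum>v\<in>B.idx l. \<Sum>w\<in>B.idx n.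
      co (G a) (f u \<odot> f v) (f w) (\<lambda>p q. D p (\<lambda>p' p''. tri3 \<beta> u v w p' p'' q)))"
    using True
    by (simp add: A.clmap3_apply[OF lifts_locfin2[OF FD] lifts_rules(1)[OF GE]] co_def
        A.ev_sum_form lifts_rules(1)[OF GE] A.adm_sum adm_pf b)
  then show ?thesis
    using True tri3[OF True] by (simp add: lifts_rules(7)[OF GE b] P.lmap3_apply)
qed (simp add: A.clmap3_apply[OF lifts_locfin2[OF FD] lifts_rules(1)[OF GE]])

lemma crmap3_lifts:
  "A.crmap3 F (G a) (k, l, n) \<beta> = (if trilinear_form sA \<beta> then
    \<Sum>u\<in>B.idx k. \<Sum>v\<in>B.idx l. \<Sum>w\<in>B.idx n. P.rmap3 D (E (pr (f u \<odot> (f v \<odot> f w)) a)) (tri3 \<beta> u v w) else 0)"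
proof (cases "trilinear_form sA \<beta>")
  case True
  have inner: "F y (l, n) (\<lambda>x' x''. \<beta> (A.hcomp k x) x' x'') =
      (\<Sum>v\<in>B.idx l. \<Sum>w\<in>B.idx n. \<Sum>u\<in>B.idx k. D (pr (f v \<odot> f w) y) (\<lambda>p q. tri3 \<beta> u v w (pr (f u) x) p q))"
    for x y
  proof -
    have bil: "P.bil (\<lambda>p q. tri3 \<beta> u v w r p q)" for u v w r
      using tri3[OF True] by (auto simp: P.tri_iff P.bil_iff)
    have "(\<lambda>p q. \<beta> (A.hcomp k x) (tens p (e v)) (tens q (e w))) =
        (\<lambda>p q. \<Sum>u\<in>B.idx k. tri3 \<beta> u v w (pr (f u) x) p q)" for v w
      by (simp add: hcomp_expand_A tri_sum[OF True] tri3_def)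
    then show ?thesis
      by (simp add: lifts_component[OF FD A.tri_bil(3)[OF True]]
          P.tprod_sum_form[OF lifts_rules(4)[OF FD] bil])
  qed
  have b: "P.bil (\<lambda>p q. D q (\<lambda>p' p''. tri3 \<beta> u v w p p' p''))" for u v w
    using bil_slice(2)[OF tri3[OF True]] lifts_rules[OF FD] by blast
  have "(\<lambda>x y. F y (l, n) (\<lambda>x' x''. \<beta> (A.hcomp k x) x' x'')) =
      (\<lambda>x y. \<Sum>v\<in>B.idx l. \<Sum>w\<in>B.idx n. \<Sum>u\<in>B.idx k.
        pf (\<lambda>p q. D q (\<lambda>p' p''. tri3 \<beta> u v w p p' p'')) (f u) (f v \<odot> f w) x y)"
    by (simp add: inner pf_def)
  then have "A.crmap3 F (G a) (k, l, n) \<beta> = (\<Sum>v\<in>B.idx l. \<Sum>w\<in>B.idx n. \<Sum>u\<in>B.idx k.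
      co (G a) (f u) (f v \<odot> f w) (\<lambda>p q. D q (\<lambda>p' p''. tri3 \<beta> u v w p p' p'')))"
    using True
    by (simp add: A.crmap3_apply[OF lifts_locfin2[OF FD] lifts_rules(1)[OF GE]] co_def
        A.ev_sum_form lifts_rules(1)[OF GE] A.adm_sum adm_pf b)
  also have "\<dots> = (\<Sum>v\<in>B.idx l. \<Sum>w\<in>B.idx n. \<Sum>u\<in>B.idx k.
      P.rmap3 D (E (pr (f u \<odot> (f v \<odot> f w)) a)) (tri3 \<beta> u v w))"
    using tri3[OF True] by (simp add: lifts_rules(7)[OF GE b] P.rmap3_apply)
  also have "\<dots> = (\<Sum>v\<in>B.idx l. \<Sum>u\<in>B.idx k. \<Sum>w\<in>B.idx n.
      P.rmap3 D (E (pr (f u \<odot> (f v \<odot> f w)) a)) (tri3 \<beta> u v w))"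
    by (rule sum.cong[OF refl]) (rule sum.swap)
  also have "\<dots> = (\<Sum>u\<in>B.idx k. \<Sum>v\<in>B.idx l. \<Sum>w\<in>B.idx n.
      P.rmap3 D (E (pr (f u \<odot> (f v \<odot> f w)) a)) (tri3 \<beta> u v w))"
    by (rule sum.swap)
  finally show ?thesis using True by simp
qed (simp add: A.crmap3_apply[OF lifts_locfin2[OF FD] lifts_rules(1)[OF GE]])

end

text \<open>Exchanging the first two legs exchanges \<open>u\<close> and \<open>v\<close> in the
  coefficients. The second premise handles forms that are not trilinear, where
  \<open>A.cflip12 T\<close> evaluates \<open>T\<close> at the zero form.\<close>

lemma cflip12_triple:
  assumes "\<And>k l n \<beta>. T (k, l, n) \<beta> = (if trilinear_form sA \<beta> then
      \<Sum>u\<in>B.idx k. \<Sum>v\<in>B.idx l. \<Sum>w\<in>B.idx n. H u v w (tri3 \<beta> u v w) else 0)"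
    and "\<And>u v w. H u v w (\<lambda>_ _ _. 0) = 0"
  shows "A.cflip12 T (k, l, n) \<beta> = (if trilinear_form sA \<beta> then
      \<Sum>u\<in>B.idx k. \<Sum>v\<in>B.idx l. \<Sum>w\<in>B.idx n. H v u w (\<lambda>p q r. tri3 \<beta> u v w q p r) else 0)"
proof (cases "trilinear_form sA \<beta>")
  case True
  then have "trilinear_form sA (\<lambda>x y z. \<beta> y x z)" by (simp add: A.tri_iff)
  moreover have "A.cflip12 T (k, l, n) \<beta> = T (l, k, n) (\<lambda>x y z. \<beta> y x z)"
    by (simp add: A.cflip12_def A.flip12_apply[OF True])
  moreover have "tri3 (\<lambda>x y z. \<beta> y x z) v u w = (\<lambda>p q r. tri3 \<beta> u v w q p r)" for u v w
    by (simp add: tri3_def)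
  ultimately show ?thesis using True by (simp add: assms sum.swap[of _ "B.idx l"])
next
  case False
  have "A.cflip12 T (k, l, n) \<beta> = T (l, k, n) (\<lambda>_ _ _. 0)"
    using False by (simp add: A.cflip12_def A.flip12_def tsum3_def A.pure3_def)
  also have "T (l, k, n) (\<lambda>_ _ _. 0) = 0 "
    by (simp add: assms A.tri_iff tri3_def)
  finally show ?thesis using False by simp
qed

end

section \<open>Consequences of the Poisson coalgebra axioms\<close>

context poisson_coalgebra
begin

lemma Delta_swap: "bil l \<Longrightarrow> \<Delta> p (\<lambda>x y. l y x) = \<Delta> p l"
  using flip_apply[of l "\<Delta> p"] by (simp add: Delta_cocomm)

lemma delta_swap: "bil l \<Longrightarrow> \<delta> p (\<lambda>x y. l y x) = - \<delta> p l"
  using flip_apply[of l "\<delta> p"] by (simp add: delta_coskew)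

lemma Delta_lin: "\<Delta> (p + p') = \<Delta> p + \<Delta> p'" "\<Delta> (scale c p) = fscale c (\<Delta> p)"
  and delta_lin: "\<delta> (p + p') = \<delta> p + \<delta> p'" "\<delta> (scale c p) = fscale c (\<delta> p)"
  using Delta_linear delta_linear by (auto simp: Vector_Spaces.linear_iff)

lemma neg_form:
  assumes "t \<in> tprod UNIV UNIV" "bil l" shows "t (\<lambda>x y. - l x y) = - t l"
  using tprod_scale_form[OF assms, of "-1"] by simp

text \<open>The axiom for \<open>(\<nu> \<otimes> id) \<theta>\<close> has \<open>\<Delta>\<close>
  on the left leg of \<open>\<delta>\<close>, the co-Leibniz rule has it on the right. Skewness of
  \<open>\<delta>\<close> carries it across by rotating the three arguments, and the symmetries of
  \<open>\<Delta>\<close> and \<open>\<delta>\<close> bring the other two terms back; each of the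
  three moves costs one sign.\<close>

lemma coLeibniz_left:
  assumes l: "trilinear_form scale l"
  shows "lmap3 \<Delta> (\<delta> p) l = rmap3 \<delta> (\<Delta> p) l + flip12 (rmap3 \<delta> (\<Delta> p)) l"
proof -
  have tri: "trilinear_form scale (\<lambda>x y z. l y z x)" "trilinear_form scale (\<lambda>x y z. l x z y)"
    "trilinear_form scale (\<lambda>x y z. l y x z)" "trilinear_form scale (\<lambda>x y z. l z y x)"
    using l by (auto simp: tri_iff)
  have slice: "bil (\<lambda>x y. D x (\<lambda>x' x''. l' x' x'' y))" "bil (\<lambda>x y. D y (l' x))"
    if l': "trilinear_form scale l'" and D: "D = \<Delta> \<or> D = \<delta>" for D l'
  proof -
    have b: "bil (\<lambda>x' x''. l' x' x'' q)" "bil (l' q)" for q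
      using l' by (auto simp: tri_iff bil_iff)
    have s: "(\<lambda>x' x''. l' x' x'' (q + q')) = (\<lambda>x' x''. l' x' x'' q + l' x' x'' q')"
      "(\<lambda>x' x''. l' x' x'' (scale c q)) = (\<lambda>x' x''. c * l' x' x'' q)"
      "l' (q + q') = (\<lambda>x' x''. l' q x' x'' + l' q' x' x'')"
      "l' (scale c q) = (\<lambda>x' x''. c * l' q x' x'')" for c q q'
      using l' by (auto simp: tri_iff fun_eq_iff)
    have in_D: "D p \<in> tprod UNIV UNIV" for p using D Delta_in delta_in by auto
    have lin_D: "D (p + p') = D p + D p'" "D (scale c p) = fscale c (D p)" for p p' c
      using D Delta_lin delta_lin by auto
    show "bil (\<lambda>x y. D x (\<lambda>x' x''. l' x' x'' y))" "bil (\<lambda>x y. D y (l' x))"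
      unfolding bil_iff
      by (auto simp: s lin_D fscale_def tprod_add_form[OF in_D] tprod_scale_form[OF in_D] b)
  qed
  have b: "bil (l x)" "bil (\<lambda>y z. l y x z)" for x
    using l by (auto simp: tri_iff bil_iff)
  have 1: "lmap3 \<Delta> (\<delta> p) l = - rmap3 \<Delta> (\<delta> p) (\<lambda>x y z. l y z x)"
    using delta_swap[OF slice(2)[OF tri(1), of "\<Delta>"], of p] l tri
    by (simp add: lmap3_apply rmap3_apply)
  have 2: "lmap3 \<delta> (\<Delta> p) (\<lambda>x y z. l y z x) = - rmap3 \<delta> (\<Delta> p) (\<lambda>x y z. l y x z)"
  proof -
    have "lmap3 \<delta> (\<Delta> p) (\<lambda>x y z. l y z x) = \<Delta> p (\<lambda>x y. \<delta> y (\<lambda>x' x''. l x'' x x'))"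
      using Delta_swap[OF slice(1)[OF tri(1), of "\<delta>"], of p] tri by (simp add: lmap3_apply)
    also have "\<dots> = \<Delta> p (\<lambda>x y. - \<delta> y (\<lambda>x' x''. l x' x x''))"
      using delta_swap[OF b(2)] by simp
    also have "\<dots> = - \<Delta> p (\<lambda>x y. \<delta> y (\<lambda>x' x''. l x' x x''))"
      by (rule neg_form[OF Delta_in slice(2)[OF tri(3)]]) simp
    finally show ?thesis using tri by (simp add: rmap3_apply)
  qed
  have 3: "rmap3 \<delta> (\<Delta> p) (\<lambda>x y z. l x z y) = - rmap3 \<delta> (\<Delta> p) l"
  proof -
    have "rmap3 \<delta> (\<Delta> p) (\<lambda>x y z. l x z y) = \<Delta> p (\<lambda>x y. - \<delta> y (l x))"
      using delta_swap[OF b(1)] tri by (simp add: rmap3_apply)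
    also have "\<dots> = - \<Delta> p (\<lambda>x y. \<delta> y (l x))"
      by (rule neg_form[OF Delta_in slice(2)[OF l]]) simp
    finally show ?thesis using l by (simp add: rmap3_apply)
  qed
  have flip_rmap3: "flip12 (rmap3 \<delta> (\<Delta> p)) l' = rmap3 \<delta> (\<Delta> p) (\<lambda>x y z. l' y x z)"
    if "trilinear_form scale l'" for l'
    using that by (rule flip12_apply)
  have "lmap3 \<Delta> (\<delta> p) l = - (lmap3 \<delta> (\<Delta> p) (\<lambda>x y z. l y z x) +
      flip12 (rmap3 \<delta> (\<Delta> p)) (\<lambda>x y z. l y z x))"
    by (simp add: 1 coLeibniz)
  then show ?thesis
    by (simp add: 2 3 flip_rmap3[OF l] flip_rmap3[OF tri(1)])
qed

end

section \<open>The induced coproducts and the coalgebra axioms\<close>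

locale affinization_bialgebra =
  affinization_algebra sP mul brk sB grB circB \<omega> m \<Omega> e f sA tens grA circ ast +
  P: poisson_bialgebra sP mul brk \<Delta> \<delta>
  for sP :: "'k::field \<Rightarrow> 'p::ab_group_add \<Rightarrow> 'p"
    and mul :: "'p \<Rightarrow> 'p \<Rightarrow> 'p" (infixl "\<cdot>" 70)
    and brk :: "'p \<Rightarrow> 'p \<Rightarrow> 'p"
    and sB :: "'k \<Rightarrow> 'b::ab_group_add \<Rightarrow> 'b" and grB :: "int \<Rightarrow> 'b set"
    and circB :: "'b \<Rightarrow> 'b \<Rightarrow> 'b" (infixl "\<odot>" 70) and \<omega> :: "'b \<Rightarrow> 'b \<Rightarrow> 'k"
    and m :: int and \<Omega> :: "'j set" and e f :: "'j \<Rightarrow> 'b"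
    and sA :: "'k \<Rightarrow> 'a::ab_group_add \<Rightarrow> 'a" and tens :: "'p \<Rightarrow> 'b \<Rightarrow> 'a" and grA :: "int \<Rightarrow> 'a set"
    and circ ast :: "'a \<Rightarrow> 'a \<Rightarrow> 'a"
    and \<Delta> \<delta> :: "'p \<Rightarrow> ('p, 'k) tensor2" +
  fixes \<nu> \<theta> :: "'a \<Rightarrow> ('a, 'k) ctensor2"
  assumes nu_linear: "Vector_Spaces.linear sA cscale \<nu>"
    and nu_tens: "\<nu> (tens p b) = bullet sA tens (\<Delta> p) (B.nu_form b)"
    and theta_linear: "Vector_Spaces.linear sA cscale \<theta>"
    and theta_tens: "\<theta> (tens p b) = bullet sA tens (\<delta> p) (B.nu_form b)"
begin

lemma lifts_bullet:
  assumes F: "Vector_Spaces.linear sA cscale F"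
    and F_tens: "\<And>p b. F (tens p b) = bullet sA tens (D p) (B.nu_form b)"
    and D: "\<And>p. D p \<in> P.tprod UNIV UNIV" "\<And>p p'. D (p + p') = D p + D p'"
    "\<And>c p. D (sP c p) = fscale c (D p)"
  shows "lifts F D"
proof -
  have lin: "F (a + a') = F a + F a'" "F (sA c a) = cscale c (F a)" for a a' c
    using F by (auto simp: Vector_Spaces.linear_iff)
  have F_in: "F a \<in> A.ctensor" for a
  proof (induction a rule: tens_induct)
    case (tens p b)
    show ?case unfolding F_tens by (rule bullet_in[OF D(1) B.nu_form])
  next
    case (add x y)
    then show ?case by (simp only: lin A.ctensor_add)
  qed
  have "co (F a) b b' l = D (pr (b \<odot> b') a) l" if "P.bil l" for a b b' l
  proof (induction a rule: tens_induct)
    case (tens p c)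
    show ?case
      using B.form_skew[of c "b \<odot> b'"]
      by (simp add: F_tens co_bullet[OF D(1) B.nu_form that] B.form_hat_nu_form pr_tens D(3) fscale_def)
  next
    case (add x y)
    have "co (F (x + y)) b b' l = co (F x) b b' l + co (F y) b b' l"
      unfolding lin by (rule co_add[OF that F_in F_in])
    then show ?case by (simp add: add pr_add D(2))
  qed
  then show ?thesis by (simp add: lifts_def lin F_in D)
qed

lemma nu_lifts: "lifts \<nu> \<Delta>"
  by (rule lifts_bullet[OF nu_linear nu_tens P.Delta_in P.Delta_lin])

lemma theta_lifts: "lifts \<theta> \<delta>"
  by (rule lifts_bullet[OF theta_linear theta_tens P.delta_in P.delta_lin])

lemma lmap3_zero:
  "P.lmap3 \<Delta> (\<Delta> p) (\<lambda>_ _ _. 0) = 0" "P.lmap3 \<delta> (\<Delta> p) (\<lambda>_ _ _. 0) = 0"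
  "P.rmap3 \<delta> (\<Delta> p) (\<lambda>_ _ _. 0) = 0" "P.rmap3 \<delta> (\<delta> p) (\<lambda>_ _ _. 0) = 0"
  by (simp_all add: P.lmap3_apply P.rmap3_apply P.tri_iff P.tprod_zero_form[OF P.Delta_in]
      P.tprod_zero_form[OF P.delta_in])

lemmas flips =
  cflip12_triple[OF clmap3_lifts[OF nu_lifts nu_lifts] lmap3_zero(1)]
  cflip12_triple[OF clmap3_lifts[OF theta_lifts nu_lifts] lmap3_zero(2)]
  cflip12_triple[OF crmap3_lifts[OF theta_lifts nu_lifts] lmap3_zero(3)]
  cflip12_triple[OF crmap3_lifts[OF theta_lifts theta_lifts] lmap3_zero(4)]

text \<open>All composites are composites over \<open>P\<close>, taken at the contraction of
  \<open>a\<close> with a triple product. Associativity identifies the two bracketings, and the perm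
  identity absorbs the exchange of \<open>u\<close> and \<open>v\<close> under the flip, so each
  axiom becomes one of the Poisson coalgebra at that contraction.\<close>

lemma completed_dpp_coalgebra_A: "completed_dpp_coalgebra sA grA \<nu> \<theta>"
proof unfold_locales
  show "\<nu> a \<in> A.ctensor" "\<theta> a \<in> A.ctensor" for a
    using lifts_rules(1) nu_lifts theta_lifts by blast+
  show "A.clmap3_defined F (G a) \<and> A.crmap3_defined F (G a)"
    if "F \<in> {\<nu>, \<theta>}" "G \<in> {\<nu>, \<theta>}" for F G a
    using that A.clmap3_defined A.crmap3_defined lifts_locfin2 lifts_rules(1) nu_lifts theta_lifts
    by auto
  note rules = clmap3_lifts[OF nu_lifts nu_lifts] clmap3_lifts[OF theta_lifts nu_lifts]
    clmap3_lifts[OF nu_lifts theta_lifts] clmap3_lifts[OF theta_lifts theta_lifts]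
    crmap3_lifts[OF nu_lifts nu_lifts] crmap3_lifts[OF theta_lifts nu_lifts]
    crmap3_lifts[OF nu_lifts theta_lifts] crmap3_lifts[OF theta_lifts theta_lifts]
  have assoc: "f u \<odot> (f v \<odot> f w) = f u \<odot> f v \<odot> f w" for u v w by (rule B.circ_assoc)
  have perm: "f v \<odot> f u \<odot> f w = f u \<odot> f v \<odot> f w" for u v w by (rule B.circ_perm)
  have flip12: "P.flip12 t (tri3 \<beta> u v w) = t (\<lambda>p q r. tri3 \<beta> u v w q p r)"
    if "trilinear_form sA \<beta>" for t \<beta> u v w
    using P.flip12_apply[OF tri3[OF that]] .
  show "A.clmap3 \<nu> (\<nu> a) = A.crmap3 \<nu> (\<nu> a)" for a
    by (intro ext, clarify) (simp add: rules P.Delta_coassoc assoc)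
  \<comment> \<open>Flipping the first two legs of a left composite flips the inner coproduct only,
    so symmetry of \<open>\<Delta>\<close> and skewness of \<open>\<delta>\<close> decide the
    sign.\<close>
  have 1: "P.flip12 (P.lmap3 \<Delta> (\<Delta> p)) l = P.lmap3 \<Delta> (\<Delta> p) l"
    and 2: "P.flip12 (P.lmap3 \<delta> (\<Delta> p)) l = - P.lmap3 \<delta> (\<Delta> p) l"
    if l: "trilinear_form sP l" for p l
  proof -
    have l': "trilinear_form sP (\<lambda>x y z. l y x z)" and b: "P.bil (\<lambda>x y. l x y z)" for z
      using l by (auto simp: P.tri_iff P.bil_iff)
    have s: "P.bil (\<lambda>x y. \<delta> x (\<lambda>x' x''. l x' x'' y))"
      by (rule bil_slice[OF l P.delta_in P.delta_lin])
    show "P.flip12 (P.lmap3 \<Delta> (\<Delta> p)) l = P.lmap3 \<Delta> (\<Delta> p) l"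
      using P.Delta_swap[OF b] by (simp add: P.flip12_apply l P.lmap3_apply l')
    show "P.flip12 (P.lmap3 \<delta> (\<Delta> p)) l = - P.lmap3 \<delta> (\<Delta> p) l"
      using P.delta_swap[OF b] by (simp add: P.flip12_apply l P.lmap3_apply l' P.neg_form[OF P.Delta_in s])
  qed
  show "A.crmap3 \<nu> (\<nu> a) = A.cflip12 (A.clmap3 \<nu> (\<nu> a))" for a
    by (intro ext, clarify)
      (simp add: rules flips assoc perm 1 tri3 flip: P.Delta_coassoc flip12)
  show "A.crmap3 \<theta> (\<theta> a) = A.clmap3 \<theta> (\<theta> a) + A.cflip12 (A.crmap3 \<theta> (\<theta> a))" for a
  proof (intro ext, clarify)
    have "P.rmap3 \<delta> (\<delta> p) = P.lmap3 \<delta> (\<delta> p) + P.flip12 (P.rmap3 \<delta> (\<delta> p))" for p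
      using P.delta_cojacobi[of p] by (simp add: algebra_simps)
    then have *: "P.rmap3 \<delta> (\<delta> p) l = P.lmap3 \<delta> (\<delta> p) l + P.flip12 (P.rmap3 \<delta> (\<delta> p)) l" for p l
      by (metis plus_fun_apply)
    show "A.crmap3 \<theta> (\<theta> a) (k, l, n) \<beta> =
      (A.clmap3 \<theta> (\<theta> a) + A.cflip12 (A.crmap3 \<theta> (\<theta> a))) (k, l, n) \<beta>" for k l n \<beta>
    proof (cases "trilinear_form sA \<beta>")
      case True
      show ?thesis
        by (simp add: rules flips assoc perm True flip: flip12[OF True] sum.distrib)
          (subst *, rule refl)
    qed (simp add: rules flips)
  qed
  show "A.crmap3 \<nu> (\<theta> a) = A.clmap3 \<theta> (\<nu> a) + A.cflip12 (A.crmap3 \<theta> (\<nu> a))" for a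
  proof (intro ext, clarify)
    show "A.crmap3 \<nu> (\<theta> a) (k, l, n) \<beta> =
      (A.clmap3 \<theta> (\<nu> a) + A.cflip12 (A.crmap3 \<theta> (\<nu> a))) (k, l, n) \<beta>" for k l n \<beta>
    proof (cases "trilinear_form sA \<beta>")
      case True
      then show ?thesis
        by (simp add: rules flips assoc perm P.coLeibniz flip: flip12[OF True] sum.distrib)
    qed (simp add: rules flips)
  qed
  show "A.clmap3 \<nu> (\<theta> a) = A.crmap3 \<theta> (\<nu> a) + A.cflip12 (A.crmap3 \<theta> (\<nu> a))" for a
  proof (intro ext, clarify)
    show "A.clmap3 \<nu> (\<theta> a) (k, l, n) \<beta> =
      (A.crmap3 \<theta> (\<nu> a) + A.cflip12 (A.crmap3 \<theta> (\<nu> a))) (k, l, n) \<beta>" for k l n \<beta>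
    proof (cases "trilinear_form sA \<beta>")
      case True
      then show ?thesis
        by (simp add: rules flips assoc perm P.coLeibniz_left[OF tri3[OF True]]
            flip: flip12[OF True] sum.distrib)
    qed (simp add: rules flips)
  qed
  show "A.clmap3 \<theta> (\<nu> a) = - A.cflip12 (A.clmap3 \<theta> (\<nu> a))" for a
  proof (intro ext, clarify)
    show "A.clmap3 \<theta> (\<nu> a) (k, l, n) \<beta> = (- A.cflip12 (A.clmap3 \<theta> (\<nu> a))) (k, l, n) \<beta>" for k l n \<beta>
    proof (cases "trilinear_form sA \<beta>")
      case True
      then show ?thesis
        by (simp add: rules flips assoc perm 2[OF tri3[OF True]] flip: flip12[OF True] sum_negf)
    qed (simp add: rules flips)
  qed
qed (use lifts_rules(2,3)[OF nu_lifts] lifts_rules(2,3)[OF theta_lifts] in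
  \<open>auto simp: cscale_def fscale_def fun_eq_iff algebra_simps\<close>)

sublocale C: completed_dpp_coalgebra sA grA \<nu> \<theta>
  by (rule completed_dpp_coalgebra_A)

lemma tfam_structure: "tfam \<nu>" "tfam \<theta>"
  "tfam (\<lambda>a. \<nu> a - A.cflip (\<nu> a))" "tfam (\<lambda>a. \<theta> a + A.cflip (\<theta> a))"
  "tfam (\<lambda>a. A.cflip (\<nu> a))" "tfam (\<lambda>a. A.cflip (\<theta> a))"
  using lifts_rules(1,2)[OF nu_lifts] lifts_rules(1,2)[OF theta_lifts]
  by (auto simp: tfam_def A.cflip_add A.cflip_in A.ctensor_add A.ctensor_diff)

lemma co_nu: "P.bil l \<Longrightarrow> co (\<nu> (tens p c)) b b' l = \<omega> (b \<odot> b') c * \<Delta> p l"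
  and co_theta: "P.bil l \<Longrightarrow> co (\<theta> (tens p c)) b b' l = \<omega> (b \<odot> b') c * \<delta> p l"
  by (simp_all add: lifts_rules(7)[OF nu_lifts] lifts_rules(7)[OF theta_lifts] pr_tens
      P.Delta_lin P.delta_lin fscale_def)

lemma structure_in: "\<nu> a \<in> A.ctensor" "\<theta> a \<in> A.ctensor"
  "A.cflip (\<nu> a) \<in> A.ctensor" "A.cflip (\<theta> a) \<in> A.ctensor"
  using C.nu_in C.theta_in A.cflip_in by auto

lemma co_cflip_nu: "P.bil l \<Longrightarrow> co (A.cflip (\<nu> (tens p c))) b b' l = \<omega> (b' \<odot> b) c * \<Delta> p l"
  and co_cflip_theta: "P.bil l \<Longrightarrow> co (A.cflip (\<theta> (tens p c))) b b' l = - \<omega> (b' \<odot> b) c * \<delta> p l"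
  using co_nu[OF P.bil_swap] co_theta[OF P.bil_swap] P.Delta_swap[of l p] P.delta_swap[of l p]
  by (simp_all add: co_cflip[OF _ structure_in(1)] co_cflip[OF _ structure_in(2)])

lemma Delta_mul_form: "P.bil l \<Longrightarrow>
    \<Delta> (p1 \<cdot> p2) l = \<Delta> p1 (\<lambda>x y. l (p2 \<cdot> x) y) + \<Delta> p2 (\<lambda>x y. l x (p1 \<cdot> y))"
  and delta_brk_form: "P.bil l \<Longrightarrow> \<delta> (brk p1 p2) l =
    \<delta> p2 (\<lambda>x y. l (brk p1 x) y) + \<delta> p2 (\<lambda>x y. l x (brk p1 y)) -
    (\<delta> p1 (\<lambda>x y. l (brk p2 x) y) + \<delta> p1 (\<lambda>x y. l x (brk p2 y)))"
  and Delta_brk_form: "P.bil l \<Longrightarrow> \<Delta> (brk p1 p2) l =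
    \<Delta> p2 (\<lambda>x y. l (brk p1 x) y) + \<Delta> p2 (\<lambda>x y. l x (brk p1 y)) +
    (\<delta> p1 (\<lambda>x y. l (p2 \<cdot> x) y) - \<delta> p1 (\<lambda>x y. l x (p2 \<cdot> y)))"
  and delta_mul_form: "P.bil l \<Longrightarrow> \<delta> (p1 \<cdot> p2) l =
    \<delta> p2 (\<lambda>x y. l (p1 \<cdot> x) y) + \<delta> p1 (\<lambda>x y. l (p2 \<cdot> x) y) +
    \<Delta> p2 (\<lambda>x y. l x (brk p1 y)) + \<Delta> p1 (\<lambda>x y. l x (brk p2 y))"
  by (simp_all add: P.Delta_mul P.delta_brk P.Delta_brk P.delta_mul P.map2_apply)

lemmas axiom_rules = circ_tens ast_tens co_nu co_theta co_cflip_nu co_cflip_theta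
  co_add co_diff co_minus structure_in A.cmap2_in A.ctensor_add A.ctensor_diff A.ctensor_minus
  A.locfin_id locfin_ops A.locfin_add A.locfin_diff P.bil_mul P.bil_brk
  co_left[OF adj_L] co_left[OF adj_R] co_left[OF adj_L'] co_left[OF adj_R'] co_left[OF adj_LR]
  co_left[OF adj_L'R'] co_right[OF adj_L] co_right[OF adj_R] co_right[OF adj_L']
  co_right[OF adj_R'] co_right[OF adj_LR] co_right[OF adj_L'R']

lemmas axiom_intros = biadd_rules biadd_tfam biadd_cmap2 tfam_structure opfam_rules

lemmas form_rules = B.form_L[of "_ \<odot> _"] B.form_diff B.form_lin B.circ_diff B.circ_lin
  B.circ_assoc[symmetric]

text \<open>The adjoint of a right multiplication is a commutator up to sign, and in a perm algebra
  commutators annihilate everything when multiplied from the left. Hence both sides of the first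
  perm and of the first Leibniz bialgebra condition are zero.\<close>

lemma R_nu: "A.cmap2 (\<lambda>x. circ x a1) id (\<nu> a2) = 0"
  and R'_theta: "A.cmap2 (\<lambda>x. ast x a1) id (\<theta> a2) = 0"
proof -
  have z: "biadd (\<lambda>_ _. 0)" by (simp add: biadd_def A.ctensor_zero)
  have p: "\<omega> ((c \<odot> b - b \<odot> c) \<odot> b') c' = 0" for b b' c c'
    using B.circ_perm[of b c b'] by (simp add: B.circ_diff B.form_diff)
  show "A.cmap2 (\<lambda>x. circ x a1) id (\<nu> a2) = 0"
  proof (rule biadd_eqI[OF _ z], goal_cases)
    case (2 p1 b1 p2 b2 b b' l)
    show ?case by (simp only: axiom_rules co_zero p 2 mult_zero_left)
  qed (intro axiom_intros)
  show "A.cmap2 (\<lambda>x. ast x a1) id (\<theta> a2) = 0"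
  proof (rule biadd_eqI[OF _ z], goal_cases)
    case (2 p1 b1 p2 b2 b b' l)
    show ?case by (simp only: axiom_rules co_zero p 2 mult_zero_left)
  qed (intro axiom_intros)
qed

section \<open>The bialgebra identities\<close>

lemma nu_add: "\<nu> (a + a') = \<nu> a + \<nu> a'"
  by (rule lifts_rules(2)[OF nu_lifts])

text \<open>From \<open>\<Delta> (p1 p2) = \<Delta> (p2 p1)\<close> and \<open>\<Delta> [p1, p2] = - \<Delta> [p2, p1]\<close>.\<close>

lemma symmetry_forms:
  assumes l: "P.bil l"
  shows "\<Delta> p2 (\<lambda>x y. l (p1 \<cdot> x) y) =
      \<Delta> p1 (\<lambda>x y. l (p2 \<cdot> x) y) + \<Delta> p2 (\<lambda>x y. l x (p1 \<cdot> y)) - \<Delta> p1 (\<lambda>x y. l x (p2 \<cdot> y))"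
    and "\<delta> p2 (\<lambda>x y. l (p1 \<cdot> x) y) = \<delta> p1 (\<lambda>x y. l x (p2 \<cdot> y)) + \<delta> p2 (\<lambda>x y. l x (p1 \<cdot> y))
      - \<delta> p1 (\<lambda>x y. l (p2 \<cdot> x) y) - \<Delta> p1 (\<lambda>x y. l (brk p2 x) y) - \<Delta> p1 (\<lambda>x y. l x (brk p2 y))
      - \<Delta> p2 (\<lambda>x y. l (brk p1 x) y) - \<Delta> p2 (\<lambda>x y. l x (brk p1 y))"
proof -
  show "\<Delta> p2 (\<lambda>x y. l (p1 \<cdot> x) y) =
      \<Delta> p1 (\<lambda>x y. l (p2 \<cdot> x) y) + \<Delta> p2 (\<lambda>x y. l x (p1 \<cdot> y)) - \<Delta> p1 (\<lambda>x y. l x (p2 \<cdot> y))"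
    using Delta_mul_form[OF l, of p1 p2] Delta_mul_form[OF l, of p2 p1]
    by (simp add: P.mul_comm[of p1 p2] algebra_simps)
  have "\<Delta> (brk p1 p2) = - \<Delta> (brk p2 p1)"
    using P.brk_skew[of p1 p2] additive_minus[of \<Delta>, OF P.Delta_lin(1)] by simp
  then have "\<Delta> (brk p1 p2) l + \<Delta> (brk p2 p1) l = 0" by simp
  moreover have "\<delta> p2 (\<lambda>x y. l (p1 \<cdot> x) y) - (\<delta> p1 (\<lambda>x y. l x (p2 \<cdot> y)) + \<delta> p2 (\<lambda>x y. l x (p1 \<cdot> y))
      - \<delta> p1 (\<lambda>x y. l (p2 \<cdot> x) y) - \<Delta> p1 (\<lambda>x y. l (brk p2 x) y) - \<Delta> p1 (\<lambda>x y. l x (brk p2 y))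
      - \<Delta> p2 (\<lambda>x y. l (brk p1 x) y) - \<Delta> p2 (\<lambda>x y. l x (brk p1 y)))
    = \<Delta> (brk p1 p2) l + \<Delta> (brk p2 p1) l"
    by (simp add: Delta_brk_form[OF l] algebra_simps)
  ultimately show "\<delta> p2 (\<lambda>x y. l (p1 \<cdot> x) y) = \<delta> p1 (\<lambda>x y. l x (p2 \<cdot> y)) + \<delta> p2 (\<lambda>x y. l x (p1 \<cdot> y))
      - \<delta> p1 (\<lambda>x y. l (p2 \<cdot> x) y) - \<Delta> p1 (\<lambda>x y. l (brk p2 x) y) - \<Delta> p1 (\<lambda>x y. l x (brk p2 y))
      - \<Delta> p2 (\<lambda>x y. l (brk p1 x) y) - \<Delta> p2 (\<lambda>x y. l x (brk p1 y))"
    by (simp only: eq_iff_diff_eq_0[of "\<delta> p2 (\<lambda>x y. l (p1 \<cdot> x) y)"])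
qed

lemma cflip_zero: "A.cflip 0 = 0"
  by (rule ctensor_co_eqI) (simp_all add: A.cflip_in A.ctensor_zero co_cflip co_zero P.bil_swap)

lemmas scalar_rules = form_rules Delta_mul_form delta_brk_form Delta_brk_form delta_mul_form

text \<open>The calculation is the same for all identities down to \<open>compat7\<close>. On pure
  tensors each coefficient is a value of \<open>\<omega>\<close> on a triple product with
  \<open>c1\<close> or \<open>c2\<close> in the last place; \<open>form_four\<close> rewrites it
  into three fixed values with \<open>b1\<close> last. The coefficients of these values agree by the
  Poisson bialgebra identities.\<close>

lemma perm2: "\<nu> (circ a1 a2) = A.cmap2 (circ a1 - (\<lambda>b. circ b a1)) id (\<nu> a2) + A.cmap2 id (\<lambda>b. circ b a2) (\<nu> a1)"
proof (rule biadd_eqI[where x = a1 and y = a2], goal_cases)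
  case (3 p1 c1 p2 c2 b1 b2 l)
  show ?case
    by (simp only: axiom_rules nu_add 3)
      \<comment> \<open>The elements are fixed in \<open>symmetry_forms\<close> to make it a
        directed rule; with free variables the exchange of the two elements could be applied again
        and again.\<close>
      (simp add: scalar_rules B.form_four[where a = b1 and b = b2 and c = c1 and d = c2]
        symmetry_forms[OF 3, of p2 p1] 3 algebra_simps)
qed (intro axiom_intros)+

lemma perm3: "\<nu> (circ a1 a2) = A.cmap2 id (circ a1) (\<nu> a2) + A.cmap2 (circ a2 - (\<lambda>b. circ b a2)) id (\<nu> a1 - A.cflip (\<nu> a1))"
proof (rule biadd_eqI[where x = a1 and y = a2], goal_cases)
  case (3 p1 c1 p2 c2 b1 b2 l)
  show ?case
    by (simp only: axiom_rules nu_add 3)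
      (simp add: scalar_rules B.form_four[where a = b1 and b = b2 and c = c1 and d = c2]
        symmetry_forms[OF 3, of p2 p1] 3 algebra_simps)
qed (intro axiom_intros)+

lemma leib2: "\<theta> (ast a1 a2) =
      (A.cmap2 id (\<lambda>b. ast b a2) (\<theta> a1 + A.cflip (\<theta> a1)) - A.cmap2 (ast a2 + (\<lambda>b. ast b a2)) id (\<theta> a1 + A.cflip (\<theta> a1))) +
      (A.cmap2 id (ast a1) (\<theta> a2) + A.cmap2 (ast a1) id (\<theta> a2))"
proof (rule biadd_eqI[where x = a1 and y = a2], goal_cases)
  case (3 p1 c1 p2 c2 b1 b2 l)
  show ?case
    by (simp only: axiom_rules nu_add 3)
      (simp add: scalar_rules B.form_four[where a = b1 and b = b2 and c = c1 and d = c2]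
        symmetry_forms[OF 3, of p2 p1] 3 algebra_simps)
qed (intro axiom_intros)+

lemma compat1: "\<nu> (ast a1 a2) =
      (A.cmap2 id (ast a1) (\<nu> a2) + A.cmap2 (ast a1) id (\<nu> a2)) +
      (A.cmap2 (circ a2 - (\<lambda>b. circ b a2)) id (\<theta> a1 + A.cflip (\<theta> a1)) - A.cmap2 id (\<lambda>b. circ b a2) (\<theta> a1 + A.cflip (\<theta> a1)))"
proof (rule biadd_eqI[where x = a1 and y = a2], goal_cases)
  case (3 p1 c1 p2 c2 b1 b2 l)
  show ?case
    by (simp only: axiom_rules nu_add 3)
      (simp add: scalar_rules B.form_four[where a = b1 and b = b2 and c = c1 and d = c2]
        symmetry_forms[OF 3, of p2 p1] 3 algebra_simps)
qed (intro axiom_intros)+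

lemma compat2: "\<theta> (circ a1 a2) =
      A.cmap2 id (circ a1) (\<theta> a2) + A.cmap2 id (\<lambda>b. circ b a2) (\<theta> a1)
      - A.cmap2 (ast a1 + (\<lambda>b. ast b a1)) id (\<nu> a2) - A.cmap2 (ast a2 + (\<lambda>b. ast b a2)) id (\<nu> a1 - A.cflip (\<nu> a1))"
proof (rule biadd_eqI[where x = a1 and y = a2], goal_cases)
  case (3 p1 c1 p2 c2 b1 b2 l)
  show ?case
    by (simp only: axiom_rules nu_add 3)
      (simp add: scalar_rules B.form_four[where a = b1 and b = b2 and c = c1 and d = c2]
        symmetry_forms[OF 3, of p2 p1] 3 algebra_simps)
qed (intro axiom_intros)+

lemma compat3: "A.cmap2 id (\<lambda>b. ast b a1) (A.cflip (\<nu> a2)) = - A.cmap2 (\<lambda>b. circ b a2) id (\<theta> a1)"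
proof (rule biadd_eqI[where x = a1 and y = a2], goal_cases)
  case (3 p1 c1 p2 c2 b1 b2 l)
  show ?case
    by (simp only: axiom_rules nu_add 3)
      (simp add: scalar_rules B.form_four[where a = b1 and b = b2 and c = c1 and d = c2]
        symmetry_forms[OF 3, of p2 p1] 3 algebra_simps)
qed (intro axiom_intros)+

lemma compat4: "\<nu> (ast a1 a2) =
      (A.cmap2 id (circ a1) (\<theta> a2) - A.cmap2 (circ a1) id (\<theta> a2)) +
      (A.cmap2 id (\<lambda>b. ast b a2) (\<nu> a1 - A.cflip (\<nu> a1)) - A.cmap2 (ast a2 + (\<lambda>b. ast b a2)) id (\<nu> a1 - A.cflip (\<nu> a1)))"
proof (rule biadd_eqI[where x = a1 and y = a2], goal_cases)
  case (3 p1 c1 p2 c2 b1 b2 l)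
  show ?case
    by (simp only: axiom_rules nu_add 3)
      (simp add: scalar_rules B.form_four[where a = b1 and b = b2 and c = c1 and d = c2]
        symmetry_forms[OF 3, of p2 p1] 3 algebra_simps)
qed (intro axiom_intros)+

lemma compat5: "\<theta> (circ a1 a2) + A.cflip (\<theta> (circ a1 a2)) =
      A.cmap2 id (circ a1) (\<theta> a2 + A.cflip (\<theta> a2)) + A.cmap2 id (circ a2) (\<theta> a1 + A.cflip (\<theta> a1))
      - A.cmap2 (ast a1) id (\<nu> a2 - A.cflip (\<nu> a2)) - A.cmap2 (ast a2) id (\<nu> a1 - A.cflip (\<nu> a1))"
proof (rule biadd_eqI[where x = a1 and y = a2], goal_cases)
  case (3 p1 c1 p2 c2 b1 b2 l)
  show ?case
    by (simp only: axiom_rules nu_add 3)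
      (simp add: scalar_rules B.form_four[where a = b1 and b = b2 and c = c1 and d = c2]
        symmetry_forms[OF 3, of p2 p1] 3 algebra_simps)
qed (intro axiom_intros)+

lemma compat6: "\<theta> (circ a1 a2) =
      A.cmap2 (circ a1) id (\<theta> a2) - A.cmap2 id (\<lambda>b. ast b a2) (\<nu> a1 - A.cflip (\<nu> a1))
      + A.cmap2 id (ast a1) (\<nu> a2) + A.cmap2 (circ a2 - (\<lambda>b. circ b a2)) id (\<theta> a1 + A.cflip (\<theta> a1))"
proof (rule biadd_eqI[where x = a1 and y = a2], goal_cases)
  case (3 p1 c1 p2 c2 b1 b2 l)
  show ?case
    by (simp only: axiom_rules nu_add 3)
      (simp add: scalar_rules B.form_four[where a = b1 and b = b2 and c = c1 and d = c2]
        symmetry_forms[OF 3, of p2 p1] 3 algebra_simps)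
qed (intro axiom_intros)+

lemma compat7: "\<nu> (ast a1 a2 + ast a2 a1) =
      A.cmap2 id (ast a1 + (\<lambda>b. ast b a1)) (\<nu> a2) + A.cmap2 (ast a1 + (\<lambda>b. ast b a1)) id (A.cflip (\<nu> a2))
      + A.cmap2 id (circ a2 - (\<lambda>b. circ b a2)) (\<theta> a1) + A.cmap2 (circ a2 - (\<lambda>b. circ b a2)) id (A.cflip (\<theta> a1))"
proof (rule biadd_eqI[where x = a1 and y = a2], goal_cases)
  case (3 p1 c1 p2 c2 b1 b2 l)
  show ?case
    by (simp only: axiom_rules nu_add 3)
      (simp add: scalar_rules B.form_four[where a = b1 and b = b2 and c = c1 and d = c2]
        symmetry_forms[OF 3, of p2 p1] 3 algebra_simps)
qed (intro axiom_intros)+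

lemma completed_dpp_bialgebra_A: "completed_dpp_bialgebra sA grA circ ast \<nu> \<theta>"
proof unfold_locales
  show "A.cmap2 (\<lambda>b. circ b a1) id (\<nu> a2) = A.cflip (A.cmap2 (\<lambda>b. circ b a2) id (\<nu> a1))" for a1 a2
    by (simp add: R_nu cflip_zero)
  show "A.cflip (A.cmap2 (\<lambda>b. ast b a2) id (\<theta> a1)) = A.cmap2 (\<lambda>b. ast b a1) id (\<theta> a2)" for a1 a2
    by (simp add: R'_theta cflip_zero)
qed (rule perm2 perm3 leib2 compat1 compat2 compat3 compat4 compat5 compat6 compat7)+

sublocale H: completed_dpp_bialgebra sA grA circ ast \<nu> \<theta>
  by (rule completed_dpp_bialgebra_A)

end

section \<open>The coboundary structure\<close>

context affinization_algebra
begin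

text \<open>Written with \<open>bullet\<close> so that \<open>co_bullet\<close> gives its values at
  once; \<open>lift_eq_formal_sum\<close> identifies it with the formal sum of the theorem.\<close>

definition lift :: "('p, 'k) tensor2 \<Rightarrow> ('a, 'k) ctensor2" where
  "lift r = bullet sA tens r B.casimir"

context
  fixes r assumes r: "r \<in> P.tprod UNIV UNIV"
begin

lemma lift_in: "lift r \<in> A.ctensor"
  unfolding lift_def by (rule bullet_in[OF r B.casimir_in])

lemma co_lift: "P.bil l \<Longrightarrow> co (lift r) b b' l = \<omega> b' b * r l"
  unfolding lift_def by (simp add: co_bullet[OF r B.casimir_in] B.form_hat_eq_ev B.ev_casimir)

text \<open>Exchanging the legs exchanges the arguments of \<open>\<omega>\<close> in
  \<open>co_lift\<close>, whence the sign.\<close>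

lemma lift_flip: "A.cflip (lift r) = - lift (P.flip r)"
proof (rule ctensor_co_eqI)
  have fr: "P.flip r \<in> P.tprod UNIV UNIV" by (rule P.flip_in[OF r P.subspace_UNIV])
  show "A.cflip (lift r) \<in> A.ctensor" by (rule A.cflip_in[OF lift_in])
  have "lift (P.flip r) \<in> A.ctensor"
    unfolding lift_def by (rule bullet_in[OF fr B.casimir_in])
  then show "- lift (P.flip r) \<in> A.ctensor" by (rule A.ctensor_minus)
  fix b b' l assume l: "P.bil l"
  have "co (lift (P.flip r)) b b' l = \<omega> b' b * P.flip r l"
    unfolding lift_def by (simp add: co_bullet[OF fr B.casimir_in l] B.form_hat_eq_ev B.ev_casimir)
  then have "co (- lift (P.flip r)) b b' l = - (\<omega> b' b * r (\<lambda>x y. l y x))"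
    by (simp add: co_minus[OF l \<open>lift (P.flip r) \<in> A.ctensor\<close>] P.flip_apply[OF l])
  moreover have "co (A.cflip (lift r)) b b' l = \<omega> b b' * r (\<lambda>x y. l y x)"
    by (simp add: co_cflip[OF l lift_in] co_lift[OF P.bil_swap[OF l]])
  ultimately show "co (A.cflip (lift r)) b b' l = co (- lift (P.flip r)) b b' l"
    using B.form_skew[of b b'] by simp
qed

end

lemma lift_add:
  assumes "r \<in> P.tprod UNIV UNIV" "s \<in> P.tprod UNIV UNIV"
  shows "lift (r + s) = lift r + lift s"
  by (rule ctensor_co_eqI)
    (use assms in \<open>simp_all add: lift_in P.tprod_add A.ctensor_add co_lift co_add algebra_simps\<close>)

lemma lift_minus:
  assumes "r \<in> P.tprod UNIV UNIV"
  shows "lift (- r) = - lift r"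
  by (rule ctensor_co_eqI)
    (use assms in \<open>simp_all add: lift_in P.tprod_minus A.ctensor_minus co_lift co_minus\<close>)

lemma nu_of_tfam:
  assumes s: "s \<in> A.ctensor"
  shows "tfam (D.nu_of s)" "tfam (D.theta_of s)"
proof -
  have op: "opfam T \<Longrightarrow> tfam (\<lambda>a. A.cmap2 (T a) id s)" "opfam T \<Longrightarrow> tfam (\<lambda>a. A.cmap2 id (T a) s)" for T
    using s by (auto simp: opfam_def tfam_def A.cmap2_in A.locfin_id A.cmap2_add_left A.cmap2_add_right)
  have "tfam (\<lambda>a. A.cmap2 id (\<lambda>b. circ b a) s + A.cmap2 ((\<lambda>b. circ b a) - circ a) id s)"
    by (intro tfam_rules op opfam_rules)
  then show "tfam (D.nu_of s)" unfolding D.nu_of_def[abs_def] .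
  have "tfam (\<lambda>a. A.cmap2 (ast a + (\<lambda>b. ast b a)) id s - A.cmap2 id (\<lambda>b. ast b a) s)"
    by (intro tfam_rules op opfam_rules)
  then show "tfam (D.theta_of s)" unfolding D.theta_of_def[abs_def] .
qed

lemma tfam_eqI:
  assumes "tfam F" "tfam G" "\<And>p c b b' l. P.bil l \<Longrightarrow> co (F (tens p c)) b b' l = co (G (tens p c)) b b' l"
  shows "F = G"
proof
  fix a show "F a = G a"
  proof (induction a rule: tens_induct)
    case (tens p b)
    show ?case by (rule ctensor_co_eqI) (use assms in \<open>auto simp: tfam_def\<close>)
  next
    case (add x y)
    then show ?case using assms by (simp add: tfam_def)
  qed
qed

text \<open>After passing to adjoints, both terms of \<open>nu_of\<close> and both terms of
  \<open>theta_of\<close> have the coefficient \<open>\<omega> (b \<odot> b') c\<close> up to sign.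
  The signs that remain are the minus in \<open>Delta_of\<close> and the plus in
  \<open>delta_of\<close>.\<close>

lemma co_nu_of_lift:
  assumes r: "r \<in> P.tprod UNIV UNIV" and l: "P.bil l"
  shows "co (D.nu_of (lift r) (tens p c)) b b' l = \<omega> (b \<odot> b') c * P.Delta_of r p l"
    and "co (D.theta_of (lift r) (tens p c)) b b' l = \<omega> (b \<odot> b') c * P.delta_of r p l"
proof -
  have 1: "\<omega> (c \<odot> b' - b' \<odot> c) b = \<omega> (b \<odot> b') c"
    using B.form_R[of b' b c] B.form_alternate[of b' b c] B.form_skew[of c "b \<odot> b'"] by simp
  have 2: "\<omega> b' (b \<odot> c) = \<omega> (b \<odot> b') c" by (rule B.form_L)
  note rules = co_add co_diff A.cmap2_in lift_in[OF r] A.locfin_id locfin_ops A.locfin_add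
    A.locfin_diff co_left[OF adj_RL] co_right[OF adj_R] co_left[OF adj_L'R'] co_right[OF adj_R'] l
    co_lift[OF r] P.bil_mul P.bil_brk
  have "co (D.nu_of (lift r) (tens p c)) b b' l =
      \<omega> (c \<odot> b' - b' \<odot> c) b * r (\<lambda>x y. l x (p \<cdot> y)) + \<omega> b' (- (b \<odot> c)) * r (\<lambda>x y. l (p \<cdot> x) y)"
    unfolding D.nu_of_def by (simp only: rules)
  then show "co (D.nu_of (lift r) (tens p c)) b b' l = \<omega> (b \<odot> b') c * P.Delta_of r p l"
    unfolding 1 by (simp add: 2 B.form_diff P.Delta_of_def P.map2_apply[OF l] algebra_simps)
  have "co (D.theta_of (lift r) (tens p c)) b b' l =
      \<omega> b' (b \<odot> c) * r (\<lambda>x y. l (brk p x) y) - \<omega> (b' \<odot> c - c \<odot> b') b * r (\<lambda>x y. l x (brk p y))"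
    unfolding D.theta_of_def by (simp only: rules)
  moreover have "\<omega> (b' \<odot> c - c \<odot> b') b = - \<omega> (c \<odot> b' - b' \<odot> c) b"
    by (simp add: B.form_diff)
  then have "\<omega> (b' \<odot> c - c \<odot> b') b = - \<omega> (b \<odot> b') c"
    by (simp only: 1)
  ultimately show "co (D.theta_of (lift r) (tens p c)) b b' l = \<omega> (b \<odot> b') c * P.delta_of r p l"
    by (simp add: 2 P.delta_of_def P.map2_apply[OF l] algebra_simps)
qed

lemma dp_invariant_lift:
  assumes r: "r \<in> P.tprod UNIV UNIV" and inv: "P.poi_invariant r"
  shows "D.dp_invariant (lift r)"
proof -
  have z: "tfam (\<lambda>_. 0)" by (simp add: tfam_def A.ctensor_zero)
  have "D.nu_of (lift r) = (\<lambda>_. 0)"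
    by (rule tfam_eqI[OF nu_of_tfam(1)[OF lift_in[OF r]] z])
      (use inv in \<open>simp add: co_nu_of_lift[OF r] co_zero P.poi_invariant_def\<close>)
  moreover have "D.theta_of (lift r) = (\<lambda>_. 0)"
    by (rule tfam_eqI[OF nu_of_tfam(2)[OF lift_in[OF r]] z])
      (use inv in \<open>simp add: co_nu_of_lift[OF r] co_zero P.poi_invariant_def\<close>)
  ultimately show ?thesis by (simp add: D.dp_invariant_def)
qed

text \<open>An index \<open>u\<close> contributes to degree \<open>k\<close> of the first leg only
  if it lies in the finite set \<open>idx k\<close>. This gives local finiteness and leaves the
  finite sum that occurs in the Casimir element.\<close>

lemma lift_eq_formal_sum:
  fixes x y :: "'i \<Rightarrow> 'p"
  assumes I: "finite I"
  defines "T \<equiv> lift_terms sA grA tens x y e f"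
  shows "locally_finite (I \<times> \<Omega>) T"
    and "formal_sum (I \<times> \<Omega>) T = lift (\<Sum>i\<in>I. P.pure2 (x i) (y i))"
proof -
  have T: "T (i, u) (k, l) = A.pure2 (tens (x i) (B.hcomp k (e u))) (tens (y i) (B.hcomp l (f u)))"
    for i u k l
    by (simp add: T_def lift_terms_def A.cpure2_def hcomp_tens)
  have pure_zero: "A.pure2 0 z = 0" for z
    by (simp add: A.pure2_def fun_eq_iff A.bil_diff)
  have out: "T (i, u) (k, l) = 0" if u: "u \<in> \<Omega>" "u \<notin> B.idx k" for i u k l
  proof -
    obtain j where j: "u \<in> B.idx j" using B.idx_ex[OF u(1)] by blast
    then have "B.hcomp k (e u) = 0" using u B.hcomp_hom[of "e u" j k] by (auto simp: B.idx_def)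
    then show ?thesis by (simp add: T tens_diff pure_zero)
  qed
  have sub: "I \<times> B.idx k \<subseteq> I \<times> \<Omega>" for k by (auto simp: B.idx_def)
  have fin: "finite (I \<times> B.idx k)" for k using I B.finite_idx by simp
  show "locally_finite (I \<times> \<Omega>) T"
    unfolding locally_finite_def
  proof
    fix \<kappa> :: "int \<times> int"
    obtain k l where \<kappa>: "\<kappa> = (k, l)" by (cases \<kappa>)
    have "{j \<in> I \<times> \<Omega>. T j \<kappa> \<noteq> 0} \<subseteq> I \<times> B.idx k" using out \<kappa> by auto
    then show "finite {j \<in> I \<times> \<Omega>. T j \<kappa> \<noteq> 0}" using fin finite_subset by blast
  qed
  show "formal_sum (I \<times> \<Omega>) T = lift (\<Sum>i\<in>I. P.pure2 (x i) (y i))"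
  proof (intro ext)
    fix \<kappa> :: "int \<times> int" and \<beta>
    obtain k l where \<kappa>: "\<kappa> = (k, l)" by (cases \<kappa>)
    have "formal_sum (I \<times> \<Omega>) T \<kappa> = (\<Sum>j\<in>I \<times> B.idx k. T j \<kappa>)"
      by (rule formal_sum_eq[OF fin _ sub]) (use out \<kappa> in auto)
    then have "formal_sum (I \<times> \<Omega>) T \<kappa> \<beta> = (\<Sum>(i, u)\<in>I \<times> B.idx k. T (i, u) (k, l) \<beta>)"
      by (simp add: sum_fun_apply \<kappa>)
    also have "\<dots> = (\<Sum>i\<in>I. \<Sum>u\<in>B.idx k. T (i, u) (k, l) \<beta>)"
      by (simp add: sum.cartesian_product)
    also have "\<dots> = (\<Sum>i\<in>I. \<Sum>u\<in>B.idx k.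
        A.pure2 (tens (x i) (e u)) (tens (y i) (B.hcomp l (f u))) \<beta>)"
      by (intro sum.cong refl) (simp add: T B.idx_def B.hcomp_hom[of _ k k])
    finally have 1: "formal_sum (I \<times> \<Omega>) T \<kappa> \<beta> = (\<Sum>i\<in>I. \<Sum>u\<in>B.idx k.
        A.pure2 (tens (x i) (e u)) (tens (y i) (B.hcomp l (f u))) \<beta>)" .
    have r: "(\<Sum>i\<in>I. P.pure2 (x i) (y i)) \<in> P.tprod UNIV UNIV"
      by (intro P.tprod_sum P.tprod_pure2) auto
    show "formal_sum (I \<times> \<Omega>) T \<kappa> \<beta> = lift (\<Sum>i\<in>I. P.pure2 (x i) (y i)) \<kappa> \<beta>"
    proof (cases "A.bil \<beta>")
      case True
      have "lift (\<Sum>i\<in>I. P.pure2 (x i) (y i)) \<kappa> \<beta> =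
          (\<Sum>i\<in>I. P.pure2 (x i) (y i)) (\<lambda>p q. B.casimir \<kappa> (\<lambda>b b'. \<beta> (tens p b) (tens q b')))"
        unfolding lift_def by (rule bullet_apply[OF r B.casimir_in True])
      also have "(\<lambda>p q. B.casimir \<kappa> (\<lambda>b b'. \<beta> (tens p b) (tens q b'))) =
          (\<lambda>p q. \<Sum>u\<in>B.idx k. \<beta> (tens p (e u)) (tens q (B.hcomp l (f u))))"
      proof (intro ext)
        fix p q
        have b: "B.bil (\<lambda>b b'. \<beta> (tens p b) (tens q b'))"
          using True unfolding A.bil_iff B.bil_iff by (auto simp: tens_lin)
        \<comment> \<open>Unless \<open>k + l + m = 0\<close>, the projection to degree
          \<open>l\<close> kills \<open>f u\<close>; this reproduces the case distinction in
          \<open>casimir\<close>.\<close>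
        have f: "B.hcomp l (f u) = (if k + l + m = 0 then f u else 0)" if "u \<in> B.idx k" for u
          using B.hcomp_hom[OF B.f_deg[OF that], of l] by auto
        show "B.casimir \<kappa> (\<lambda>b b'. \<beta> (tens p b) (tens q b')) =
          (\<Sum>u\<in>B.idx k. \<beta> (tens p (e u)) (tens q (B.hcomp l (f u))))"
          by (simp add: \<kappa> B.casimir_def B.sum_pure2_apply[OF b] f tens_diff A.bil_diff[OF True] cong: sum.cong)
      qed
      finally show ?thesis
        by (simp add: 1 A.pure2_apply[OF True] P.sum_pure2_apply P.bil_sum bil_tens[OF True])
    next
      case False
      then show ?thesis
        by (simp add: 1 A.pure2_def A.ctensor_not_bil[OF lift_in[OF r]])
    qed
  qed
qed

end

section \<open>The double sums of the Yang-Baxter equation\<close>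

lemma sum3_rotate: "(\<Sum>a\<in>I. \<Sum>c\<in>K. \<Sum>u\<in>A. g a c u) = (\<Sum>u\<in>A. \<Sum>a\<in>I. \<Sum>c\<in>K. g a c u)"
  by (rule trans[OF sum.cong[OF refl sum.swap] sum.swap])

lemma sum5_swap:
  "(\<Sum>a\<in>I. \<Sum>c\<in>K. \<Sum>u\<in>A. \<Sum>v\<in>B. \<Sum>w\<in>C. h a c u v w) = (\<Sum>u\<in>A. \<Sum>v\<in>B. \<Sum>w\<in>C. \<Sum>a\<in>I. \<Sum>c\<in>K. h a c u v w)"
  by (rule trans[OF sum3_rotate], rule sum.cong[OF refl], rule trans[OF sum3_rotate],
      rule sum.cong[OF refl], rule sum3_rotate)

context tensor_powers
begin

text \<open>Linearity in four arguments, in the shape in which it is consumed when two tensors are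
  evaluated one after the other.\<close>

definition quadl :: "('v \<Rightarrow> 'v \<Rightarrow> 'v \<Rightarrow> 'v \<Rightarrow> 'k) \<Rightarrow> bool" where
  "quadl H \<longleftrightarrow> (\<forall>x y. bil (H x y)) \<and> (\<forall>x' y'. bil (\<lambda>x y. H x y x' y'))"

lemma quadl_inner:
  assumes H: "quadl H" and t: "t \<in> tprod V W"
  shows "bil (\<lambda>x y. t (H x y))"
proof -
  have b: "bil (H x y)" for x y using H by (simp add: quadl_def)
  have "H (x + x') y = (\<lambda>x'' y''. H x y x'' y'' + H x' y x'' y'')"
    "H x (y + y') = (\<lambda>x'' y''. H x y x'' y'' + H x y' x'' y'')"
    "H (scale c x) y = (\<lambda>x'' y''. c * H x y x'' y'')"
    "H x (scale c y) = (\<lambda>x'' y''. c * H x y x'' y'')" for x x' y y' c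
    using H by (simp_all add: quadl_def bil_iff fun_eq_iff)
  then show ?thesis
    unfolding bil_iff by (auto simp: tprod_add_form[OF t] tprod_scale_form[OF t] b)
qed

lemma quadl_add: "quadl H \<Longrightarrow> quadl K \<Longrightarrow> quadl (\<lambda>x y x' y'. H x y x' y' + K x y x' y')"
  and quadl_diff: "quadl H \<Longrightarrow> quadl K \<Longrightarrow> quadl (\<lambda>x y x' y'. H x y x' y' - K x y x' y')"
  by (auto simp: quadl_def bil_add bil_minus)

lemma quadl_zero: "quadl (\<lambda>_ _ _ _. 0)"
  by (simp add: quadl_def)

end

context graded_space
begin

definition qform :: "('a \<Rightarrow> 'a \<Rightarrow> 'a \<Rightarrow> 'a \<Rightarrow> ('a, 'k) ctensor3) \<Rightarrow> bool" where
  "qform G \<longleftrightarrow> (\<forall>\<kappa> \<beta>. quadl (\<lambda>x y x' y'. G x y x' y' \<kappa> \<beta>))"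

end

context graded_dpp_algebra
begin

text \<open>\<open>DPYBE\<close> sums a combination of four monomials but requires convergence of
  each monomial. In a fixed degree, the union of the two supports is a finite index set valid for
  both summands and for their combination.\<close>

lemma double_sum_combine:
  assumes s: "s \<in> ctensor" and G: "qform G" "double_summable s G" and K: "qform K" "double_summable s K"
  shows double_sum_add: "double_sum s (\<lambda>x y x' y'. G x y x' y' + K x y x' y') = double_sum s G + double_sum s K"
      "double_summable s (\<lambda>x y x' y'. G x y x' y' + K x y x' y')"
      "qform (\<lambda>x y x' y'. G x y x' y' + K x y x' y')"
    and double_sum_diff: "double_sum s (\<lambda>x y x' y'. G x y x' y' - K x y x' y') = double_sum s G - double_sum s K"
      "double_summable s (\<lambda>x y x' y'. G x y x' y' - K x y x' y')"
      "qform (\<lambda>x y x' y'. G x y x' y' - K x y x' y')"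
proof -
  show "qform (\<lambda>x y x' y'. G x y x' y' + K x y x' y')" "qform (\<lambda>x y x' y'. G x y x' y' - K x y x' y')"
    using G(1) K(1) by (auto simp: qform_def intro: quadl_add quadl_diff)
  have b: "bil (\<lambda>x' y'. G x y x' y' \<kappa> \<beta>)" "bil (\<lambda>x' y'. K x y x' y' \<kappa> \<beta>)"
    "bil (\<lambda>x y. s kl (\<lambda>x' y'. G x y x' y' \<kappa> \<beta>))" "bil (\<lambda>x y. s kl (\<lambda>x' y'. K x y x' y' \<kappa> \<beta>))"
    for x y \<kappa> \<beta> kl
  proof -
    have q: "quadl (\<lambda>x y x' y'. G x y x' y' \<kappa> \<beta>)" "quadl (\<lambda>x y x' y'. K x y x' y' \<kappa> \<beta>)"
      using G(1) K(1) unfolding qform_def by blast+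
    show "bil (\<lambda>x' y'. G x y x' y' \<kappa> \<beta>)" "bil (\<lambda>x' y'. K x y x' y' \<kappa> \<beta>)"
      using q by (auto simp: quadl_def)
    show "bil (\<lambda>x y. s kl (\<lambda>x' y'. G x y x' y' \<kappa> \<beta>))" "bil (\<lambda>x y. s kl (\<lambda>x' y'. K x y x' y' \<kappa> \<beta>))"
      by (rule quadl_inner[OF q(1) ctensorD'[OF s]], rule quadl_inner[OF q(2) ctensorD'[OF s]])
  qed
  have terms: "double_terms s (\<lambda>x y x' y'. G x y x' y' + K x y x' y') j \<kappa> =
      double_terms s G j \<kappa> + double_terms s K j \<kappa>"
    "double_terms s (\<lambda>x y x' y'. G x y x' y' - K x y x' y') j \<kappa> =
      double_terms s G j \<kappa> - double_terms s K j \<kappa>" for j \<kappa>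
    by (cases j; simp add: double_terms_def tsum2_def fun_eq_iff tprod_add_form[OF ctensorD'[OF s]]
        tprod_diff_form[OF ctensorD'[OF s]] b)+
  define S where "S \<kappa> = {j. double_terms s G j \<kappa> \<noteq> 0} \<union> {j. double_terms s K j \<kappa> \<noteq> 0}" for \<kappa>
  have fin: "finite (S \<kappa>)" for \<kappa>
    using G(2)[unfolded double_summable_def locally_finite_def, rule_format, of \<kappa>]
      K(2)[unfolded double_summable_def locally_finite_def, rule_format, of \<kappa>]
    by (simp add: S_def)
  have out: "double_terms s G j \<kappa> = 0" "double_terms s K j \<kappa> = 0" if "j \<notin> S \<kappa>" for j \<kappa>
    using that by (auto simp: S_def)
  have sums: "double_sum s G \<kappa> = (\<Sum>j\<in>S \<kappa>. double_terms s G j \<kappa>)"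
    "double_sum s K \<kappa> = (\<Sum>j\<in>S \<kappa>. double_terms s K j \<kappa>)" for \<kappa>
    unfolding double_sum_def by (rule formal_sum_eq[OF fin]; use out in auto)+
  have "double_sum s (\<lambda>x y x' y'. G x y x' y' + K x y x' y') \<kappa> =
      (\<Sum>j\<in>S \<kappa>. double_terms s G j \<kappa> + double_terms s K j \<kappa>)"
    "double_sum s (\<lambda>x y x' y'. G x y x' y' - K x y x' y') \<kappa> =
      (\<Sum>j\<in>S \<kappa>. double_terms s G j \<kappa> - double_terms s K j \<kappa>)" for \<kappa>
    unfolding double_sum_def terms[symmetric]
    by (rule formal_sum_eq[OF fin]; use out terms in auto)+
  then show
    "double_sum s (\<lambda>x y x' y'. G x y x' y' + K x y x' y') = double_sum s G + double_sum s K"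
    "double_sum s (\<lambda>x y x' y'. G x y x' y' - K x y x' y') = double_sum s G - double_sum s K"
    by (auto simp: fun_eq_iff sums sum.distrib sum_subtractf)
  have "{j. double_terms s (\<lambda>x y x' y'. G x y x' y' + K x y x' y') j \<kappa> \<noteq> 0} \<subseteq> S \<kappa>"
    "{j. double_terms s (\<lambda>x y x' y'. G x y x' y' - K x y x' y') j \<kappa> \<noteq> 0} \<subseteq> S \<kappa>" for \<kappa>
  proof -
    have "j \<in> S \<kappa>" if "double_terms s G j \<kappa> + double_terms s K j \<kappa> \<noteq> 0 \<or>
        double_terms s G j \<kappa> - double_terms s K j \<kappa> \<noteq> 0" for j
      using that out[of j \<kappa>] by (cases "j \<in> S \<kappa>") auto
    then show "{j. double_terms s (\<lambda>x y x' y'. G x y x' y' + K x y x' y') j \<kappa> \<noteq> 0} \<subseteq> S \<kappa>"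
      "{j. double_terms s (\<lambda>x y x' y'. G x y x' y' - K x y x' y') j \<kappa> \<noteq> 0} \<subseteq> S \<kappa>"
      unfolding terms by blast+
  qed
  from finite_subset[OF this(1) fin] finite_subset[OF this(2) fin]
  show "double_summable s (\<lambda>x y x' y'. G x y x' y' + K x y x' y')"
    "double_summable s (\<lambda>x y x' y'. G x y x' y' - K x y x' y')"
    unfolding double_summable_def locally_finite_def by simp_all
qed

end

context quadratic_dual_bases
begin

text \<open>Summation over the dual bases in one degree hides a projection to that degree. The
  degree assumption on \<open>b\<close> makes the projection harmless, so two values of
  \<open>\<omega>\<close> merge into one.\<close>

lemma contract:
  shows contract_e: "b \<in> gr (- m - i) \<Longrightarrow> (\<Sum>a\<in>idx i. \<omega> b (e a) * \<omega> x (f a)) = \<omega> x b"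
    and contract_f: "b \<in> gr i \<Longrightarrow> (\<Sum>a\<in>idx i. \<omega> x (e a) * \<omega> b (f a)) = \<omega> b x"
proof -
  have *: "(\<Sum>a\<in>idx i. \<omega> y (e a) * \<omega> z (f a)) = \<omega> (hcomp i z) y" for y z
  proof -
    have "\<omega> (hcomp i z) y = - \<omega> y (hcomp i z)" by (rule form_skew)
    also have "\<dots> = (\<Sum>a\<in>idx i. \<omega> y (e a) * - \<omega> (f a) z)"
      by (simp add: hcomp_expand form_diff form_lin sum_negf mult.commute)
    also have "\<dots> = (\<Sum>a\<in>idx i. \<omega> y (e a) * \<omega> z (f a))"
      by (intro sum.cong refl) (simp add: form_skew[of z])
    finally show ?thesis by simp
  qed
  show "b \<in> gr (- m - i) \<Longrightarrow> (\<Sum>a\<in>idx i. \<omega> b (e a) * \<omega> x (f a)) = \<omega> x b"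
    using hcomp_form[of b i x] form_skew[of "hcomp i x" b] form_skew[of b x]
    by (simp add: * hcomp_hom)
  show "b \<in> gr i \<Longrightarrow> (\<Sum>a\<in>idx i. \<omega> x (e a) * \<omega> b (f a)) = \<omega> b x"
    by (simp add: * hcomp_hom)
qed

text \<open>The eight monomials of the DPYBE have only three coefficients up to sign, and this is
  the linear relation between them.\<close>

lemma form_three:
  "\<omega> b2 (b1 \<odot> b3 - b3 \<odot> b1) = \<omega> b3 (b1 \<odot> b2 - b2 \<odot> b1) - \<omega> (b2 \<odot> b3 - b3 \<odot> b2) b1"
proof -
  have "\<omega> (b2 \<odot> b3 - b3 \<odot> b2) b1 = - (\<omega> b1 (b2 \<odot> b3) - \<omega> b1 (b3 \<odot> b2))"
    by (simp add: form_skew[of _ b1] form_diff)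
  also have "\<dots> = - \<omega> b2 (b1 \<odot> b3)" by (simp only: form_cyclic)
  finally show ?thesis
    using form_alternate[of b3 b1 b2] form_alternate[of b3 b2 b1] form_alternate[of b2 b3 b1]
      form_cyclic[of b1 b2 b3]
    by (simp add: form_diff algebra_simps)
qed

end

context affinization_algebra
begin

text \<open>The double sum of a monomial \<open>G\<close> factors: \<open>C\<close> is what the two
  Casimir elements contribute, tested at dual basis vectors, and \<open>T\<close> is the
  corresponding monomial over \<open>P\<close>, evaluated on two copies of \<open>r\<close>.\<close>

definition dterm ::
    "('p, 'k) tensor2 \<Rightarrow> ('a \<Rightarrow> 'a \<Rightarrow> 'a \<Rightarrow> 'a \<Rightarrow> ('a, 'k) ctensor3) \<Rightarrow> ('b \<Rightarrow> 'b \<Rightarrow> 'b \<Rightarrow> 'k) \<Rightarrow>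
     (('p \<Rightarrow> 'p \<Rightarrow> 'p \<Rightarrow> 'k) \<Rightarrow> 'p \<Rightarrow> 'p \<Rightarrow> 'p \<Rightarrow> 'p \<Rightarrow> 'k) \<Rightarrow> bool" where
  "dterm r G C T \<longleftrightarrow> A.qform G \<and> D.double_summable (lift r) G \<and>
    (\<forall>\<kappa>1 \<kappa>2 \<kappa>3 \<beta>. D.double_sum (lift r) G (\<kappa>1, \<kappa>2, \<kappa>3) \<beta> = (if trilinear_form sA \<beta> then
      \<Sum>u\<in>B.idx \<kappa>1. \<Sum>v\<in>B.idx \<kappa>2. \<Sum>w\<in>B.idx \<kappa>3. C (f u) (f v) (f w) *
        r (\<lambda>p q. r (T (tri3 \<beta> u v w) p q)) else 0))"

lemma dtermD:
  assumes "dterm r G C T"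
  shows "A.qform G" "D.double_summable (lift r) G"
    and "D.double_sum (lift r) G (\<kappa>1, \<kappa>2, \<kappa>3) \<beta> = (if trilinear_form sA \<beta> then
      \<Sum>u\<in>B.idx \<kappa>1. \<Sum>v\<in>B.idx \<kappa>2. \<Sum>w\<in>B.idx \<kappa>3. C (f u) (f v) (f w) *
        r (\<lambda>p q. r (T (tri3 \<beta> u v w) p q)) else 0)"
  using assms by (auto simp: dterm_def)

context
  fixes r assumes r: "r \<in> P.tprod UNIV UNIV"
begin

lemma lift_component:
  assumes "A.bil \<gamma>"
  shows "lift r (i, k) \<gamma> =
    (if i + k + m = 0 then \<Sum>a\<in>B.idx i. r (\<lambda>p q. \<gamma> (tens p (e a)) (tens q (f a))) else 0)"
proof -
  have b: "B.bil (\<lambda>b b'. \<gamma> (tens p b) (tens q b'))" for p q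
    using assms unfolding A.bil_iff B.bil_iff by (auto simp: tens_lin)
  have "lift r (i, k) \<gamma> = r (\<lambda>p q. B.casimir (i, k) (\<lambda>b b'. \<gamma> (tens p b) (tens q b')))"
    unfolding lift_def by (rule bullet_apply[OF r B.casimir_in assms])
  also have "\<dots> = (if i + k + m = 0 then r (\<lambda>p q. \<Sum>a\<in>B.idx i. \<gamma> (tens p (e a)) (tens q (f a))) else 0)"
    by (simp add: B.casimir_def B.sum_pure2_apply[OF b] P.tprod_zero_form[OF r])
  finally show ?thesis
    by (simp add: P.tprod_sum_form[OF r bil_tens[OF assms]])
qed

lemma quadl_tens: "A.quadl H \<Longrightarrow>
    P.quadl (\<lambda>p q p' q'. H (tens p b) (tens q c) (tens p' b') (tens q' c'))"
  unfolding A.quadl_def P.quadl_def A.bil_iff P.bil_iff by (auto simp: tens_lin)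

lemma lift_component2:
  assumes H: "A.quadl H"
  shows "lift r (i, j) (\<lambda>x y. lift r (k, l) (H x y)) =
    (if i + j + m = 0 \<and> k + l + m = 0 then \<Sum>a\<in>B.idx i. \<Sum>c\<in>B.idx k. r (\<lambda>p q. r (\<lambda>p' q'.
      H (tens p (e a)) (tens q (f a)) (tens p' (e c)) (tens q' (f c)))) else 0)"
proof -
  have b: "A.bil (H x y)" for x y using H by (simp add: A.quadl_def)
  show ?thesis
    by (subst lift_component[OF A.quadl_inner[OF H A.ctensorD'[OF lift_in[OF r]]]])
      (simp add: lift_component[OF b] P.tprod_zero_form[OF r] P.tprod_sum_form[OF r]
        P.quadl_inner[OF quadl_tens[OF H] r])
qed

text \<open>
  One term \<open>X \<otimes> Y \<otimes> Z\<close> of the DPYBE, where \<open>X, Y, Z\<close> are monomials in \<open>x, y, x', y'\<close>: to the degree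
  \<open>(\<kappa>1, \<kappa>2, \<kappa>3)\<close> only the components of \<open>lift r\<close> of degrees \<open>i0\<close> and \<open>k0\<close> contribute.
\<close>
context
  fixes G X Y Z XP YP ZP XB YB ZB C and i0 k0 :: "int \<Rightarrow> int \<Rightarrow> int \<Rightarrow> int"
  assumes G: "G = (\<lambda>x y x' y'. A.cpure3 (X x y x' y') (Y x y x' y') (Z x y x' y'))"
    and bilA: "\<And>\<beta>. trilinear_form sA \<beta> \<Longrightarrow>
      A.quadl (\<lambda>x y x' y'. \<beta> (X x y x' y') (Y x y x' y') (Z x y x' y'))"
    and bilP: "\<And>l. trilinear_form sP l \<Longrightarrow>
      P.quadl (\<lambda>x y x' y'. l (XP x y x' y') (YP x y x' y') (ZP x y x' y'))"
    and tens_rules: "\<And>p q p' q' b c b' c'.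
      X (tens p b) (tens q c) (tens p' b') (tens q' c') = tens (XP p q p' q') (XB b c b' c')"
      "\<And>p q p' q' b c b' c'.
      Y (tens p b) (tens q c) (tens p' b') (tens q' c') = tens (YP p q p' q') (YB b c b' c')"
      "\<And>p q p' q' b c b' c'.
      Z (tens p b) (tens q c) (tens p' b') (tens q' c') = tens (ZP p q p' q') (ZB b c b' c')"
    and supp: "\<And>\<kappa>1 \<kappa>2 \<kappa>3 i k x y x' y'. x \<in> grA i \<Longrightarrow> y \<in> grA (- m - i) \<Longrightarrow> x' \<in> grA k \<Longrightarrow> y' \<in> grA (- m - k) \<Longrightarrow>
      (i, k) \<noteq> (i0 \<kappa>1 \<kappa>2 \<kappa>3, k0 \<kappa>1 \<kappa>2 \<kappa>3) \<Longrightarrow> A.hcomp \<kappa>1 (X x y x' y') = 0 \<or>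
        A.hcomp \<kappa>2 (Y x y x' y') = 0 \<or> A.hcomp \<kappa>3 (Z x y x' y') = 0"
    and coeff: "\<And>\<kappa>1 \<kappa>2 \<kappa>3 b1 b2 b3.
      b1 \<in> grB (- m - \<kappa>1) \<Longrightarrow> b2 \<in> grB (- m - \<kappa>2) \<Longrightarrow> b3 \<in> grB (- m - \<kappa>3) \<Longrightarrow>
      (\<Sum>a\<in>B.idx (i0 \<kappa>1 \<kappa>2 \<kappa>3). \<Sum>c\<in>B.idx (k0 \<kappa>1 \<kappa>2 \<kappa>3). \<omega> b1 (XB (e a) (f a) (e c) (f c)) *
        \<omega> b2 (YB (e a) (f a) (e c) (f c)) * \<omega> b3 (ZB (e a) (f a) (e c) (f c))) = C b1 b2 b3"
begin

lemma monomial_qform: "A.qform G"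
  unfolding A.qform_def
proof (intro allI)
  fix \<kappa> :: "int \<times> int \<times> int" and \<beta> :: "'a \<Rightarrow> 'a \<Rightarrow> 'a \<Rightarrow> 'k"
  obtain \<kappa>1 \<kappa>2 \<kappa>3 where \<kappa>: "\<kappa> = (\<kappa>1, \<kappa>2, \<kappa>3)" by (cases \<kappa>)
  show "A.quadl (\<lambda>x y x' y'. G x y x' y' \<kappa> \<beta>)"
  proof (cases "trilinear_form sA \<beta>")
    case True
    then have "trilinear_form sA (\<lambda>x y z. \<beta> (A.hcomp \<kappa>1 x) (A.hcomp \<kappa>2 y) (A.hcomp \<kappa>3 z))"
      by (auto simp: A.tri_iff A.hcomp_add A.hcomp_scale)
    from bilA[OF this] show ?thesis using True by (simp add: G \<kappa> A.cpure3_def A.pure3_def)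
  qed (simp add: G \<kappa> A.cpure3_def A.pure3_def A.quadl_zero)
qed

lemma monomial_term_zero:
  assumes "(ij, kl) \<noteq> ((i0 \<kappa>1 \<kappa>2 \<kappa>3, - m - i0 \<kappa>1 \<kappa>2 \<kappa>3), (k0 \<kappa>1 \<kappa>2 \<kappa>3, - m - k0 \<kappa>1 \<kappa>2 \<kappa>3))"
  shows "D.double_terms (lift r) G (ij, kl) (\<kappa>1, \<kappa>2, \<kappa>3) = 0"
proof
  fix \<beta>
  obtain i j k l where ij: "ij = (i, j)" and kl: "kl = (k, l)" by (cases ij; cases kl)
  have "G x y x' y' (\<kappa>1, \<kappa>2, \<kappa>3) \<beta> = 0"
    if "(i, k) \<noteq> (i0 \<kappa>1 \<kappa>2 \<kappa>3, k0 \<kappa>1 \<kappa>2 \<kappa>3)" "x \<in> grA i" "y \<in> grA (- m - i)" "x' \<in> grA k" "y' \<in> grA (- m - k)"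
    for x y x' y'
  proof -
    have "\<beta> 0 u v = 0" "\<beta> u 0 v = 0" "\<beta> u v 0 = 0" if "trilinear_form sA \<beta>" for u v
      using that additive_zero[of "\<lambda>x. \<beta> x u v"] additive_zero[of "\<lambda>x. \<beta> u x v"] additive_zero[of "\<beta> u v"]
      by (auto simp: A.tri_iff)
    then show ?thesis
      using supp[OF that(2-5,1)] by (auto simp: G A.cpure3_def A.pure3_def)
  qed
  moreover have "tens p (e a) \<in> grA i" "tens p (f a) \<in> grA (- m - i)" if "a \<in> B.idx i" for p a i
    using that B.f_deg by (auto simp: B.idx_def intro: tens_in)
  moreover have "A.quadl (\<lambda>x y x' y'. G x y x' y' (\<kappa>1, \<kappa>2, \<kappa>3) \<beta>)"
    using monomial_qform by (simp add: A.qform_def)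
  ultimately show "D.double_terms (lift r) G (ij, kl) (\<kappa>1, \<kappa>2, \<kappa>3) \<beta> = 0 \<beta>"
    using assms
    by (auto simp: ij kl D.double_terms_def tsum2_def lift_component2 P.tprod_zero_form[OF r] intro!: sum.neutral)
qed

lemma monomial_summable: "D.double_summable (lift r) G"
  unfolding D.double_summable_def locally_finite_def
proof
  fix \<kappa> :: "int \<times> int \<times> int"
  obtain \<kappa>1 \<kappa>2 \<kappa>3 where \<kappa>: "\<kappa> = (\<kappa>1, \<kappa>2, \<kappa>3)" by (cases \<kappa>)
  have "{j \<in> UNIV. D.double_terms (lift r) G j \<kappa> \<noteq> 0} \<subseteq>
      {((i0 \<kappa>1 \<kappa>2 \<kappa>3, - m - i0 \<kappa>1 \<kappa>2 \<kappa>3), (k0 \<kappa>1 \<kappa>2 \<kappa>3, - m - k0 \<kappa>1 \<kappa>2 \<kappa>3))}"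
    using monomial_term_zero unfolding \<kappa> by fastforce
  then show "finite {j \<in> UNIV. D.double_terms (lift r) G j \<kappa> \<noteq> 0}"
    by (rule finite_subset) simp
qed

lemma monomial_sum:
  "D.double_sum (lift r) G (\<kappa>1, \<kappa>2, \<kappa>3) \<beta> = (if trilinear_form sA \<beta> then
    \<Sum>u\<in>B.idx \<kappa>1. \<Sum>v\<in>B.idx \<kappa>2. \<Sum>w\<in>B.idx \<kappa>3. C (f u) (f v) (f w) * r (\<lambda>p q. r (\<lambda>p' q'.
      tri3 \<beta> u v w (XP p q p' q') (YP p q p' q') (ZP p q p' q'))) else 0)"
proof -
  let ?i = "i0 \<kappa>1 \<kappa>2 \<kappa>3" and ?k = "k0 \<kappa>1 \<kappa>2 \<kappa>3"
  let ?j = "((?i, - m - ?i), (?k, - m - ?k))"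
  have q: "A.quadl (\<lambda>x y x' y'. G x y x' y' (\<kappa>1, \<kappa>2, \<kappa>3) \<beta>)"
    using monomial_qform by (simp add: A.qform_def)
  have "D.double_sum (lift r) G (\<kappa>1, \<kappa>2, \<kappa>3) = (\<Sum>j\<in>{?j}. D.double_terms (lift r) G j (\<kappa>1, \<kappa>2, \<kappa>3))"
    unfolding D.double_sum_def
    by (rule formal_sum_eq) (use monomial_term_zero in \<open>auto simp: split_paired_all\<close>)
  then have *: "D.double_sum (lift r) G (\<kappa>1, \<kappa>2, \<kappa>3) \<beta> = (\<Sum>a\<in>B.idx ?i. \<Sum>c\<in>B.idx ?k. r (\<lambda>p q. r (\<lambda>p' q'.
      G (tens p (e a)) (tens q (f a)) (tens p' (e c)) (tens q' (f c)) (\<kappa>1, \<kappa>2, \<kappa>3) \<beta>)))"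
    by (simp add: D.double_terms_def tsum2_def lift_component2[OF q])
  show ?thesis
  proof (cases "trilinear_form sA \<beta>")
    case True
    define c3 where "c3 u v w a c = \<omega> (f u) (XB (e a) (f a) (e c) (f c)) *
        \<omega> (f v) (YB (e a) (f a) (e c) (f c)) * \<omega> (f w) (ZB (e a) (f a) (e c) (f c))" for u v w a c
    define T where "T u v w = (\<lambda>p q p' q'. tri3 \<beta> u v w (XP p q p' q') (YP p q p' q') (ZP p q p' q'))" for u v w
    have Tq: "P.quadl (T u v w)" for u v w
      unfolding T_def by (rule bilP[OF tri3[OF True]])
    have Tb: "P.bil (T u v w p q)" for u v w p q using Tq by (simp add: P.quadl_def)
    have inner: "\<beta> (A.hcomp \<kappa>1 x) (A.hcomp \<kappa>2 y) (A.hcomp \<kappa>3 z) = (\<Sum>u\<in>B.idx \<kappa>1. \<Sum>v\<in>B.idx \<kappa>2. \<Sum>w\<in>B.idx \<kappa>3.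
        tri3 \<beta> u v w (pr (f u) x) (pr (f v) y) (pr (f w) z))" for x y z
    proof -
      have mid: "\<beta> x (\<Sum>i\<in>I. g i) y = (\<Sum>i\<in>I. \<beta> x (g i) y)" for x y and I :: "'j set" and g
        using True by (auto intro!: additive_sum[of "\<lambda>z. \<beta> x z y"] simp: A.tri_iff)
      show ?thesis
        by (simp only: hcomp_expand_A tri_sum(2)[OF True], simp only: mid, simp only: tri_sum(1)[OF True] tri3_def)
    qed
    have tri3_scale: "tri3 \<beta> u v w (sP c1 p) (sP c2 q) (sP c3 s) = c1 * c2 * c3 * tri3 \<beta> u v w p q s"
      for u v w c1 c2 c3 p q s
      using tri3[OF True] by (simp add: P.tri_iff)
    have "G (tens p (e a)) (tens q (f a)) (tens p' (e c)) (tens q' (f c)) (\<kappa>1, \<kappa>2, \<kappa>3) \<beta> =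
        (\<Sum>u\<in>B.idx \<kappa>1. \<Sum>v\<in>B.idx \<kappa>2. \<Sum>w\<in>B.idx \<kappa>3. c3 u v w a c * T u v w p q p' q')" for p q p' q' a c
      using True by (simp add: G A.cpure3_def A.pure3_def inner tens_rules pr_tens tri3_scale c3_def T_def)
    then have "D.double_sum (lift r) G (\<kappa>1, \<kappa>2, \<kappa>3) \<beta> = (\<Sum>a\<in>B.idx ?i. \<Sum>c\<in>B.idx ?k.
        \<Sum>u\<in>B.idx \<kappa>1. \<Sum>v\<in>B.idx \<kappa>2. \<Sum>w\<in>B.idx \<kappa>3. c3 u v w a c * r (\<lambda>p q. r (T u v w p q)))"
      unfolding *
      by (simp add: P.tprod_sum_form[OF r] P.tprod_scale_form[OF r] P.bil_sum P.bil_scale Tb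
          P.quadl_inner[OF Tq r])
    \<comment> \<open>The sums from the two Casimir elements move innermost, where
      \<open>coeff\<close> contracts them for fixed \<open>u\<close>, \<open>v\<close> and
      \<open>w\<close>.\<close>
    also have "\<dots> = (\<Sum>u\<in>B.idx \<kappa>1. \<Sum>v\<in>B.idx \<kappa>2. \<Sum>w\<in>B.idx \<kappa>3. \<Sum>a\<in>B.idx ?i. \<Sum>c\<in>B.idx ?k.
        c3 u v w a c * r (\<lambda>p q. r (T u v w p q)))"
      by (rule sum5_swap)
    also have "\<dots> = (\<Sum>u\<in>B.idx \<kappa>1. \<Sum>v\<in>B.idx \<kappa>2. \<Sum>w\<in>B.idx \<kappa>3. C (f u) (f v) (f w) * r (\<lambda>p q. r (T u v w p q)))"
      by (intro sum.cong refl)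
        (simp add: sum_distrib_right[symmetric] c3_def coeff B.f_deg)
    finally show ?thesis using True by (simp add: T_def)
  next
    case False
    then show ?thesis
      by (subst *) (simp add: G A.cpure3_def A.pure3_def P.tprod_zero_form[OF r])
  qed
qed

lemma dtermI: "dterm r G C (\<lambda>l p q p' q'. l (XP p q p' q') (YP p q p' q') (ZP p q p' q'))"
  unfolding dterm_def using monomial_qform monomial_summable monomial_sum by blast

end

end

end

section \<open>The monomials of the Yang-Baxter equation\<close>

lemma (in quadratic_graded_perm_algebra) form_R':
  "\<omega> (x \<odot> c) b = \<omega> (b \<odot> c - c \<odot> b) x"
  using form_R[of b x c] form_skew[of "x \<odot> c" b] by (simp add: form_diff)

lemma (in quadratic_dual_bases) contract_f':
  "b \<in> gr i \<Longrightarrow> (\<Sum>a\<in>idx i. \<omega> b (f a) * \<omega> x (e a)) = \<omega> b x"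
  using contract_f by (simp add: mult.commute)

context affinization_algebra
begin

context
  fixes r op opP
  assumes r: "r \<in> P.tprod UNIV UNIV"
    and op: "(op, opP) \<in> {(circ, mul), (ast, brk)}"
begin

text \<open>Both products have the same factor on \<open>B\<close>. One calculation of coefficients
  therefore serves \<open>circ\<close> with \<open>mul\<close> and \<open>ast\<close> with
  \<open>brk\<close>.\<close>

lemma op_tens: "op (tens p b) (tens q c) = tens (opP p q) (b \<odot> c)"
  using op by (auto simp: circ_tens ast_tens)

lemmas op_lin = circ_lin ast_lin
lemmas opP_lin = P.mul_lin P.brk_lin

text \<open>In every monomial two legs are single letters, and their degrees determine
  \<open>i\<close> and \<open>k\<close>. Here the first leg \<open>x\<close> forces
  \<open>i = \<kappa>1\<close>, and the third leg \<open>y'\<close>, of degree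
  \<open>- m - k\<close>, forces \<open>k = - m - \<kappa>3\<close>. The other monomials below are
  treated in the same way.\<close>

lemma dterm_yx':
  "dterm r (\<lambda>x y x' y'. A.cpure3 (x) (op y x') (y')) (\<lambda>b1 b2 b3. \<omega> (b2 \<odot> b3 - b3 \<odot> b2) b1) (\<lambda>l x y x' y'. l (x) (opP y x') (y'))"
proof -
  have bilA: "A.quadl (\<lambda>x y x' y'. \<beta> (x) (op y x') (y'))" if "trilinear_form sA \<beta>" for \<beta>
    using that op by (auto simp: A.quadl_def A.bil_iff A.tri_iff op_lin)
  have bilP: "P.quadl (\<lambda>x y x' y'. l (x) (opP y x') (y'))" if "trilinear_form sP l" for l
    using that op by (auto simp: P.quadl_def P.bil_iff P.tri_iff opP_lin)
  have supp: "A.hcomp \<kappa>1 (x) = 0 \<or> A.hcomp \<kappa>2 (op y x') = 0 \<or> A.hcomp \<kappa>3 (y') = 0"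
    if "x \<in> grA i" "y \<in> grA (- m - i)" "x' \<in> grA k" "y' \<in> grA (- m - k)" "(i, k) \<noteq> (\<kappa>1, - m - \<kappa>3)"
    for \<kappa>1 \<kappa>2 \<kappa>3 i k x y x' y'
    using that A.hcomp_hom[of x "i" \<kappa>1] A.hcomp_hom[of y' "- m - k" \<kappa>3]
    by auto
  have coeff: "(\<Sum>a\<in>B.idx (\<kappa>1). \<Sum>c\<in>B.idx (- m - \<kappa>3). \<omega> b1 (e a) * \<omega> b2 (f a \<odot> e c) * \<omega> b3 (f c)) = \<omega> (b2 \<odot> b3 - b3 \<odot> b2) b1"
    if b1: "b1 \<in> grB (- m - \<kappa>1)" and b2: "b2 \<in> grB (- m - \<kappa>2)" and b3: "b3 \<in> grB (- m - \<kappa>3)"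
    for \<kappa>1 \<kappa>2 \<kappa>3 b1 b2 b3
  proof -
    have "(\<Sum>a\<in>B.idx (\<kappa>1). \<Sum>c\<in>B.idx (- m - \<kappa>3). \<omega> b1 (e a) * \<omega> b2 (f a \<odot> e c) * \<omega> b3 (f c)) =
        (\<Sum>a\<in>B.idx (\<kappa>1). \<omega> b1 (e a) * (\<Sum>c\<in>B.idx (- m - \<kappa>3). \<omega> (f a \<odot> b2) (e c) * \<omega> b3 (f c)))"
      by (simp add: B.form_L sum_distrib_left mult_ac)
    \<comment> \<open>The contraction over \<open>c\<close> leaves
      \<open>\<omega> b3 (f a \<odot> b2)\<close>; the adjoint of right multiplication then frees
      \<open>f a\<close> for the contraction over \<open>a\<close>.\<close>
    also have "\<dots> = (\<Sum>a\<in>B.idx (\<kappa>1). \<omega> b1 (e a) * \<omega> (b2 \<odot> b3 - b3 \<odot> b2) (f a))"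
      by (simp only: B.contract_f[OF b3]) (simp only: B.form_R B.form_R')
    also have "\<dots> = \<omega> (b2 \<odot> b3 - b3 \<odot> b2) b1"
      by (rule B.contract_e[OF b1])
    finally show ?thesis .
  qed
  show ?thesis
    by (rule dtermI[OF r refl bilA bilP refl op_tens refl supp coeff])
qed

lemma dterm_yy':
  "dterm r (\<lambda>x y x' y'. A.cpure3 (x) (x') (op y y')) (\<lambda>b1 b2 b3. \<omega> (b2 \<odot> b3 - b3 \<odot> b2) b1) (\<lambda>l x y x' y'. l (x) (x') (opP y y'))"
proof -
  have bilA: "A.quadl (\<lambda>x y x' y'. \<beta> (x) (x') (op y y'))" if "trilinear_form sA \<beta>" for \<beta>
    using that op by (auto simp: A.quadl_def A.bil_iff A.tri_iff op_lin)
  have bilP: "P.quadl (\<lambda>x y x' y'. l (x) (x') (opP y y'))" if "trilinear_form sP l" for l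
    using that op by (auto simp: P.quadl_def P.bil_iff P.tri_iff opP_lin)
  have supp: "A.hcomp \<kappa>1 (x) = 0 \<or> A.hcomp \<kappa>2 (x') = 0 \<or> A.hcomp \<kappa>3 (op y y') = 0"
    if "x \<in> grA i" "y \<in> grA (- m - i)" "x' \<in> grA k" "y' \<in> grA (- m - k)" "(i, k) \<noteq> (\<kappa>1, \<kappa>2)"
    for \<kappa>1 \<kappa>2 \<kappa>3 i k x y x' y'
    using that A.hcomp_hom[of x "i" \<kappa>1] A.hcomp_hom[of x' "k" \<kappa>2]
    by auto
  have coeff: "(\<Sum>a\<in>B.idx (\<kappa>1). \<Sum>c\<in>B.idx (\<kappa>2). \<omega> b1 (e a) * \<omega> b2 (e c) * \<omega> b3 (f a \<odot> f c)) = \<omega> (b2 \<odot> b3 - b3 \<odot> b2) b1"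
    if b1: "b1 \<in> grB (- m - \<kappa>1)" and b2: "b2 \<in> grB (- m - \<kappa>2)" and b3: "b3 \<in> grB (- m - \<kappa>3)"
    for \<kappa>1 \<kappa>2 \<kappa>3 b1 b2 b3
  proof -
    have "(\<Sum>a\<in>B.idx (\<kappa>1). \<Sum>c\<in>B.idx (\<kappa>2). \<omega> b1 (e a) * \<omega> b2 (e c) * \<omega> b3 (f a \<odot> f c)) =
        (\<Sum>a\<in>B.idx (\<kappa>1). \<omega> b1 (e a) * (\<Sum>c\<in>B.idx (\<kappa>2). \<omega> b2 (e c) * \<omega> (f a \<odot> b3) (f c)))"
      by (simp add: B.form_L sum_distrib_left mult_ac)
    also have "\<dots> = (\<Sum>a\<in>B.idx (\<kappa>1). \<omega> b1 (e a) * \<omega> (b2 \<odot> b3 - b3 \<odot> b2) (f a))"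
      by (simp only: B.contract_e[OF b2]) (simp only: B.form_R B.form_R')
    also have "\<dots> = \<omega> (b2 \<odot> b3 - b3 \<odot> b2) b1"
      by (rule B.contract_e[OF b1])
    finally show ?thesis .
  qed
  show ?thesis
    by (rule dtermI[OF r refl bilA bilP refl refl op_tens supp coeff])
qed

text \<open>Now \<open>y\<close> and \<open>y'\<close> are the single letters, so the outer sum
  pairs \<open>f a\<close> with a test vector, and \<open>contract_f'\<close> takes the place of
  \<open>contract_e\<close>.\<close>

lemma dterm_xx':
  "dterm r (\<lambda>x y x' y'. A.cpure3 (op x x') (y) (y')) (\<lambda>b1 b2 b3. \<omega> b2 (b1 \<odot> b3 - b3 \<odot> b1)) (\<lambda>l x y x' y'. l (opP x x') (y) (y'))"
proof -
  have bilA: "A.quadl (\<lambda>x y x' y'. \<beta> (op x x') (y) (y'))" if "trilinear_form sA \<beta>" for \<beta>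
    using that op by (auto simp: A.quadl_def A.bil_iff A.tri_iff op_lin)
  have bilP: "P.quadl (\<lambda>x y x' y'. l (opP x x') (y) (y'))" if "trilinear_form sP l" for l
    using that op by (auto simp: P.quadl_def P.bil_iff P.tri_iff opP_lin)
  have supp: "A.hcomp \<kappa>1 (op x x') = 0 \<or> A.hcomp \<kappa>2 (y) = 0 \<or> A.hcomp \<kappa>3 (y') = 0"
    if "x \<in> grA i" "y \<in> grA (- m - i)" "x' \<in> grA k" "y' \<in> grA (- m - k)" "(i, k) \<noteq> (- m - \<kappa>2, - m - \<kappa>3)"
    for \<kappa>1 \<kappa>2 \<kappa>3 i k x y x' y'
    using that A.hcomp_hom[of y "- m - i" \<kappa>2] A.hcomp_hom[of y' "- m - k" \<kappa>3]
    by auto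
  have coeff: "(\<Sum>a\<in>B.idx (- m - \<kappa>2). \<Sum>c\<in>B.idx (- m - \<kappa>3). \<omega> b1 (e a \<odot> e c) * \<omega> b2 (f a) * \<omega> b3 (f c)) = \<omega> b2 (b1 \<odot> b3 - b3 \<odot> b1)"
    if b1: "b1 \<in> grB (- m - \<kappa>1)" and b2: "b2 \<in> grB (- m - \<kappa>2)" and b3: "b3 \<in> grB (- m - \<kappa>3)"
    for \<kappa>1 \<kappa>2 \<kappa>3 b1 b2 b3
  proof -
    have "(\<Sum>a\<in>B.idx (- m - \<kappa>2). \<Sum>c\<in>B.idx (- m - \<kappa>3). \<omega> b1 (e a \<odot> e c) * \<omega> b2 (f a) * \<omega> b3 (f c)) =
        (\<Sum>a\<in>B.idx (- m - \<kappa>2). \<omega> b2 (f a) * (\<Sum>c\<in>B.idx (- m - \<kappa>3). \<omega> (e a \<odot> b1) (e c) * \<omega> b3 (f c)))"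
      by (simp add: B.form_L sum_distrib_left mult_ac)
    also have "\<dots> = (\<Sum>a\<in>B.idx (- m - \<kappa>2). \<omega> b2 (f a) * \<omega> (b1 \<odot> b3 - b3 \<odot> b1) (e a))"
      by (simp only: B.contract_f[OF b3]) (simp only: B.form_R B.form_R')
    also have "\<dots> = \<omega> b2 (b1 \<odot> b3 - b3 \<odot> b1)"
      by (rule B.contract_f'[OF b2])
    finally show ?thesis .
  qed
  show ?thesis
    by (rule dtermI[OF r refl bilA bilP op_tens refl refl supp coeff])
qed

lemma dterm_xx'_swap:
  "dterm r (\<lambda>x y x' y'. A.cpure3 (op x x') (y') (y)) (\<lambda>b1 b2 b3. \<omega> b3 (b1 \<odot> b2 - b2 \<odot> b1)) (\<lambda>l x y x' y'. l (opP x x') (y') (y))"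
proof -
  have bilA: "A.quadl (\<lambda>x y x' y'. \<beta> (op x x') (y') (y))" if "trilinear_form sA \<beta>" for \<beta>
    using that op by (auto simp: A.quadl_def A.bil_iff A.tri_iff op_lin)
  have bilP: "P.quadl (\<lambda>x y x' y'. l (opP x x') (y') (y))" if "trilinear_form sP l" for l
    using that op by (auto simp: P.quadl_def P.bil_iff P.tri_iff opP_lin)
  have supp: "A.hcomp \<kappa>1 (op x x') = 0 \<or> A.hcomp \<kappa>2 (y') = 0 \<or> A.hcomp \<kappa>3 (y) = 0"
    if "x \<in> grA i" "y \<in> grA (- m - i)" "x' \<in> grA k" "y' \<in> grA (- m - k)" "(i, k) \<noteq> (- m - \<kappa>3, - m - \<kappa>2)"
    for \<kappa>1 \<kappa>2 \<kappa>3 i k x y x' y'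
    using that A.hcomp_hom[of y' "- m - k" \<kappa>2] A.hcomp_hom[of y "- m - i" \<kappa>3]
    by auto
  have coeff: "(\<Sum>a\<in>B.idx (- m - \<kappa>3). \<Sum>c\<in>B.idx (- m - \<kappa>2). \<omega> b1 (e a \<odot> e c) * \<omega> b2 (f c) * \<omega> b3 (f a)) = \<omega> b3 (b1 \<odot> b2 - b2 \<odot> b1)"
    if b1: "b1 \<in> grB (- m - \<kappa>1)" and b2: "b2 \<in> grB (- m - \<kappa>2)" and b3: "b3 \<in> grB (- m - \<kappa>3)"
    for \<kappa>1 \<kappa>2 \<kappa>3 b1 b2 b3
  proof -
    have "(\<Sum>a\<in>B.idx (- m - \<kappa>3). \<Sum>c\<in>B.idx (- m - \<kappa>2). \<omega> b1 (e a \<odot> e c) * \<omega> b2 (f c) * \<omega> b3 (f a)) =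
        (\<Sum>a\<in>B.idx (- m - \<kappa>3). \<omega> b3 (f a) * (\<Sum>c\<in>B.idx (- m - \<kappa>2). \<omega> (e a \<odot> b1) (e c) * \<omega> b2 (f c)))"
      by (simp add: B.form_L sum_distrib_left mult_ac)
    also have "\<dots> = (\<Sum>a\<in>B.idx (- m - \<kappa>3). \<omega> b3 (f a) * \<omega> (b1 \<odot> b2 - b2 \<odot> b1) (e a))"
      by (simp only: B.contract_f[OF b2]) (simp only: B.form_R B.form_R')
    also have "\<dots> = \<omega> b3 (b1 \<odot> b2 - b2 \<odot> b1)"
      by (rule B.contract_f'[OF b3])
    finally show ?thesis .
  qed
  show ?thesis
    by (rule dtermI[OF r refl bilA bilP op_tens refl refl supp coeff])
qed

lemma dterm_xy':
  "dterm r (\<lambda>x y x' y'. A.cpure3 (x') (op x y') (y)) (\<lambda>b1 b2 b3. \<omega> b3 (b1 \<odot> b2 - b2 \<odot> b1)) (\<lambda>l x y x' y'. l (x') (opP x y') (y))"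
proof -
  have bilA: "A.quadl (\<lambda>x y x' y'. \<beta> (x') (op x y') (y))" if "trilinear_form sA \<beta>" for \<beta>
    using that op by (auto simp: A.quadl_def A.bil_iff A.tri_iff op_lin)
  have bilP: "P.quadl (\<lambda>x y x' y'. l (x') (opP x y') (y))" if "trilinear_form sP l" for l
    using that op by (auto simp: P.quadl_def P.bil_iff P.tri_iff opP_lin)
  have supp: "A.hcomp \<kappa>1 (x') = 0 \<or> A.hcomp \<kappa>2 (op x y') = 0 \<or> A.hcomp \<kappa>3 (y) = 0"
    if "x \<in> grA i" "y \<in> grA (- m - i)" "x' \<in> grA k" "y' \<in> grA (- m - k)" "(i, k) \<noteq> (- m - \<kappa>3, \<kappa>1)"
    for \<kappa>1 \<kappa>2 \<kappa>3 i k x y x' y'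
    using that A.hcomp_hom[of x' "k" \<kappa>1] A.hcomp_hom[of y "- m - i" \<kappa>3]
    by auto
  have coeff: "(\<Sum>a\<in>B.idx (- m - \<kappa>3). \<Sum>c\<in>B.idx (\<kappa>1). \<omega> b1 (e c) * \<omega> b2 (e a \<odot> f c) * \<omega> b3 (f a)) = \<omega> b3 (b1 \<odot> b2 - b2 \<odot> b1)"
    if b1: "b1 \<in> grB (- m - \<kappa>1)" and b2: "b2 \<in> grB (- m - \<kappa>2)" and b3: "b3 \<in> grB (- m - \<kappa>3)"
    for \<kappa>1 \<kappa>2 \<kappa>3 b1 b2 b3
  proof -
    have "(\<Sum>a\<in>B.idx (- m - \<kappa>3). \<Sum>c\<in>B.idx (\<kappa>1). \<omega> b1 (e c) * \<omega> b2 (e a \<odot> f c) * \<omega> b3 (f a)) =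
        (\<Sum>a\<in>B.idx (- m - \<kappa>3). \<omega> b3 (f a) * (\<Sum>c\<in>B.idx (\<kappa>1). \<omega> b1 (e c) * \<omega> (e a \<odot> b2) (f c)))"
      by (simp add: B.form_L sum_distrib_left mult_ac)
    also have "\<dots> = (\<Sum>a\<in>B.idx (- m - \<kappa>3). \<omega> b3 (f a) * \<omega> (b1 \<odot> b2 - b2 \<odot> b1) (e a))"
      by (simp only: B.contract_e[OF b1]) (simp only: B.form_R B.form_R')
    also have "\<dots> = \<omega> b3 (b1 \<odot> b2 - b2 \<odot> b1)"
      by (rule B.contract_f'[OF b3])
    finally show ?thesis .
  qed
  show ?thesis
    by (rule dtermI[OF r refl bilA bilP refl op_tens refl supp coeff])
qed

lemma dterm_yy'_swap:
  "dterm r (\<lambda>x y x' y'. A.cpure3 (x') (x) (op y y')) (\<lambda>b1 b2 b3. \<omega> (b1 \<odot> b3 - b3 \<odot> b1) b2) (\<lambda>l x y x' y'. l (x') (x) (opP y y'))"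
proof -
  have bilA: "A.quadl (\<lambda>x y x' y'. \<beta> (x') (x) (op y y'))" if "trilinear_form sA \<beta>" for \<beta>
    using that op by (auto simp: A.quadl_def A.bil_iff A.tri_iff op_lin)
  have bilP: "P.quadl (\<lambda>x y x' y'. l (x') (x) (opP y y'))" if "trilinear_form sP l" for l
    using that op by (auto simp: P.quadl_def P.bil_iff P.tri_iff opP_lin)
  have supp: "A.hcomp \<kappa>1 (x') = 0 \<or> A.hcomp \<kappa>2 (x) = 0 \<or> A.hcomp \<kappa>3 (op y y') = 0"
    if "x \<in> grA i" "y \<in> grA (- m - i)" "x' \<in> grA k" "y' \<in> grA (- m - k)" "(i, k) \<noteq> (\<kappa>2, \<kappa>1)"
    for \<kappa>1 \<kappa>2 \<kappa>3 i k x y x' y'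
    using that A.hcomp_hom[of x' "k" \<kappa>1] A.hcomp_hom[of x "i" \<kappa>2]
    by auto
  have coeff: "(\<Sum>a\<in>B.idx (\<kappa>2). \<Sum>c\<in>B.idx (\<kappa>1). \<omega> b1 (e c) * \<omega> b2 (e a) * \<omega> b3 (f a \<odot> f c)) = \<omega> (b1 \<odot> b3 - b3 \<odot> b1) b2"
    if b1: "b1 \<in> grB (- m - \<kappa>1)" and b2: "b2 \<in> grB (- m - \<kappa>2)" and b3: "b3 \<in> grB (- m - \<kappa>3)"
    for \<kappa>1 \<kappa>2 \<kappa>3 b1 b2 b3
  proof -
    have "(\<Sum>a\<in>B.idx (\<kappa>2). \<Sum>c\<in>B.idx (\<kappa>1). \<omega> b1 (e c) * \<omega> b2 (e a) * \<omega> b3 (f a \<odot> f c)) =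
        (\<Sum>a\<in>B.idx (\<kappa>2). \<omega> b2 (e a) * (\<Sum>c\<in>B.idx (\<kappa>1). \<omega> b1 (e c) * \<omega> (f a \<odot> b3) (f c)))"
      by (simp add: B.form_L sum_distrib_left mult_ac)
    also have "\<dots> = (\<Sum>a\<in>B.idx (\<kappa>2). \<omega> b2 (e a) * \<omega> (b1 \<odot> b3 - b3 \<odot> b1) (f a))"
      by (simp only: B.contract_e[OF b1]) (simp only: B.form_R B.form_R')
    also have "\<dots> = \<omega> (b1 \<odot> b3 - b3 \<odot> b1) b2"
      by (rule B.contract_e[OF b2])
    finally show ?thesis .
  qed
  show ?thesis
    by (rule dtermI[OF r refl bilA bilP refl refl op_tens supp coeff])
qed

end

end

section \<open>The Yang-Baxter equation of P, evaluated on trilinear forms\<close>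

context poisson_algebra
begin

context
  fixes r V W assumes r: "r \<in> tprod V W"
begin

lemma dbl_add: "quadl H \<Longrightarrow> quadl K \<Longrightarrow>
    r (\<lambda>x y. r (\<lambda>x' y'. H x y x' y' + K x y x' y')) = r (\<lambda>x y. r (H x y)) + r (\<lambda>x y. r (K x y))"
  and dbl_diff: "quadl H \<Longrightarrow> quadl K \<Longrightarrow>
    r (\<lambda>x y. r (\<lambda>x' y'. H x y x' y' - K x y x' y')) = r (\<lambda>x y. r (H x y)) - r (\<lambda>x y. r (K x y))"
  using quadl_inner[of H, OF _ r] quadl_inner[of K, OF _ r]
  by (simp_all add: quadl_def tprod_add_form[OF r] tprod_diff_form[OF r])

lemma dbl_swap: "quadl H \<Longrightarrow> r (\<lambda>x y. r (H x y)) = r (\<lambda>x y. r (\<lambda>x' y'. H x' y' x y))"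
  by (rule tprod_Fubini[OF r r]) (simp_all add: quadl_def)

lemma dbl_minus: "quadl H \<Longrightarrow> r (\<lambda>x y. r (\<lambda>x' y'. - H x y x' y')) = - r (\<lambda>x y. r (H x y))"
  using dbl_diff[OF quadl_zero, of H] by (simp add: tprod_zero_form[OF r])

context
  fixes l assumes l: "trilinear_form scale l"
begin

lemma quadl_mul:
  "quadl (\<lambda>x y x' y'. l (x \<cdot> x') y y')" "quadl (\<lambda>x y x' y'. l x x' (y \<cdot> y'))"
  "quadl (\<lambda>x y x' y'. l x' (x \<cdot> y') y)" "quadl (\<lambda>x y x' y'. l (x \<cdot> x') y' y)"
  using l by (auto simp: quadl_def bil_iff tri_iff mul_lin)

lemma quadl_brk:
  "quadl (\<lambda>x y x' y'. l (brk x x') y y')" "quadl (\<lambda>x y x' y'. l x x' (brk y y'))"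
  "quadl (\<lambda>x y x' y'. l x (brk y x') y')" "quadl (\<lambda>x y x' y'. l x' (brk x y') y)"
  "quadl (\<lambda>x y x' y'. l x' x (brk y y'))"
  using l by (auto simp: quadl_def bil_iff tri_iff brk_lin)

text \<open>Exchanging the two copies of \<open>r\<close> and using commutativity brings the third
  term into the shape of the first monomial of the DPYBE.\<close>

lemma YBE_A_form: "YBE_A r l = r (\<lambda>x y. r (\<lambda>x' y'. l (x \<cdot> x') y y')) +
    r (\<lambda>x y. r (\<lambda>x' y'. l x x' (y \<cdot> y'))) - r (\<lambda>x y. r (\<lambda>x' y'. l x (y \<cdot> x') y'))"
proof -
  have "YBE_A r l = r (\<lambda>x y. r (\<lambda>x' y'. l (x \<cdot> x') y y' + l x x' (y \<cdot> y') - l x' (x \<cdot> y') y))"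
    by (simp add: YBE_A_def tsum2_def pure3_apply l)
  also have "\<dots> = r (\<lambda>x y. r (\<lambda>x' y'. l (x \<cdot> x') y y')) + r (\<lambda>x y. r (\<lambda>x' y'. l x x' (y \<cdot> y'))) -
      r (\<lambda>x y. r (\<lambda>x' y'. l x' (x \<cdot> y') y))"
    by (simp add: dbl_diff[OF quadl_add[OF quadl_mul(1,2)] quadl_mul(3)] dbl_add[OF quadl_mul(1,2)])
  also have "r (\<lambda>x y. r (\<lambda>x' y'. l x' (x \<cdot> y') y)) = r (\<lambda>x y. r (\<lambda>x' y'. l x (y \<cdot> x') y'))"
    by (subst dbl_swap[OF quadl_mul(3)]) (simp add: mul_comm)
  finally show ?thesis .
qed

lemma dbl_mul_swap: "r (\<lambda>x y. r (\<lambda>x' y'. l (x \<cdot> x') y' y)) = r (\<lambda>x y. r (\<lambda>x' y'. l (x \<cdot> x') y y'))"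
  by (subst dbl_swap[OF quadl_mul(4)]) (simp add: mul_comm)

lemma YBE_C_form: "YBE_C r l = r (\<lambda>x y. r (\<lambda>x' y'. l (brk x x') y y')) +
    r (\<lambda>x y. r (\<lambda>x' y'. l x x' (brk y y'))) + r (\<lambda>x y. r (\<lambda>x' y'. l x (brk y x') y'))"
  by (simp add: YBE_C_def tsum2_def pure3_apply l dbl_add[OF quadl_brk(1,2)]
      dbl_add[OF quadl_add[OF quadl_brk(1,2)] quadl_brk(3)])

lemma tri_minus: "l x (- y) z = - l x y z" "l x y (- z) = - l x y z"
  by (rule additive_minus[of "\<lambda>y. l x y z"] additive_minus[of "l x y"]; use l in \<open>simp add: tri_iff\<close>)+

text \<open>Exchanging the two copies of \<open>r\<close> reverses the arguments of the bracket. The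
  four bracket monomials of the DPYBE thereby reduce to the three of \<open>YBE_C\<close>.\<close>

lemma dbl_brk_swap:
  "r (\<lambda>x y. r (\<lambda>x' y'. l x' (brk x y') y)) = - r (\<lambda>x y. r (\<lambda>x' y'. l x (brk y x') y'))"
  "r (\<lambda>x y. r (\<lambda>x' y'. l x' x (brk y y'))) = - r (\<lambda>x y. r (\<lambda>x' y'. l x x' (brk y y')))"
proof -
  have skew: "l u (brk v w) z = - l u (brk w v) z" "l u z (brk v w) = - l u z (brk w v)" for u v w z
    by (subst brk_skew, rule tri_minus)+
  have "r (\<lambda>x y. r (\<lambda>x' y'. l x' (brk x y') y)) = r (\<lambda>x y. r (\<lambda>x' y'. l x (brk x' y) y'))"
    by (rule dbl_swap[OF quadl_brk(4)])
  also have "\<dots> = r (\<lambda>x y. r (\<lambda>x' y'. - l x (brk y x') y'))"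
    by (intro arg_cong[of _ _ r] ext) (rule skew)
  finally show "r (\<lambda>x y. r (\<lambda>x' y'. l x' (brk x y') y)) = - r (\<lambda>x y. r (\<lambda>x' y'. l x (brk y x') y'))"
    by (simp only: dbl_minus[OF quadl_brk(3)])
  have "r (\<lambda>x y. r (\<lambda>x' y'. l x' x (brk y y'))) = r (\<lambda>x y. r (\<lambda>x' y'. l x x' (brk y' y)))"
    by (rule dbl_swap[OF quadl_brk(5)])
  also have "\<dots> = r (\<lambda>x y. r (\<lambda>x' y'. - l x x' (brk y y')))"
    by (intro arg_cong[of _ _ r] ext) (rule skew)
  finally show "r (\<lambda>x y. r (\<lambda>x' y'. l x' x (brk y y'))) = - r (\<lambda>x y. r (\<lambda>x' y'. l x x' (brk y y')))"
    by (simp only: dbl_minus[OF quadl_brk(2)])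
qed

end

end

end

context affinization_algebra
begin

text \<open>At the dual basis vectors \<open>b1\<close>, \<open>b2\<close>, \<open>b3\<close> the
  relation \<open>form_three\<close> eliminates one coefficient. The first equation becomes
  \<open>- \<omega> (b2 \<odot> b3 - b3 \<odot> b2) b1\<close> times \<open>YBE_A r\<close>, the
  second \<open>\<omega> b2 (b1 \<odot> b3 - b3 \<odot> b1)\<close> times \<open>YBE_C r\<close>,
  both evaluated on a trilinear form.\<close>

lemma DPYBE_lift:
  assumes r: "r \<in> P.tprod UNIV UNIV" and ybe: "P.PoiYBE r"
  shows "D.DPYBE (lift r)"
proof -
  note s = lift_in[OF r]
  have ops: "(circ, mul) \<in> {(circ, mul), (ast, brk)}" "(ast, brk) \<in> {(circ, mul), (ast, brk)}"
    by auto
  note t1 = dtermD[OF dterm_yx'[OF r ops(1)]] and t2 = dtermD[OF dterm_yy'[OF r ops(1)]]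
    and t3 = dtermD[OF dterm_xx'[OF r ops(1)]] and t4 = dtermD[OF dterm_xx'_swap[OF r ops(1)]]
    and t5 = dtermD[OF dterm_xx'[OF r ops(2)]] and t6 = dtermD[OF dterm_yx'[OF r ops(2)]]
    and t7 = dtermD[OF dterm_xy'[OF r ops(2)]] and t8 = dtermD[OF dterm_yy'_swap[OF r ops(2)]]
  \<comment> \<open>Each partial combination carries along its summability and its multilinearity,
    which the next splitting requires.\<close>
  note a1 = D.double_sum_diff[OF s t1(1,2) t2(1,2)]
  note a2 = D.double_sum_add[OF s a1(3,2) t3(1,2)]
  note a3 = D.double_sum_diff[OF s a2(3,2) t4(1,2)]
  note c1 = D.double_sum_diff[OF s t5(1,2) t6(1,2)]
  note c2 = D.double_sum_diff[OF s c1(3,2) t7(1,2)]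
  note c3 = D.double_sum_add[OF s c2(3,2) t8(1,2)]
  have A: "r (\<lambda>x y. r (\<lambda>x' y'. l x (y \<cdot> x') y')) =
      r (\<lambda>x y. r (\<lambda>x' y'. l (x \<cdot> x') y y')) + r (\<lambda>x y. r (\<lambda>x' y'. l x x' (y \<cdot> y')))"
    and C: "r (\<lambda>x y. r (\<lambda>x' y'. l (brk x x') y y')) = - r (\<lambda>x y. r (\<lambda>x' y'. l x x' (brk y y'))) -
      r (\<lambda>x y. r (\<lambda>x' y'. l x (brk y x') y'))"
    if "trilinear_form sP l" for l
    using P.YBE_A_form[OF r that] P.YBE_C_form[OF r that] ybe
    by (simp_all add: P.PoiYBE_def algebra_simps eq_neg_iff_add_eq_0)
  have "D.double_sum (lift r) (\<lambda>x y x' y'. A.cpure3 x (circ y x') y' - A.cpure3 x x' (circ y y') +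
      A.cpure3 (circ x x') y y' - A.cpure3 (circ x x') y' y) (\<kappa>1, \<kappa>2, \<kappa>3) \<beta> = 0" for \<kappa>1 \<kappa>2 \<kappa>3 \<beta>
  proof (cases "trilinear_form sA \<beta>")
    case True
    note tri = tri3[OF True]
    have "\<omega> (f v \<odot> f w - f w \<odot> f v) (f u) * r (\<lambda>x y. r (\<lambda>x' y'. l x (y \<cdot> x') y')) -
        \<omega> (f v \<odot> f w - f w \<odot> f v) (f u) * r (\<lambda>x y. r (\<lambda>x' y'. l x x' (y \<cdot> y'))) +
        \<omega> (f v) (f u \<odot> f w - f w \<odot> f u) * r (\<lambda>x y. r (\<lambda>x' y'. l (x \<cdot> x') y y')) -
        \<omega> (f w) (f u \<odot> f v - f v \<odot> f u) * r (\<lambda>x y. r (\<lambda>x' y'. l (x \<cdot> x') y' y)) = 0"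
      if "trilinear_form sP l" for l u v w
      by (simp only: A[OF that] P.dbl_mul_swap[OF r that] B.form_three[of "f v" "f u" "f w"])
        (simp add: algebra_simps)
    note zero = this[OF tri]
    show ?thesis
      by (simp add: a3(1) a2(1) a1(1) t1(3) t2(3) t3(3) t4(3) True del: right_minus_eq)
        (simp only: sum.distrib[symmetric] sum_subtractf[symmetric] zero sum.neutral_const)
  qed (simp add: a3(1) a2(1) a1(1) t1(3) t2(3) t3(3) t4(3))
  moreover have "D.double_sum (lift r) (\<lambda>x y x' y'. A.cpure3 (ast x x') y y' - A.cpure3 x (ast y x') y' -
      A.cpure3 x' (ast x y') y + A.cpure3 x' x (ast y y')) (\<kappa>1, \<kappa>2, \<kappa>3) \<beta> = 0" for \<kappa>1 \<kappa>2 \<kappa>3 \<beta>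
  proof (cases "trilinear_form sA \<beta>")
    case True
    note tri = tri3[OF True]
    \<comment> \<open>By \<open>form_three\<close> this fourth coefficient is the negative of the
      one of the monomial with \<open>x\<close> times \<open>x'\<close>.\<close>
    have skew: "\<omega> (b1 \<odot> b3 - b3 \<odot> b1) b2 = \<omega> (b2 \<odot> b3 - b3 \<odot> b2) b1 - \<omega> b3 (b1 \<odot> b2 - b2 \<odot> b1)"
      for b1 b2 b3
      using B.form_three[of b2 b1 b3] B.form_skew[of "b1 \<odot> b3 - b3 \<odot> b1" b2] by simp
    have "\<omega> (f v) (f u \<odot> f w - f w \<odot> f u) * r (\<lambda>x y. r (\<lambda>x' y'. l (brk x x') y y')) -
        \<omega> (f v \<odot> f w - f w \<odot> f v) (f u) * r (\<lambda>x y. r (\<lambda>x' y'. l x (brk y x') y')) -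
        \<omega> (f w) (f u \<odot> f v - f v \<odot> f u) * r (\<lambda>x y. r (\<lambda>x' y'. l x' (brk x y') y)) +
        \<omega> (f u \<odot> f w - f w \<odot> f u) (f v) * r (\<lambda>x y. r (\<lambda>x' y'. l x' x (brk y y'))) = 0"
      if "trilinear_form sP l" for l u v w
      by (simp only: C[OF that] P.dbl_brk_swap[OF r that] B.form_three[of "f v" "f u" "f w"]
          skew[of "f u" "f w" "f v"]) (simp add: algebra_simps)
    note zero = this[OF tri]
    show ?thesis
      by (simp add: c3(1) c2(1) c1(1) t5(3) t6(3) t7(3) t8(3) True)
        (simp only: sum.distrib[symmetric] sum_subtractf[symmetric] zero sum.neutral_const)
  qed (simp add: c3(1) c2(1) c1(1) t5(3) t6(3) t7(3) t8(3))
  ultimately show ?thesis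
    unfolding D.DPYBE_def D.DPYBE_defined_def
    using t1(2) t2(2) t3(2) t4(2) t5(2) t6(2) t7(2) t8(2)
    by (auto simp: fun_eq_iff)
qed

end

section \<open>Transfer of coboundary, quasi-triangular and triangular structures\<close>

context affinization_bialgebra
begin

lemma coboundary_lift:
  assumes r: "r \<in> P.tprod UNIV UNIV" and "\<Delta> = P.Delta_of r" "\<delta> = P.delta_of r"
  shows "\<nu> = D.nu_of (lift r)" "\<theta> = D.theta_of (lift r)"
proof -
  show "\<nu> = D.nu_of (lift r)"
    by (rule tfam_eqI[OF tfam_structure(1) nu_of_tfam(1)[OF lift_in[OF r]]])
      (simp add: co_nu co_nu_of_lift[OF r] assms(2))
  show "\<theta> = D.theta_of (lift r)"
    by (rule tfam_eqI[OF tfam_structure(2) nu_of_tfam(2)[OF lift_in[OF r]]])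
      (simp add: co_theta co_nu_of_lift[OF r] assms(3))
qed

lemma coboundary_A: "P.coboundary \<Longrightarrow> H.coboundary"
  unfolding P.coboundary_def H.coboundary_def using coboundary_lift lift_in by blast

text \<open>The sign in \<open>lift_flip\<close> turns the difference of the lift and its flip into
  the lift of the sum \<open>r + P.flip r\<close>, whose invariance is given.\<close>

lemma quasi_triangular_A: "P.quasi_triangular \<Longrightarrow> H.quasi_triangular"
proof -
  assume "P.quasi_triangular"
  then obtain r where r: "r \<in> P.tprod UNIV UNIV" "\<Delta> = P.Delta_of r" "\<delta> = P.delta_of r"
    and ybe: "P.PoiYBE r" and inv: "P.poi_invariant (r + P.flip r)"
    unfolding P.quasi_triangular_def by blast
  have fr: "P.flip r \<in> P.tprod UNIV UNIV" by (rule P.flip_in[OF r(1) P.subspace_UNIV])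
  have "lift r - A.cflip (lift r) = lift (r + P.flip r)"
    by (simp add: lift_flip[OF r(1)] lift_add[OF r(1) fr])
  then have "D.dp_invariant (lift r - A.cflip (lift r))"
    using dp_invariant_lift[OF P.tprod_add[OF r(1) fr] inv] by simp
  then show "H.quasi_triangular"
    unfolding H.quasi_triangular_def
    using coboundary_lift[OF r] lift_in[OF r(1)] DPYBE_lift[OF r(1) ybe] by blast
qed

lemma triangular_A: "P.triangular \<Longrightarrow> H.triangular"
proof -
  assume "P.triangular"
  then obtain r where r: "r \<in> P.tprod UNIV UNIV" "\<Delta> = P.Delta_of r" "\<delta> = P.delta_of r"
    and ybe: "P.PoiYBE r" and skew: "P.flip r = - r"
    unfolding P.triangular_def by blast
  have "A.cflip (lift r) = lift r"
    by (simp add: lift_flip[OF r(1)] skew lift_minus[OF r(1)])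
  then show "H.triangular"
    unfolding H.triangular_def
    using coboundary_lift[OF r] lift_in[OF r(1)] DPYBE_lift[OF r(1) ybe] by blast
qed

end

theorem theorem4p20:
  fixes sP :: "'k::field_char_0 \<Rightarrow> 'p::ab_group_add \<Rightarrow> 'p"
    and mul brk :: "'p \<Rightarrow> 'p \<Rightarrow> 'p"
    and \<Delta> \<delta> :: "'p \<Rightarrow> ('p, 'k) tensor2"
    and sB :: "'k \<Rightarrow> 'b::ab_group_add \<Rightarrow> 'b"
    and grB :: "int \<Rightarrow> 'b set"
    and circB :: "'b \<Rightarrow> 'b \<Rightarrow> 'b"
    and \<omega> :: "'b \<Rightarrow> 'b \<Rightarrow> 'k"
    and sA :: "'k \<Rightarrow> 'a::ab_group_add \<Rightarrow> 'a"
    and tens :: "'p \<Rightarrow> 'b \<Rightarrow> 'a"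
    and circ ast :: "'a \<Rightarrow> 'a \<Rightarrow> 'a"
    and \<nu> \<theta> :: "'a \<Rightarrow> ('a, 'k) ctensor2"
    and grA :: "int \<Rightarrow> 'a set"
  assumes "poisson_bialgebra sP mul brk \<Delta> \<delta>"
    and "\<exists>basis. finite_dimensional_vector_space sP basis"
    and "quadratic_graded_perm_algebra sB grB circB \<omega>"
    and "tensor_product sP sB sA tens"
    and "grA = tensor_grading sA tens grB"
    and "bilinear_map sA sA sA circ"
    and "\<forall>p1 b1 p2 b2. circ (tens p1 b1) (tens p2 b2) = tens (mul p1 p2) (circB b1 b2)"
    and "bilinear_map sA sA sA ast"
    and "\<forall>p1 b1 p2 b2. ast (tens p1 b1) (tens p2 b2) = tens (brk p1 p2) (circB b1 b2)"
    and "Vector_Spaces.linear sA cscale \<nu>"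
    and "\<forall>p b. \<nu> (tens p b) = bullet sA tens (\<Delta> p) (quadratic_graded_perm_algebra.nu_form sB grB circB \<omega> b)"
    and "Vector_Spaces.linear sA cscale \<theta>"
    and "\<forall>p b. \<theta> (tens p b) = bullet sA tens (\<delta> p) (quadratic_graded_perm_algebra.nu_form sB grB circB \<omega> b)"
  shows "(\<forall>(I :: 'i set) x y r (\<Omega> :: 'j set) e f.
            finite I \<and> r = (\<Sum>i\<in>I. tensor_powers.pure2 sP (x i) (y i)) \<and>
            \<Delta> = poisson_algebra.Delta_of sP mul r \<and> \<delta> = poisson_algebra.delta_of sP brk r \<and>
            quadratic_graded_perm_algebra.homogeneous_dual_bases sB grB \<omega> \<Omega> e f \<longrightarrow>
            (let T = lift_terms sA grA tens x y e f; rhat = formal_sum (I \<times> \<Omega>) T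
             in locally_finite (I \<times> \<Omega>) T \<and> rhat \<in> graded_space.ctensor sA grA \<and>
                \<nu> = graded_dpp_algebra.nu_of sA grA circ rhat \<and>
                \<theta> = graded_dpp_algebra.theta_of sA grA ast rhat))
       \<and> (poisson_bialgebra.coboundary sP mul brk \<Delta> \<delta> \<longrightarrow>
            completed_dpp_bialgebra sA grA circ ast \<nu> \<theta> \<and>
            completed_dpp_bialgebra.coboundary sA grA circ ast \<nu> \<theta>)
       \<and> (poisson_bialgebra.quasi_triangular sP mul brk \<Delta> \<delta> \<longrightarrow>
            completed_dpp_bialgebra sA grA circ ast \<nu> \<theta> \<and>
            completed_dpp_bialgebra.quasi_triangular sA grA circ ast \<nu> \<theta>)
       \<and> (poisson_bialgebra.triangular sP mul brk \<Delta> \<delta> \<longrightarrow>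
            completed_dpp_bialgebra sA grA circ ast \<nu> \<theta> \<and>
            completed_dpp_bialgebra.triangular sA grA circ ast \<nu> \<theta>)"
proof -
  interpret P0: poisson_bialgebra sP mul brk \<Delta> \<delta> by (rule assms(1))
  interpret B0: quadratic_graded_perm_algebra sB grB circB \<omega> by (rule assms(3))
  obtain m where m: "\<And>i j x y. i + j + m \<noteq> 0 \<Longrightarrow> x \<in> grB i \<Longrightarrow> y \<in> grB j \<Longrightarrow> \<omega> x y = 0"
    using B0.form_graded by blast
  \<comment> \<open>The index type stays general: the locale is used with the given bases and again
    with constructed ones, indexed by elements of \<open>B\<close>.\<close>
  have loc: "affinization_bialgebra sP mul brk sB grB circB \<omega> m \<Omega> e f sA tens grA circ ast \<Delta> \<delta> \<nu> \<theta>"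
    if "B0.homogeneous_dual_bases \<Omega> e f" for \<Omega> :: "'x set" and e f
  proof -
    have "quadratic_dual_bases sB grB circB \<omega> m \<Omega> e f"
      using assms(3) m that
      by (auto simp: quadratic_dual_bases_def quadratic_dual_bases_axioms_def)
    moreover have "affinization_axioms sP sB grB sA tens grA"
      using assms(2,4,5) by (simp add: affinization_axioms_def)
    moreover have "affinization_algebra_axioms mul brk circB sA tens circ ast"
      using assms(6-9) by (simp add: affinization_algebra_axioms_def)
    moreover have "affinization_bialgebra_axioms sB grB circB \<omega> sA tens \<Delta> \<delta> \<nu> \<theta>"
      using assms(10-13) by (simp add: affinization_bialgebra_axioms_def)
    ultimately show ?thesis
      using P0.poisson_algebra_axioms assms(1)
      by (simp add: affinization_bialgebra_def affinization_algebra_def affinization_def)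
  qed
  have first: "let T = lift_terms sA grA tens x y e f; rhat = formal_sum (I \<times> \<Omega>) T
      in locally_finite (I \<times> \<Omega>) T \<and> rhat \<in> graded_space.ctensor sA grA \<and>
         \<nu> = graded_dpp_algebra.nu_of sA grA circ rhat \<and>
         \<theta> = graded_dpp_algebra.theta_of sA grA ast rhat"
    if I: "finite I" and r: "r = (\<Sum>i\<in>I. tensor_powers.pure2 sP (x i) (y i))"
      and \<Delta>: "\<Delta> = poisson_algebra.Delta_of sP mul r" and \<delta>: "\<delta> = poisson_algebra.delta_of sP brk r"
      and bases: "quadratic_graded_perm_algebra.homogeneous_dual_bases sB grB \<omega> \<Omega> e f"
    for I :: "'i set" and x y r and \<Omega> :: "'j set" and e f
  proof -
    interpret affinization_bialgebra sP mul brk sB grB circB \<omega> m \<Omega> e f sA tens grA circ ast \<Delta> \<delta> \<nu> \<theta>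
      by (rule loc[OF bases])
    have "r \<in> P0.tprod UNIV UNIV"
      unfolding r by (intro P0.tprod_sum P0.tprod_pure2) auto
    then show ?thesis
      using lift_eq_formal_sum[OF I, of x y] lift_in coboundary_lift[OF _ \<Delta> \<delta>]
      by (simp add: r Let_def)
  qed
  \<comment> \<open>The remaining claims mention no bases, so some have to be provided.\<close>
  obtain \<Omega> :: "'b set" and e f where "B0.homogeneous_dual_bases \<Omega> e f"
    using B0.homogeneous_dual_bases_exist by blast
  then interpret affinization_bialgebra sP mul brk sB grB circB \<omega> m \<Omega> e f sA tens grA circ ast \<Delta> \<delta> \<nu> \<theta>
    by (rule loc)
  show ?thesis
    using first completed_dpp_bialgebra_A coboundary_A quasi_triangular_A triangular_A by blast
qed

end
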